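(* Let $Q$ be a finite quiver without oriented cycles and $k$ a finite field. Then the composition algebra $\mathcal C(kQ)$ contains the subalgebra $\mathcal P(kQ)$ of the Hall algebra $\mathcal H(kQ)$ generated by the isomorphism classes of all preprojective modules, and it contains the subalgebra $\mathcal I(kQ)$ generated by the isomorphism classes of all preinjective modules.
   Context: The Hall algebra $\mathcal H(kQ)$ is the $\mathbb Q$-algebra with basis the isomorphism classes $[M]$ of finite-dimensional $kQ$-modules and product $[M][N]=\sum_{[X]}F^X_{MN}[X]$, where $F^X_{MN}=|\{Y\subseteq X: X/Y\cong M,\ Y\cong N\}|$. The composition algebra $\mathcal C(kQ)$ is the subalgebra generated by the isomorphism classes of the simple modules. *)

theory Defs
  imports Complex_Main "HOL-Library.Function_Algebras"
begin

text \<open>Representations of a finite quiver (vertex set V, arrow set E, source/target maps)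
  over a field 'k.  The vector space at a vertex i is k^(d i), realised as the
  functions nat => 'k vanishing from index d i on.  Linear maps are functions
  on these spaces (their values outside the space are irrelevant).\<close>

record ('v, 'e, 'k) qrep =
  rdim :: "'v \<Rightarrow> nat"
  rmap :: "'e \<Rightarrow> (nat \<Rightarrow> 'k) \<Rightarrow> (nat \<Rightarrow> 'k)"

definition kvec :: "nat \<Rightarrow> (nat \<Rightarrow> 'k::zero) set" where
  "kvec n = {x. \<forall>j\<ge>n. x j = 0}"

definition vscale :: "'k::times \<Rightarrow> (nat \<Rightarrow> 'k) \<Rightarrow> (nat \<Rightarrow> 'k)" where
  "vscale c x = (\<lambda>j. c * x j)"

definition lin_on :: "nat \<Rightarrow> nat \<Rightarrow> ((nat \<Rightarrow> 'k::field) \<Rightarrow> (nat \<Rightarrow> 'k)) \<Rightarrow> bool" where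
  "lin_on n m f \<longleftrightarrow> (\<forall>x\<in>kvec n. f x \<in> kvec m)
     \<and> (\<forall>x\<in>kvec n. \<forall>y\<in>kvec n. f (x + y) = f x + f y)
     \<and> (\<forall>c. \<forall>x\<in>kvec n. f (vscale c x) = vscale c (f x))"

definition ksubspace :: "nat \<Rightarrow> (nat \<Rightarrow> 'k::field) set \<Rightarrow> bool" where
  "ksubspace n U \<longleftrightarrow> U \<subseteq> kvec n \<and> 0 \<in> U
     \<and> (\<forall>x\<in>U. \<forall>y\<in>U. x + y \<in> U) \<and> (\<forall>c. \<forall>x\<in>U. vscale c x \<in> U)"

locale quiver =
  fixes V :: "'v set" and E :: "'e set" and src :: "'e \<Rightarrow> 'v" and tgt :: "'e \<Rightarrow> 'v"
begin

definition wf_rep :: "('v, 'e, 'k::field) qrep \<Rightarrow> bool" where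
  "wf_rep X \<longleftrightarrow> (\<forall>i. i \<notin> V \<longrightarrow> rdim X i = 0)
     \<and> (\<forall>a\<in>E. lin_on (rdim X (src a)) (rdim X (tgt a)) (rmap X a))"

definition is_hom :: "('v, 'e, 'k::field) qrep \<Rightarrow> ('v, 'e, 'k) qrep
     \<Rightarrow> ('v \<Rightarrow> (nat \<Rightarrow> 'k) \<Rightarrow> (nat \<Rightarrow> 'k)) \<Rightarrow> bool" where
  "is_hom X Y f \<longleftrightarrow> (\<forall>i\<in>V. lin_on (rdim X i) (rdim Y i) (f i))
     \<and> (\<forall>a\<in>E. \<forall>x\<in>kvec (rdim X (src a)).
           f (tgt a) (rmap X a x) = rmap Y a (f (src a) x))"

definition hom_comp_eq :: "('v, 'e, 'k::field) qrep
     \<Rightarrow> ('v \<Rightarrow> (nat \<Rightarrow> 'k) \<Rightarrow> (nat \<Rightarrow> 'k)) \<Rightarrow> ('v \<Rightarrow> (nat \<Rightarrow> 'k) \<Rightarrow> (nat \<Rightarrow> 'k))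
     \<Rightarrow> ('v \<Rightarrow> (nat \<Rightarrow> 'k) \<Rightarrow> (nat \<Rightarrow> 'k)) \<Rightarrow> bool" where
  "hom_comp_eq X g f h \<longleftrightarrow> (\<forall>i\<in>V. \<forall>x\<in>kvec (rdim X i). g i (f i x) = h i x)"

definition hom_id :: "'v \<Rightarrow> (nat \<Rightarrow> 'k) \<Rightarrow> (nat \<Rightarrow> 'k)" where
  "hom_id = (\<lambda>i x. x)"

definition hom_surj :: "('v, 'e, 'k::field) qrep \<Rightarrow> ('v, 'e, 'k) qrep
     \<Rightarrow> ('v \<Rightarrow> (nat \<Rightarrow> 'k) \<Rightarrow> (nat \<Rightarrow> 'k)) \<Rightarrow> bool" where
  "hom_surj X Y f \<longleftrightarrow> (\<forall>i\<in>V. f i ` kvec (rdim X i) = kvec (rdim Y i))"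

definition hom_inj :: "('v, 'e, 'k::field) qrep
     \<Rightarrow> ('v \<Rightarrow> (nat \<Rightarrow> 'k) \<Rightarrow> (nat \<Rightarrow> 'k)) \<Rightarrow> bool" where
  "hom_inj X f \<longleftrightarrow> (\<forall>i\<in>V. inj_on (f i) (kvec (rdim X i)))"

definition rep_iso :: "('v, 'e, 'k::field) qrep \<Rightarrow> ('v, 'e, 'k) qrep \<Rightarrow> bool" where
  "rep_iso X Y \<longleftrightarrow> (\<exists>f. is_hom X Y f \<and> hom_inj X f \<and> hom_surj X Y f)"

definition subrep :: "('v, 'e, 'k::field) qrep \<Rightarrow> ('v \<Rightarrow> (nat \<Rightarrow> 'k) set) \<Rightarrow> bool" where
  "subrep X U \<longleftrightarrow> (\<forall>i. ksubspace (rdim X i) (U i))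
     \<and> (\<forall>a\<in>E. rmap X a ` U (src a) \<subseteq> U (tgt a))"

definition is_zero_rep :: "('v, 'e, 'k::field) qrep \<Rightarrow> bool" where
  "is_zero_rep X \<longleftrightarrow> (\<forall>i\<in>V. rdim X i = 0)"

definition simple_rep :: "('v, 'e, 'k::field) qrep \<Rightarrow> bool" where
  "simple_rep X \<longleftrightarrow> wf_rep X \<and> \<not> is_zero_rep X
     \<and> (\<forall>U. subrep X U \<longrightarrow> (\<forall>i\<in>V. U i = {0}) \<or> (\<forall>i\<in>V. U i = kvec (rdim X i)))"

definition indecomposable :: "('v, 'e, 'k::field) qrep \<Rightarrow> bool" where
  "indecomposable X \<longleftrightarrow> wf_rep X \<and> \<not> is_zero_rep X
     \<and> (\<forall>U W. subrep X U \<and> subrep X W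
          \<and> (\<forall>i\<in>V. U i \<inter> W i = {0} \<and> {u + w | u w. u \<in> U i \<and> w \<in> W i} = kvec (rdim X i))
          \<longrightarrow> (\<forall>i\<in>V. U i = {0}) \<or> (\<forall>i\<in>V. W i = {0}))"

definition projective_rep :: "('v, 'e, 'k::field) qrep \<Rightarrow> bool" where
  "projective_rep P \<longleftrightarrow> wf_rep P \<and>
     (\<forall>(Y::('v,'e,'k) qrep) Z g h. wf_rep Y \<and> wf_rep Z \<and> is_hom Y Z g \<and> hom_surj Y Z g
        \<and> is_hom P Z h \<longrightarrow> (\<exists>h'. is_hom P Y h' \<and> hom_comp_eq P g h' h))"

definition injective_rep :: "('v, 'e, 'k::field) qrep \<Rightarrow> bool" where
  "injective_rep I \<longleftrightarrow> wf_rep I \<and>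
     (\<forall>(Y::('v,'e,'k) qrep) Z f h. wf_rep Y \<and> wf_rep Z \<and> is_hom Y Z f \<and> hom_inj Y f
        \<and> is_hom Y I h \<longrightarrow> (\<exists>h'. is_hom Z I h' \<and> hom_comp_eq Y h' f h))"

definition split_epi :: "('v, 'e, 'k::field) qrep \<Rightarrow> ('v, 'e, 'k) qrep
     \<Rightarrow> ('v \<Rightarrow> (nat \<Rightarrow> 'k) \<Rightarrow> (nat \<Rightarrow> 'k)) \<Rightarrow> bool" where
  "split_epi Y N h \<longleftrightarrow> (\<exists>s. is_hom N Y s \<and> hom_comp_eq N h s hom_id)"

definition split_mono :: "('v, 'e, 'k::field) qrep \<Rightarrow> ('v, 'e, 'k) qrep
     \<Rightarrow> ('v \<Rightarrow> (nat \<Rightarrow> 'k) \<Rightarrow> (nat \<Rightarrow> 'k)) \<Rightarrow> bool" where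
  "split_mono L Y h \<longleftrightarrow> (\<exists>r. is_hom Y L r \<and> hom_comp_eq L r h hom_id)"

definition almost_split :: "('v, 'e, 'k::field) qrep \<Rightarrow> ('v, 'e, 'k) qrep \<Rightarrow> ('v, 'e, 'k) qrep
     \<Rightarrow> ('v \<Rightarrow> (nat \<Rightarrow> 'k) \<Rightarrow> (nat \<Rightarrow> 'k)) \<Rightarrow> ('v \<Rightarrow> (nat \<Rightarrow> 'k) \<Rightarrow> (nat \<Rightarrow> 'k)) \<Rightarrow> bool" where
  "almost_split L M N f g \<longleftrightarrow> wf_rep L \<and> wf_rep M \<and> wf_rep N
     \<and> is_hom L M f \<and> is_hom M N g \<and> hom_inj L f \<and> hom_surj M N g
     \<and> (\<forall>i\<in>V. f i ` kvec (rdim L i) = {x \<in> kvec (rdim M i). g i x = 0})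
     \<and> \<not> split_epi M N g
     \<and> (\<forall>(Y::('v,'e,'k) qrep) h. wf_rep Y \<and> is_hom Y N h \<and> \<not> split_epi Y N h
           \<longrightarrow> (\<exists>h'. is_hom Y M h' \<and> hom_comp_eq Y g h' h))
     \<and> (\<forall>(Y::('v,'e,'k) qrep) h. wf_rep Y \<and> is_hom L Y h \<and> \<not> split_mono L Y h
           \<longrightarrow> (\<exists>h'. is_hom M Y h' \<and> hom_comp_eq L h' f h))"

text \<open>Indecomposable preprojective modules: those of the form \<tau>^{-n} P with P
  indecomposable projective, where \<tau>^{-1} L = N iff there is an almost split
  sequence 0 \<rightarrow> L \<rightarrow> M \<rightarrow> N \<rightarrow> 0.  Dually for preinjectives.\<close>
inductive preproj_indec :: "('v, 'e, 'k::field) qrep \<Rightarrow> bool" where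
  proj: "indecomposable P \<Longrightarrow> projective_rep P \<Longrightarrow> preproj_indec P"
| tau_inv: "preproj_indec L \<Longrightarrow> almost_split L M N f g \<Longrightarrow> preproj_indec N"

inductive preinj_indec :: "('v, 'e, 'k::field) qrep \<Rightarrow> bool" where
  inj: "indecomposable I \<Longrightarrow> injective_rep I \<Longrightarrow> preinj_indec I"
| tau: "preinj_indec N \<Longrightarrow> almost_split L M N f g \<Longrightarrow> preinj_indec L"

definition direct_summand :: "('v, 'e, 'k::field) qrep \<Rightarrow> ('v, 'e, 'k) qrep \<Rightarrow> bool" where
  "direct_summand N X \<longleftrightarrow> (\<exists>f r. is_hom N X f \<and> is_hom X N r \<and> hom_comp_eq N r f hom_id)"

text \<open>A module is preprojective (preinjective) if it is a direct sum of indecomposable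
  preprojective (preinjective) modules, i.e. (Krull--Schmidt) every indecomposable
  direct summand is preprojective (preinjective).\<close>
definition preprojective :: "('v, 'e, 'k::field) qrep \<Rightarrow> bool" where
  "preprojective X \<longleftrightarrow> wf_rep X \<and>
     (\<forall>N. indecomposable N \<and> direct_summand N X \<longrightarrow> preproj_indec N)"

definition preinjective :: "('v, 'e, 'k::field) qrep \<Rightarrow> bool" where
  "preinjective X \<longleftrightarrow> wf_rep X \<and>
     (\<forall>N. indecomposable N \<and> direct_summand N X \<longrightarrow> preinj_indec N)"

definition hall_number :: "('v, 'e, 'k::{finite,field}) qrep \<Rightarrow> ('v, 'e, 'k) qrep
     \<Rightarrow> ('v, 'e, 'k) qrep \<Rightarrow> nat" where
  "hall_number X M N = card {U. subrep X U
      \<and> (\<exists>f. is_hom N X f \<and> hom_inj N f \<and> (\<forall>i\<in>V. f i ` kvec (rdim N i) = U i))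
      \<and> (\<exists>g. is_hom X M g \<and> hom_surj X M g
              \<and> (\<forall>i\<in>V. {x \<in> kvec (rdim X i). g i x = 0} = U i))}"

definition iso_class :: "('v, 'e, 'k::field) qrep \<Rightarrow> ('v, 'e, 'k) qrep set" where
  "iso_class X = {Y. wf_rep Y \<and> rep_iso X Y}"

definition iso_classes :: "('v, 'e, 'k::field) qrep set set" where
  "iso_classes = {iso_class X | X. wf_rep X}"

definition hall_elem :: "(('v, 'e, 'k::field) qrep set \<Rightarrow> rat) \<Rightarrow> bool" where
  "hall_elem h \<longleftrightarrow> finite {c. h c \<noteq> 0} \<and> {c. h c \<noteq> 0} \<subseteq> iso_classes"

definition hall_basis :: "('v, 'e, 'k::field) qrep set \<Rightarrow> (('v, 'e, 'k) qrep set \<Rightarrow> rat)" where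
  "hall_basis c = (\<lambda>d. if d = c then 1 else 0)"

definition hall_mult :: "(('v, 'e, 'k::{finite,field}) qrep set \<Rightarrow> rat)
     \<Rightarrow> (('v, 'e, 'k) qrep set \<Rightarrow> rat) \<Rightarrow> (('v, 'e, 'k) qrep set \<Rightarrow> rat)" where
  "hall_mult x y = (\<lambda>c. if c \<in> iso_classes then
      (\<Sum>A\<in>{A. x A \<noteq> 0}. \<Sum>B\<in>{B. y B \<noteq> 0}.
          x A * y B * of_nat (hall_number (SOME X. X \<in> c) (SOME M. M \<in> A) (SOME N. N \<in> B)))
      else 0)"

definition zero_rep :: "('v, 'e, 'k::field) qrep" where
  "zero_rep = \<lparr>rdim = (\<lambda>_. 0), rmap = (\<lambda>_ _. 0)\<rparr>"

inductive_set hall_subalg ::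
    "('v, 'e, 'k::{finite,field}) qrep set set \<Rightarrow> (('v, 'e, 'k) qrep set \<Rightarrow> rat) set"
  for G where
  gen: "c \<in> G \<Longrightarrow> hall_basis c \<in> hall_subalg G"
| one: "hall_basis (iso_class zero_rep) \<in> hall_subalg G"
| add: "x \<in> hall_subalg G \<Longrightarrow> y \<in> hall_subalg G \<Longrightarrow> (\<lambda>c. x c + y c) \<in> hall_subalg G"
| smult: "x \<in> hall_subalg G \<Longrightarrow> (\<lambda>c. q * x c) \<in> hall_subalg G"
| mult: "x \<in> hall_subalg G \<Longrightarrow> y \<in> hall_subalg G \<Longrightarrow> hall_mult x y \<in> hall_subalg G"

definition composition_algebra :: "(('v, 'e, 'k::{finite,field}) qrep set \<Rightarrow> rat) set" where
  "composition_algebra = hall_subalg {iso_class S | S. simple_rep S}"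

definition preproj_algebra :: "(('v, 'e, 'k::{finite,field}) qrep set \<Rightarrow> rat) set" where
  "preproj_algebra = hall_subalg {iso_class M | M. preprojective M}"

definition preinj_algebra :: "(('v, 'e, 'k::{finite,field}) qrep set \<Rightarrow> rat) set" where
  "preinj_algebra = hall_subalg {iso_class M | M. preinjective M}"

end

end

theory Submission
  imports Defs "HOL-Library.FuncSet" "HOL-Library.Cardinality"
begin

text \<open>
  The sum \<open>1\<^sub>d\<close> of all classes of dimension vector \<open>d\<close> lies in the composition algebra, because
  \<open>[S\<^sub>i]1\<^bsub>d-e\<^sub>i\<^esub>\<close> is a nonzero multiple of \<open>1\<^sub>d\<close> when \<open>i\<close> is a source of the support of \<open>d\<close>.
  Every representation has a unique maximal destabilizing subrepresentation, so Reineke's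
  Harder--Narasimhan recursion also puts the sum of all semistable classes of dimension vector
  \<open>d\<close> into the composition algebra, for every slope function.  If \<open>N\<close> is exceptional
  (\<open>End N\<close> a division ring, \<open>Ext(N,N) = 0\<close>), then \<open>N\<close> is stable for the weight \<open>\<theta>(d) = \<langle>dim N, d\<rangle> - \<langle>d, dim N\<rangle>\<close>: a proper nonzero
  \<open>U \<subseteq> N\<close> has \<open>Hom(N,U) = 0\<close>, \<open>Hom(U,N) \<noteq> 0\<close> and, by heredity, \<open>Ext(U,N) = 0\<close>.  As
  \<open>\<langle>dim N, dim N\<rangle> > 0\<close> forces a nonzero map from any other semistable module of that dimension
  vector, \<open>N\<close> is the only one, so \<open>[N]\<close> is in the composition algebra.

  Given an almost split sequence from \<open>L\<close> to \<open>N\<close>, the Auslander--Reiten formulas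
  \<open>Ext(N,Z) = 0 \<longleftrightarrow> Hom(Z,L) = 0\<close> and \<open>Ext(Z,L) = 0 \<longleftrightarrow> Hom(N,Z) = 0\<close> transport
  exceptionality between \<open>L\<close> and \<open>N\<close>, and show for preprojectives
  \<open>X = \<tau>\<^sup>-\<^sup>n P\<close>, \<open>Y = \<tau>\<^sup>-\<^sup>m P'\<close> that \<open>Ext(X,Y) \<noteq> 0\<close> implies \<open>m < n\<close> (dually for
  preinjectives).  Hence a preprojective module can be built from its indecomposable summands by
  extensions \<open>0 \<rightarrow> K \<rightarrow> X \<rightarrow> Y \<rightarrow> 0\<close> with \<open>Ext(Y,K) = 0\<close>, for which \<open>[Y][K]\<close> is a
  nonzero multiple of \<open>[X]\<close>.
\<close>

text \<open>The translate \<tau> is accessible only through the two lifting properties of an almost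
  split sequence. Once the sequence is replaced by its class \<open>\<xi>\<close> in Ext(N,L), a
  lifting property says that a pullback or pushforward of \<open>\<xi>\<close> vanishes. Testing
  this on extensions, kernels and cokernels shows that each nonzero element of Hom(Z,L), Ext(N,Z),
  Ext(Z,L) or Hom(N,Z) pairs with some element to \<open>\<xi>\<close>. Only vanishing statements
  are drawn from this, just as only signs are drawn from the Euler form; the latter follow by
  comparing the sizes of two finite cochain spaces.

  The obstacle to reaching a single class [N] is that the sum over a dimension vector mixes it with
  all other classes. A slope condition isolates it. The weight is the antisymmetrised Euler form
  because this vanishes on dim N, so that N has slope 0, and because its value on a subobject U
  compares Hom(N,U) with Hom(U,N). The recursion is not solved in closed form: semistable sums and
  sums truncated by slope enter the algebra together, by induction on the total dimension. Hall
  coefficients matter only as nonzero rationals, which can be divided out.\<close>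

section \<open>Vectors and linear maps on the coordinate spaces\<close>

lemma kvecD: "x \<in> kvec n \<Longrightarrow> n \<le> j \<Longrightarrow> x j = 0"
  by (simp add: kvec_def)

lemma kvec_0 [simp]: "kvec 0 = {0}"
  by (auto simp: kvec_def)

lemma zero_in_kvec [simp]: "0 \<in> kvec n"
  by (simp add: kvec_def)

lemma kvec_add [intro, simp]: "x \<in> kvec n \<Longrightarrow> y \<in> kvec n \<Longrightarrow> x + y \<in> kvec n"
  for x :: "nat \<Rightarrow> 'k::field"
  by (simp add: kvec_def)

lemma kvec_diff [intro, simp]: "x \<in> kvec n \<Longrightarrow> y \<in> kvec n \<Longrightarrow> x - y \<in> kvec n"
  for x :: "nat \<Rightarrow> 'k::field"
  by (simp add: kvec_def)

lemma kvec_minus [intro, simp]: "x \<in> kvec n \<Longrightarrow> - x \<in> kvec n"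
  for x :: "nat \<Rightarrow> 'k::field"
  by (simp add: kvec_def)

lemma kvec_scale [intro, simp]: "x \<in> kvec n \<Longrightarrow> vscale c x \<in> kvec n"
  for x :: "nat \<Rightarrow> 'k::field"
  by (simp add: kvec_def vscale_def)

lemma kvec_sum [intro]: "(\<And>j. j \<in> A \<Longrightarrow> f j \<in> kvec n) \<Longrightarrow> (\<Sum>j\<in>A. f j) \<in> kvec n"
  for f :: "'a \<Rightarrow> nat \<Rightarrow> 'k::field"
  by (induction A rule: infinite_finite_induct) auto

lemma kvec_mono: "m \<le> n \<Longrightarrow> kvec m \<subseteq> kvec n"
  by (auto simp: kvec_def)

lemma vscale_simps [simp]:
  fixes x y :: "nat \<Rightarrow> 'k::field"
  shows "vscale c (x + y) = vscale c x + vscale c y"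
    and "vscale c (x - y) = vscale c x - vscale c y"
    and "vscale c 0 = 0" and "vscale 0 x = 0" and "vscale 1 x = x"
    and "vscale (c + d) x = vscale c x + vscale d x"
    and "vscale c (vscale d x) = vscale (c * d) x"
  by (auto simp: vscale_def algebra_simps fun_eq_iff)

lemma vscale_minus_one: "vscale (-1) x = - x" for x :: "nat \<Rightarrow> 'k::field"
  by (auto simp: vscale_def)

lemma vscale_sum: "vscale c (\<Sum>j\<in>A. f j) = (\<Sum>j\<in>A. vscale c (f j))"
  for f :: "'a \<Rightarrow> nat \<Rightarrow> 'k::field"
  by (induction A rule: infinite_finite_induct) (simp_all del: plus_fun_apply zero_fun_apply)

lemma sum_fun_apply: "(\<Sum>j\<in>A. f j) i = (\<Sum>j\<in>A. f j i)"
  for f :: "'a \<Rightarrow> nat \<Rightarrow> 'k::field"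
  by (induction A rule: infinite_finite_induct) auto

lemma lin_onI:
  assumes "\<And>x. x \<in> kvec n \<Longrightarrow> f x \<in> kvec m"
    and "\<And>x y. x \<in> kvec n \<Longrightarrow> y \<in> kvec n \<Longrightarrow> f (x + y) = f x + f y"
    and "\<And>c x. x \<in> kvec n \<Longrightarrow> f (vscale c x) = vscale c (f x)"
  shows "lin_on n m f"
  using assms by (simp add: lin_on_def)

lemma lin_in: "lin_on n m f \<Longrightarrow> x \<in> kvec n \<Longrightarrow> f x \<in> kvec m"
  and lin_add: "lin_on n m f \<Longrightarrow> x \<in> kvec n \<Longrightarrow> y \<in> kvec n \<Longrightarrow> f (x + y) = f x + f y"
  and lin_scale: "lin_on n m f \<Longrightarrow> x \<in> kvec n \<Longrightarrow> f (vscale c x) = vscale c (f x)"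
  by (simp_all add: lin_on_def)

lemma lin_zero: "lin_on n m f \<Longrightarrow> f 0 = 0"
  using lin_scale[of n m f 0 0] by simp

lemma lin_minus: "lin_on n m f \<Longrightarrow> x \<in> kvec n \<Longrightarrow> f (- x) = - f x"
  using lin_scale[of n m f x "-1"] by (simp add: vscale_minus_one)

lemma lin_diff: "lin_on n m f \<Longrightarrow> x \<in> kvec n \<Longrightarrow> y \<in> kvec n \<Longrightarrow> f (x - y) = f x - f y"
  using lin_add[of n m f x "- y"] lin_minus[of n m f y] by simp

lemma lin_sum:
  assumes "lin_on n m f" "\<And>j. j \<in> A \<Longrightarrow> g j \<in> kvec n"
  shows "f (\<Sum>j\<in>A. g j) = (\<Sum>j\<in>A. f (g j))"
  using assms(2)
proof (induction A rule: infinite_finite_induct)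
  case (insert x F)
  then show ?case using lin_add[OF assms(1), of "g x" "sum g F"] kvec_sum[of F g n]
    by (auto simp del: plus_fun_apply)
qed (simp_all add: lin_zero[OF assms(1)] del: zero_fun_apply)

lemma lin_comp: "lin_on n m f \<Longrightarrow> lin_on m l g \<Longrightarrow> lin_on n l (\<lambda>x. g (f x))"
  by (simp add: lin_on_def)

lemma lin_plus: "lin_on n m f \<Longrightarrow> lin_on n m g \<Longrightarrow> lin_on n m (\<lambda>x. f x + g x)"
  by (simp add: lin_on_def)

lemma lin_sub: "lin_on n m f \<Longrightarrow> lin_on n m g \<Longrightarrow> lin_on n m (\<lambda>x. f x - g x)"
  by (simp add: lin_on_def)

lemma lin_uminus: "lin_on n m f \<Longrightarrow> lin_on n m (\<lambda>x. - f x)"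
  by (auto simp: lin_on_def vscale_def fun_eq_iff)

lemma lin_const0: "lin_on n m (\<lambda>x. 0)"
  by (simp add: lin_on_def)

lemma lin_id: "lin_on n n (\<lambda>x. x)"
  by (simp add: lin_on_def)

lemma lin_cong: "lin_on n m f \<Longrightarrow> (\<And>x. x \<in> kvec n \<Longrightarrow> g x = f x) \<Longrightarrow> lin_on n m g"
  by (simp add: lin_on_def)

lemma lin_inj: "lin_on n m f \<Longrightarrow> (\<And>x. x \<in> kvec n \<Longrightarrow> f x = 0 \<Longrightarrow> x = 0) \<Longrightarrow> inj_on f (kvec n)"
proof (rule inj_onI)
  fix x y assume f: "lin_on n m f" and z: "\<And>x. x \<in> kvec n \<Longrightarrow> f x = 0 \<Longrightarrow> x = 0"
    and x: "x \<in> kvec n" and y: "y \<in> kvec n" and e: "f x = f y"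
  have "x - y = 0" by (rule z) (use x y e lin_diff[OF f x y] in simp_all)
  then show "x = y" by simp
qed

lemma lin_inj_zero: "lin_on n m f \<Longrightarrow> inj_on f (kvec n) \<Longrightarrow> x \<in> kvec n \<Longrightarrow> f x = 0 \<Longrightarrow> x = 0"
  by (rule inj_onD[of f "kvec n" x 0]) (simp_all add: lin_zero[of n m f])

subsection \<open>Coordinates\<close>

definition evec :: "nat \<Rightarrow> nat \<Rightarrow> 'k::field" where
  "evec j = (\<lambda>i. if i = j then 1 else 0)"

definition lincomb :: "nat \<Rightarrow> (nat \<Rightarrow> nat \<Rightarrow> 'k::field) \<Rightarrow> (nat \<Rightarrow> 'k) \<Rightarrow> nat \<Rightarrow> 'k" where
  "lincomb n v x = (\<Sum>j<n. vscale (x j) (v j))"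

lemma evec_in [intro]: "j < n \<Longrightarrow> evec j \<in> kvec n"
  by (auto simp: evec_def kvec_def)

lemma lincomb_evec_expand: "x \<in> kvec n \<Longrightarrow> lincomb n evec x = x"
  by (auto simp: lincomb_def sum_fun_apply vscale_def evec_def fun_eq_iff kvec_def if_distrib
      sum.delta not_less cong: if_cong)

lemma lincomb_lin: "(\<And>j. j < n \<Longrightarrow> v j \<in> kvec m) \<Longrightarrow> lin_on n m (lincomb n v)"
  by (rule lin_onI) (auto simp: lincomb_def sum.distrib vscale_sum intro!: kvec_sum,
      simp add: vscale_def)

lemma lincomb_evec: "j < n \<Longrightarrow> lincomb n v (evec j) = v j"
  by (simp add: lincomb_def evec_def fun_eq_iff sum_fun_apply vscale_def if_distrib
      if_distribR sum.delta cong: if_cong)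

lemma lin_lincomb: "lin_on n m f \<Longrightarrow> x \<in> kvec n \<Longrightarrow> f x = lincomb n (\<lambda>j. f (evec j)) x"
proof -
  assume f: "lin_on n m f" and x: "x \<in> kvec n"
  have "f x = f (\<Sum>j<n. vscale (x j) (evec j))"
    using lincomb_evec_expand[OF x] by (simp add: lincomb_def)
  also have "\<dots> = (\<Sum>j<n. vscale (x j) (f (evec j)))"
    using f by (subst lin_sum[OF f]) (auto intro!: sum.cong simp: lin_scale[OF f] evec_in)
  finally show ?thesis by (simp add: lincomb_def)
qed

text \<open>\<open>kvec l\<close> is free on the vectors \<open>evec j\<close>: preimages of the
  values at these are chosen and extended by \<open>lincomb\<close>. This is the source of the
  linear lifts and sections used later.\<close>

lemma lin_lift:
  assumes p: "lin_on n m p" and f: "lin_on l m f"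
    and im: "\<And>x. x \<in> kvec l \<Longrightarrow> f x \<in> p ` kvec n"
  shows "\<exists>h. lin_on l n h \<and> (\<forall>x\<in>kvec l. p (h x) = f x)"
proof -
  have "\<forall>j\<in>{..<l}. \<exists>v. v \<in> kvec n \<and> p v = f (evec j)"
    using im by (metis evec_in imageE lessThan_iff)
  then obtain v where v: "\<And>j. j < l \<Longrightarrow> v j \<in> kvec n \<and> p (v j) = f (evec j)"
    by (metis lessThan_iff)
  have "lin_on l n (lincomb l v)" using v by (intro lincomb_lin) auto
  moreover have "p (lincomb l v x) = f x" if "x \<in> kvec l" for x
  proof -
    have pc: "lin_on l m (\<lambda>x. p (lincomb l v x))"
      using lin_comp[OF \<open>lin_on l n (lincomb l v)\<close> p] .
    show ?thesis
      using lin_lincomb[OF pc that] lin_lincomb[OF f that] v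
      by (simp add: lincomb_evec lincomb_def[of _ "\<lambda>j. f (evec j)"]
          lincomb_def[of _ "\<lambda>j. p (lincomb l v (evec j))"])
  qed
  ultimately show ?thesis by blast
qed

lemma lin_section:
  assumes "lin_on n m p" "p ` kvec n = kvec m"
  shows "\<exists>h. lin_on m n h \<and> (\<forall>x\<in>kvec m. p (h x) = x)"
  using lin_lift[OF assms(1) lin_id] assms(2) by simp

subsection \<open>Subspaces\<close>

lemma ksubspaceD:
  assumes "ksubspace n U"
  shows "x \<in> U \<Longrightarrow> x \<in> kvec n" "0 \<in> U" "x \<in> U \<Longrightarrow> y \<in> U \<Longrightarrow> x + y \<in> U"
    "x \<in> U \<Longrightarrow> vscale c x \<in> U" "x \<in> U \<Longrightarrow> - x \<in> U" "x \<in> U \<Longrightarrow> y \<in> U \<Longrightarrow> x - y \<in> U"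
proof -
  show m: "- x \<in> U" if "x \<in> U" for x
    using assms that vscale_minus_one[of x] by (metis ksubspace_def)
  show "x - y \<in> U" if "x \<in> U" "y \<in> U" for x y
    using assms m that by (metis add_uminus_conv_diff ksubspace_def)
qed (use assms in \<open>auto simp: ksubspace_def\<close>)

lemma ksubspaceI:
  assumes "\<And>x. x \<in> U \<Longrightarrow> x \<in> kvec n" "0 \<in> U"
    "\<And>x y. x \<in> U \<Longrightarrow> y \<in> U \<Longrightarrow> x + y \<in> U" "\<And>c x. x \<in> U \<Longrightarrow> vscale c x \<in> U"
  shows "ksubspace n U"
  using assms by (auto simp: ksubspace_def)

lemma ksubspace_zero [simp]: "ksubspace n {0}"
  and ksubspace_kvec [simp]: "ksubspace n (kvec n)"
  by (auto intro!: ksubspaceI)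

lemma ksubspace_0: "ksubspace 0 U \<longleftrightarrow> U = {0}"
  by (auto simp: ksubspace_def)

lemma ksubspace_Int: "ksubspace n U \<Longrightarrow> ksubspace n W \<Longrightarrow> ksubspace n (U \<inter> W)"
  by (auto intro!: ksubspaceI dest: ksubspaceD)

definition ssum :: "(nat \<Rightarrow> 'k::field) set \<Rightarrow> (nat \<Rightarrow> 'k) set \<Rightarrow> (nat \<Rightarrow> 'k) set" where
  "ssum U W = {u + w | u w. u \<in> U \<and> w \<in> W}"

lemma ksubspace_ssum: assumes "ksubspace n U" "ksubspace n W" shows "ksubspace n (ssum U W)"
proof (rule ksubspaceI)
  show "0 \<in> ssum U W" using ksubspaceD(2)[OF assms(1)] ksubspaceD(2)[OF assms(2)]
    unfolding ssum_def by (intro CollectI exI[of _ 0]) simp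
  fix x y assume "x \<in> ssum U W" "y \<in> ssum U W"
  then obtain u w u' w' where "x = u + w" "y = u' + w'" "u \<in> U" "w \<in> W" "u' \<in> U" "w' \<in> W"
    by (auto simp: ssum_def)
  moreover from this have "x + y = (u + u') + (w + w')" by (simp add: algebra_simps)
  ultimately show "x + y \<in> ssum U W"
    using ksubspaceD(3)[OF assms(1)] ksubspaceD(3)[OF assms(2)] unfolding ssum_def by blast
next
  fix c x assume "x \<in> ssum U W"
  then show "vscale c x \<in> ssum U W"
    using ksubspaceD(4)[OF assms(1)] ksubspaceD(4)[OF assms(2)] unfolding ssum_def by fastforce
qed (use assms in \<open>auto simp: ssum_def dest: ksubspaceD\<close>)

lemma ssum_supset:
  assumes "ksubspace n U" "ksubspace n W"
  shows "U \<subseteq> ssum U W" "W \<subseteq> ssum U W"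
proof -
  show "U \<subseteq> ssum U W"
  proof
    fix x assume "x \<in> U"
    then show "x \<in> ssum U W" using ksubspaceD(2)[OF assms(2)]
      unfolding ssum_def by (intro CollectI exI[of _ x] exI[of _ 0]) simp
  qed
  show "W \<subseteq> ssum U W"
  proof
    fix x assume "x \<in> W"
    then show "x \<in> ssum U W" using ksubspaceD(2)[OF assms(1)]
      unfolding ssum_def by (intro CollectI exI[of _ 0] exI[of _ x]) simp
  qed
qed

lemma ksubspace_image:
  assumes f: "lin_on n m f" and U: "ksubspace n U"
  shows "ksubspace m (f ` U)"
proof (rule ksubspaceI)
  show "0 \<in> f ` U" using lin_zero[OF f] ksubspaceD(2)[OF U] by (metis image_eqI)
  fix x y assume "x \<in> f ` U" "y \<in> f ` U"
  then show "x + y \<in> f ` U"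
    using lin_add[OF f] ksubspaceD[OF U] by (smt (verit, ccfv_SIG) image_iff)
next
  fix c x assume "x \<in> f ` U"
  then show "vscale c x \<in> f ` U"
    using lin_scale[OF f] ksubspaceD[OF U] by (smt (verit, ccfv_SIG) image_iff)
qed (use lin_in[OF f] ksubspaceD(1)[OF U] in auto)

lemma ksubspace_vimage:
  assumes f: "lin_on n m f" and U: "ksubspace m U"
  shows "ksubspace n {x \<in> kvec n. f x \<in> U}"
  by (rule ksubspaceI) (use ksubspaceD[OF U] lin_add[OF f] lin_scale[OF f] lin_zero[OF f] in auto)

lemma ksubspace_kernel: "lin_on n m f \<Longrightarrow> ksubspace n {x \<in> kvec n. f x = 0}"
  using ksubspace_vimage[of n m f "{0}"] by simp

lemma lin_truncate: "lin_on (Suc n) n (\<lambda>x. x(n := 0))"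
  by (rule lin_onI) (auto simp: kvec_def vscale_def fun_eq_iff le_Suc_eq)

text \<open>Gaussian elimination on the last coordinate. By induction
  \<open>U \<inter> kvec n\<close> is parametrised; either this is all of \<open>U\<close>, or one
  vector with nonzero last coordinate completes its basis. The retraction \<open>r\<close> of the
  ambient space is carried along because its kernel is a complement of \<open>U\<close>.\<close>

lemma subspace_param:
  assumes "ksubspace n U"
  shows "\<exists>m i r. lin_on m n i \<and> lin_on n m r \<and> (\<forall>x\<in>kvec m. r (i x) = x) \<and> i ` kvec m = U"
  using assms
proof (induction n arbitrary: U)
  case 0
  then have "U = {0}" by (simp add: ksubspace_0)
  then show ?case by (intro exI[of _ 0] exI[of _ "\<lambda>x. x"]) (auto simp: lin_id)
next
  case (Suc n)
  let ?U = "U \<inter> kvec n"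
  note U = ksubspaceD[OF Suc.prems]
  have "ksubspace n ?U"
    by (rule ksubspaceI) (use U in auto)
  from Suc.IH[OF this] obtain m i r where
    i: "lin_on m n i" and r: "lin_on n m r" and ri': "\<forall>x\<in>kvec m. r (i x) = x"
    and im: "i ` kvec m = ?U" by (elim exE conjE)
  note ri = ri'[rule_format]
  have last: "x \<in> kvec n" if "x \<in> kvec (Suc n)" "x n = 0" for x :: "nat \<Rightarrow> 'a"
    using that by (auto simp: kvec_def) (metis le_antisym not_less_eq_eq)
  show ?case
  proof (cases "U \<subseteq> kvec n")
    case True
    have "lin_on m (Suc n) i"
      using i kvec_mono[of n "Suc n"] unfolding lin_on_def by auto
    moreover have "lin_on (Suc n) m (\<lambda>x. r (x(n := 0)))"
      using lin_comp[OF lin_truncate r] .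
    moreover have "r ((i x)(n := 0)) = x" if "x \<in> kvec m" for x
      using ri[OF that] lin_in[OF i that] by (metis fun_upd_triv kvecD order_refl)
    moreover have "i ` kvec m = U" using im True by auto
    ultimately show ?thesis by blast
  next
    case False
    then obtain u0 where u0: "u0 \<in> U" "u0 \<notin> kvec n" by auto
    then have "u0 n \<noteq> 0" using last U(1) by blast
    \<comment> \<open>Normalised so that subtracting \<open>vscale (y n) u\<close> clears the last
      coordinate. In \<open>i'\<close> the new parameter \<open>x m\<close> is the coefficient of
      \<open>u\<close>; \<open>r'\<close> recovers it as \<open>y n\<close>.\<close>
    define u where "u = vscale (inverse (u0 n)) u0"
    have u: "u \<in> U" "u n = 1" using u0 \<open>u0 n \<noteq> 0\<close> U(4) by (auto simp: u_def vscale_def)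
    have uk: "u \<in> kvec (Suc n)" using u U(1) by blast
    define i' where "i' x = i (x(m := 0)) + vscale (x m) u" for x
    define r' where "r' y = r (y - vscale (y n) u) + vscale (y n) (evec m)" for y
    have nk: "y - vscale (y n) u \<in> kvec n" if "y \<in> kvec (Suc n)" for y
      using that uk u(2) by (intro last kvec_diff kvec_scale) (auto simp: vscale_def)
    have tr: "x(m := 0) \<in> kvec m" if "x \<in> kvec (Suc m)" for x :: "nat \<Rightarrow> 'a"
      using that lin_in[OF lin_truncate] by blast
    have i': "lin_on (Suc m) (Suc n) i'"
    proof (rule lin_onI)
      fix x y :: "nat \<Rightarrow> 'a" and c
      assume x: "x \<in> kvec (Suc m)"
      show "i' x \<in> kvec (Suc n)"
        using lin_in[OF i tr[OF x]] kvec_mono[of n "Suc n"] uk by (auto simp: i'_def)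
      show "i' (vscale c x) = vscale c (i' x)"
        using lin_scale[OF lin_comp[OF lin_truncate i] x] by (simp add: i'_def) (simp add: vscale_def)
      assume y: "y \<in> kvec (Suc m)"
      show "i' (x + y) = i' x + i' y"
        using lin_add[OF lin_comp[OF lin_truncate i] x y] by (simp add: i'_def)
    qed
    have em: "evec m \<in> kvec (Suc m)" by auto
    have r': "lin_on (Suc n) (Suc m) r'"
    proof (rule lin_onI)
      fix x y :: "nat \<Rightarrow> 'a" and c
      assume x: "x \<in> kvec (Suc n)"
      show "r' x \<in> kvec (Suc m)"
        using lin_in[OF r nk[OF x]] kvec_mono[of m "Suc m"] em by (auto simp: r'_def)
      have *: "vscale c x - vscale (vscale c x n) u = vscale c (x - vscale (x n) u)"
        by (simp add: fun_eq_iff vscale_def algebra_simps)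
      show "r' (vscale c x) = vscale c (r' x)"
        unfolding r'_def * using lin_scale[OF r nk[OF x]] by (simp add: vscale_def fun_eq_iff algebra_simps)
      assume y: "y \<in> kvec (Suc n)"
      have *: "x + y - vscale ((x + y) n) u = (x - vscale (x n) u) + (y - vscale (y n) u)"
        by (simp add: fun_eq_iff vscale_def algebra_simps)
      show "r' (x + y) = r' x + r' y"
        unfolding r'_def * using lin_add[OF r nk[OF x] nk[OF y]] by simp
    qed
    have ri': "r' (i' x) = x" if x: "x \<in> kvec (Suc m)" for x
    proof -
      have "i (x(m := 0)) \<in> kvec n" using lin_in[OF i tr[OF x]] .
      then have n: "i' x n = x m" using u(2) by (simp add: i'_def vscale_def kvecD)
      have "r' (i' x) = r (i (x(m := 0))) + vscale (x m) (evec m)"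
        unfolding r'_def n by (simp add: i'_def)
      also have "\<dots> = x" using ri[OF tr[OF x]] by (auto simp: vscale_def evec_def fun_eq_iff)
      finally show ?thesis .
    qed
    have "i' ` kvec (Suc m) = U"
    proof (intro equalityI subsetI)
      fix y assume "y \<in> i' ` kvec (Suc m)"
      then obtain x where x: "x \<in> kvec (Suc m)" "y = i' x" by auto
      have "i (x(m := 0)) \<in> U" using im tr[OF x(1)] by blast
      then show "y \<in> U" using U x(2) u(1) by (simp add: i'_def)
    next
      fix y assume y: "y \<in> U"
      then have yk: "y \<in> kvec (Suc n)" using U(1) by blast
      have "y - vscale (y n) u \<in> ?U" using nk[OF yk] y U u(1) by simp
      then obtain z where z: "z \<in> kvec m" "i z = y - vscale (y n) u" using im by (metis imageE)
      have "z + vscale (y n) (evec m) \<in> kvec (Suc m)" using z kvec_mono[of m "Suc m"] em by auto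
      moreover have "(z + vscale (y n) (evec m))(m := 0) = z"
        using z(1) by (auto simp: fun_eq_iff vscale_def evec_def kvec_def)
      moreover have "(z + vscale (y n) (evec m)) m = y n"
        using z(1) by (auto simp: vscale_def evec_def kvec_def)
      ultimately show "y \<in> i' ` kvec (Suc m)"
        unfolding i'_def by (intro image_eqI[of _ _ "z + vscale (y n) (evec m)"]) (auto simp: z(2))
    qed
    then show ?thesis using i' r' ri' by blast
  qed
qed

lemma lin_extend:
  assumes U: "ksubspace n U" and f: "\<And>x. x \<in> U \<Longrightarrow> f x \<in> kvec m"
    "\<And>x y. x \<in> U \<Longrightarrow> y \<in> U \<Longrightarrow> f (x + y) = f x + f y"
    "\<And>c x. x \<in> U \<Longrightarrow> f (vscale c x) = vscale c (f x)"
  shows "\<exists>g. lin_on n m g \<and> (\<forall>x\<in>U. g x = f x)"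
proof -
  obtain l i r where i: "lin_on l n i" and r: "lin_on n l r"
    and ri: "\<And>x. x \<in> kvec l \<Longrightarrow> r (i x) = x" and im: "i ` kvec l = U"
    using subspace_param[OF U] by blast
  have "lin_on l m (\<lambda>x. f (i x))"
    by (rule lin_onI) (use f im lin_add[OF i] lin_scale[OF i] in auto)
  then have "lin_on n m (\<lambda>x. f (i (r x)))" by (rule lin_comp[OF r])
  moreover have "f (i (r x)) = f x" if "x \<in> U" for x using that im ri by auto
  ultimately show ?thesis by blast
qed

text \<open>The quotient has to be some \<open>kvec m\<close> again. It is realised as the
  complement \<open>ker r\<close> of \<open>U\<close>, with \<open>r\<close> the retraction from
  \<open>subspace_param\<close>, and this complement is parametrised in turn;
  \<open>x - i (r x)\<close> is the projection onto it along \<open>U\<close>.\<close>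

lemma subspace_quotient:
  assumes U: "ksubspace n U"
  shows "\<exists>m p. lin_on n m p \<and> p ` kvec n = kvec m \<and> {x \<in> kvec n. p x = 0} = U"
proof -
  obtain l i r where i: "lin_on l n i" and r: "lin_on n l r"
    and ri: "\<And>x. x \<in> kvec l \<Longrightarrow> r (i x) = x" and im: "i ` kvec l = U"
    using subspace_param[OF U] by blast
  let ?K = "{x \<in> kvec n. r x = 0}"
  obtain m j s where j: "lin_on m n j" and s: "lin_on n m s"
    and sj: "\<And>x. x \<in> kvec m \<Longrightarrow> s (j x) = x" and jm: "j ` kvec m = ?K"
    using subspace_param[OF ksubspace_kernel[OF r]] by blast
  have q: "lin_on n n (\<lambda>x. x - i (r x))" by (intro lin_sub lin_id lin_comp[OF r i])
  have qK: "x - i (r x) \<in> ?K" if "x \<in> kvec n" for x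
    using lin_in[OF q that] lin_diff[OF r that lin_in[OF i lin_in[OF r that]]] ri[OF lin_in[OF r that]]
    by simp
  define p where "p x = s (x - i (r x))" for x
  have p: "lin_on n m p" unfolding p_def by (rule lin_comp[OF q s])
  have "p (j y) = y" if y: "y \<in> kvec m" for y
  proof -
    have "r (j y) = 0" using jm y by blast
    then show ?thesis using sj[OF y] lin_zero[OF i] by (simp add: p_def)
  qed
  then have "kvec m \<subseteq> p ` kvec n" using lin_in[OF j] by (metis image_eqI subsetI)
  then have "p ` kvec n = kvec m" using lin_in[OF p] by blast
  moreover have "{x \<in> kvec n. p x = 0} = U"
  proof (intro equalityI subsetI)
    fix x assume "x \<in> {x \<in> kvec n. p x = 0}"
    then have x: "x \<in> kvec n" "p x = 0" by auto
    have "x - i (r x) \<in> j ` kvec m" unfolding jm by (rule qK[OF x(1)])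
    then obtain z where z: "z \<in> kvec m" "j z = x - i (r x)" by auto
    then have "z = 0" using sj[OF z(1)] x(2) by (simp add: p_def)
    then have "x = i (r x)" using z(2) lin_zero[OF j] by simp
    then show "x \<in> U" using im lin_in[OF r x(1)] by blast
  next
    fix x assume x: "x \<in> U"
    then obtain z where "z \<in> kvec l" "x = i z" using im by blast
    then have "x - i (r x) = 0" using ri by simp
    then show "x \<in> {x \<in> kvec n. p x = 0}"
      using x ksubspaceD(1)[OF U] lin_zero[OF s] by (simp add: p_def)
  qed
  ultimately show ?thesis using p by blast
qed

subsection \<open>Direct sums\<close>

definition join :: "nat \<Rightarrow> (nat \<Rightarrow> 'k) \<Rightarrow> (nat \<Rightarrow> 'k) \<Rightarrow> nat \<Rightarrow> 'k" where
  "join n x y = (\<lambda>j. if j < n then x j else y (j - n))"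

definition pr1 :: "nat \<Rightarrow> (nat \<Rightarrow> 'k::zero) \<Rightarrow> nat \<Rightarrow> 'k" where
  "pr1 n x = (\<lambda>j. if j < n then x j else 0)"

definition pr2 :: "nat \<Rightarrow> (nat \<Rightarrow> 'k) \<Rightarrow> nat \<Rightarrow> 'k" where
  "pr2 n x = (\<lambda>j. x (j + n))"

lemma join_in: "x \<in> kvec n \<Longrightarrow> y \<in> kvec m \<Longrightarrow> join n x y \<in> kvec (n + m)"
  by (auto simp: join_def kvec_def)

lemma lin_pr1: "lin_on (n + m) n (pr1 n)" and lin_pr2: "lin_on (n + m) m (pr2 n)"
  by (auto intro!: lin_onI simp: pr1_def pr2_def kvec_def vscale_def fun_eq_iff)

lemma lin_join: "lin_on l n f \<Longrightarrow> lin_on l m g \<Longrightarrow> lin_on l (n + m) (\<lambda>x. join n (f x) (g x))"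
  by (rule lin_onI) (auto simp: join_in lin_in lin_add lin_scale, auto simp: join_def vscale_def)

lemma pr_join [simp]: "x \<in> kvec n \<Longrightarrow> pr1 n (join n x y) = x" "pr2 n (join n x y) = y"
  by (auto simp: pr1_def pr2_def join_def kvec_def fun_eq_iff not_less)

lemma join_pr [simp]: "join n (pr1 n x) (pr2 n x) = x"
  by (auto simp: pr1_def pr2_def join_def fun_eq_iff)

lemma join_add: "join n x y + join n x' y' = join n (x + x') (y + y')"
  by (auto simp: join_def fun_eq_iff)

lemma join_split: "x \<in> kvec n \<Longrightarrow> join n x y = join n x 0 + join n 0 y"
  for x :: "nat \<Rightarrow> 'k::field"
  by (auto simp: join_def fun_eq_iff)

subsection \<open>Cardinalities\<close>

lemma kvec_bij: "bij_betw (\<lambda>x. restrict x {..<n}) (kvec n) (PiE {..<n} (\<lambda>_. UNIV :: 'k::field set))"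
  by (rule bij_betwI[where g = "\<lambda>x j. if j < n then x j else 0"])
    (auto simp: kvec_def fun_eq_iff PiE_def extensional_def)

lemma finite_kvec [simp, intro]: "finite (kvec n :: (nat \<Rightarrow> 'k::{finite,field}) set)"
  using bij_betw_finite[OF kvec_bij[where 'k='k]] by (simp add: finite_PiE)

lemma card_kvec: "card (kvec n :: (nat \<Rightarrow> 'k::{finite,field}) set) = CARD('k) ^ n"
  using bij_betw_same_card[OF kvec_bij[where 'k='k and n=n]] by (simp add: card_PiE)

lemma card_field_gt1: "1 < CARD('k::{finite,field})"
proof -
  have "card {0, 1::'k} \<le> CARD('k)" by (rule card_mono) auto
  then show ?thesis by simp
qed

text \<open>\<open>lin_on\<close> ignores the values outside \<open>kvec n\<close>; extensionality
  fixes them, so that each linear map is one element and can be counted.\<close>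

definition lins :: "nat \<Rightarrow> nat \<Rightarrow> ((nat \<Rightarrow> 'k::field) \<Rightarrow> nat \<Rightarrow> 'k) set" where
  "lins n m = {f. lin_on n m f \<and> f \<in> extensional (kvec n)}"

lemma lins_bij:
  "bij_betw (\<lambda>f. \<lambda>j\<in>{..<n}. f (evec j)) (lins n m) (PiE {..<n} (\<lambda>_. kvec m :: (nat \<Rightarrow> 'k::field) set))"
proof (rule bij_betwI[where g = "\<lambda>v. restrict (lincomb n v) (kvec n)"])
  show "(\<lambda>f. \<lambda>j\<in>{..<n}. f (evec j)) \<in> lins n m \<rightarrow> (PiE {..<n} (\<lambda>_. kvec m :: (nat \<Rightarrow> 'k) set))"
    by (auto simp: lins_def lin_in evec_in)
  show "(\<lambda>v. restrict (lincomb n v) (kvec n)) \<in> (PiE {..<n} (\<lambda>_. kvec m :: (nat \<Rightarrow> 'k) set)) \<rightarrow> lins n m"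
  proof
    fix v :: "nat \<Rightarrow> nat \<Rightarrow> 'k" assume v: "v \<in> PiE {..<n} (\<lambda>_. kvec m)"
    then have "lin_on n m (lincomb n v)" by (intro lincomb_lin) auto
    then have "lin_on n m (restrict (lincomb n v) (kvec n))" by (rule lin_cong) auto
    then show "restrict (lincomb n v) (kvec n) \<in> lins n m" by (simp add: lins_def)
  qed
  fix f :: "(nat \<Rightarrow> 'k) \<Rightarrow> nat \<Rightarrow> 'k" assume f: "f \<in> lins n m"
  then have l: "lin_on n m f" by (simp add: lins_def)
  show "restrict (lincomb n (\<lambda>j\<in>{..<n}. f (evec j))) (kvec n) = f"
  proof (rule extensionalityI[of _ "kvec n"])
    fix x :: "nat \<Rightarrow> 'k" assume x: "x \<in> kvec n"
    show "restrict (lincomb n (\<lambda>j\<in>{..<n}. f (evec j))) (kvec n) x = f x"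
      using x lin_lincomb[OF l x] by (simp add: lincomb_def)
  qed (use f in \<open>auto simp: lins_def\<close>)
next
  fix v :: "nat \<Rightarrow> nat \<Rightarrow> 'k" assume v: "v \<in> PiE {..<n} (\<lambda>_. kvec m)"
  show "(\<lambda>j\<in>{..<n}. restrict (lincomb n v) (kvec n) (evec j)) = v"
    using v by (auto simp: fun_eq_iff lincomb_evec evec_in PiE_def extensional_def)
qed

lemma card_lins: "card (lins n m :: ((nat \<Rightarrow> 'k::{finite,field}) \<Rightarrow> nat \<Rightarrow> 'k) set) = CARD('k) ^ (n * m)"
  using bij_betw_same_card[OF lins_bij[where 'k='k and n=n and m=m]]
  by (simp add: card_PiE card_kvec power_mult mult.commute)

lemma finite_lins [simp, intro]: "finite (lins n m :: ((nat \<Rightarrow> 'k::{finite,field}) \<Rightarrow> nat \<Rightarrow> 'k) set)"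
  using bij_betw_finite[OF lins_bij[where 'k='k and n=n and m=m]] by (simp add: finite_PiE)

text \<open>Unspecified unless the cardinality is a power of that of the field, as it is for subspaces.\<close>

definition vdim :: "(nat \<Rightarrow> 'k::{finite,field}) set \<Rightarrow> nat" where
  "vdim U = (THE m. card U = CARD('k) ^ m)"

lemma vdim_unique: "card (U :: (nat \<Rightarrow> 'k::{finite,field}) set) = CARD('k) ^ m \<Longrightarrow> vdim U = m"
  unfolding vdim_def using card_field_gt1[where 'k='k] by (intro the_equality) auto

lemma vdim_kvec [simp]: "vdim (kvec n :: (nat \<Rightarrow> 'k::{finite,field}) set) = n"
  by (simp add: vdim_unique card_kvec)

lemma vdim_zero [simp]: "vdim {0 :: nat \<Rightarrow> 'k::{finite,field}} = 0"
  by (rule vdim_unique) simp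

lemma finite_ksubspace: "ksubspace n (U :: (nat \<Rightarrow> 'k::{finite,field}) set) \<Longrightarrow> finite U"
  by (meson finite_kvec finite_subset ksubspace_def)

lemma card_vdim:
  assumes "ksubspace n (U :: (nat \<Rightarrow> 'k::{finite,field}) set)"
  shows "card U = CARD('k) ^ vdim U"
proof -
  obtain m i r where i: "lin_on m n i" "\<forall>x\<in>kvec m. r (i x) = x" "i ` kvec m = U"
    using subspace_param[OF assms] by blast
  then have "inj_on i (kvec m)" by (metis inj_onI)
  then have "card U = CARD('k) ^ m" using i(3) card_image[of i "kvec m"]
    by (simp add: card_kvec)
  then show ?thesis by (simp add: vdim_unique)
qed

lemma vdim_mono:
  assumes "ksubspace n (U :: (nat \<Rightarrow> 'k::{finite,field}) set)" "ksubspace n W" "U \<subseteq> W"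
  shows "vdim U \<le> vdim W"
  using card_mono[OF finite_ksubspace[OF assms(2)] assms(3)] card_field_gt1[where 'k='k]
  by (simp add: card_vdim[OF assms(1)] card_vdim[OF assms(2)])

lemma vdim_eq:
  assumes "ksubspace n (U :: (nat \<Rightarrow> 'k::{finite,field}) set)" "ksubspace n W" "U \<subseteq> W"
    "vdim W \<le> vdim U"
  shows "U = W"
  using assms card_subset_eq[OF finite_ksubspace[OF assms(2)] assms(3)]
  by (metis card_vdim le_antisym vdim_mono)

lemma vdim_image:
  fixes f :: "(nat \<Rightarrow> 'k::{finite,field}) \<Rightarrow> nat \<Rightarrow> 'k"
  assumes "inj_on f U" shows "vdim (f ` U) = vdim U"
  using card_image[OF assms] by (simp add: vdim_def)

text \<open>The fibres of \<open>f\<close> on \<open>W\<close> are cosets of its kernel there, so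
  cardinalities multiply and exponents of \<open>CARD('k)\<close> add.\<close>

lemma vdim_rank_nullity:
  fixes f :: "(nat \<Rightarrow> 'k::{finite,field}) \<Rightarrow> nat \<Rightarrow> 'k"
  assumes f: "lin_on n m f" and W: "ksubspace n W"
  shows "vdim W = vdim (f ` W) + vdim {x \<in> W. f x = 0}"
proof -
  let ?K = "{x \<in> W. f x = 0}"
  have K: "ksubspace n ?K"
    by (rule ksubspaceI) (use ksubspaceD[OF W] lin_zero[OF f] lin_add[OF f] lin_scale[OF f] in auto)
  have fib: "card {x \<in> W. f x = y} = card ?K" if "y \<in> f ` W" for y
  proof -
    obtain w where w: "w \<in> W" "f w = y" using \<open>y \<in> f ` W\<close> by auto
    note D = ksubspaceD[OF W]
    have "bij_betw (\<lambda>x. x - w) {x \<in> W. f x = y} ?K"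
    proof (rule bij_betwI[where g = "\<lambda>x. x + w"])
      show "(\<lambda>x. x - w) \<in> {x \<in> W. f x = y} \<rightarrow> ?K"
        using w D lin_diff[OF f] by auto
      show "(\<lambda>x. x + w) \<in> ?K \<rightarrow> {x \<in> W. f x = y}"
        using w D lin_add[OF f] by auto
    qed auto
    then show ?thesis by (rule bij_betw_same_card)
  qed
  have "W = (\<Union>y\<in>f ` W. {x \<in> W. f x = y})" by auto
  then have "card W = card (\<Union>y\<in>f ` W. {x \<in> W. f x = y})" by simp
  also have "\<dots> = (\<Sum>y\<in>f ` W. card {x \<in> W. f x = y})"
    using finite_ksubspace[OF W] by (intro card_UN_disjoint) auto
  also have "\<dots> = card (f ` W) * card ?K" using fib by simp
  finally have "CARD('k) ^ vdim W = CARD('k) ^ (vdim (f ` W) + vdim ?K)"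
    using card_vdim[OF W] card_vdim[OF K] card_vdim[OF ksubspace_image[OF f W]]
    by (simp add: power_add)
  then show ?thesis using card_field_gt1[where 'k='k] by (metis power_inject_exp)
qed

text \<open>The quotient map by \<open>W\<close> has the same image on \<open>ssum U W\<close> and
  on \<open>U\<close>, with kernels \<open>W\<close> and \<open>U \<inter> W\<close>; rank-nullity
  is applied to both.\<close>

lemma vdim_ssum:
  fixes U W :: "(nat \<Rightarrow> 'k::{finite,field}) set"
  assumes U: "ksubspace n U" and W: "ksubspace n W"
  shows "vdim (ssum U W) + vdim (U \<inter> W) = vdim U + vdim W"
proof -
  obtain m p where p: "lin_on n m p" "{x \<in> kvec n. p x = 0} = W"
    using subspace_quotient[OF W] by blast
  note S = ksubspace_ssum[OF U W]
  have W0: "p w = 0" if "w \<in> W" for w using p that by blast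
  have "p ` ssum U W = p ` U"
  proof (intro equalityI subsetI)
    fix y assume "y \<in> p ` ssum U W"
    then obtain u w where uw: "u \<in> U" "w \<in> W" "y = p (u + w)" by (auto simp: ssum_def)
    then have "y = p u"
      using lin_add[OF p(1)] W0 ksubspaceD(1)[OF U] ksubspaceD(1)[OF W] by simp
    then show "y \<in> p ` U" using uw by blast
  qed (use ssum_supset[OF U W] in auto)
  moreover have "{x \<in> ssum U W. p x = 0} = W"
    using ssum_supset[OF U W] p(2) ksubspaceD(1)[OF S] by blast
  moreover have "{x \<in> U. p x = 0} = U \<inter> W"
    using p(2) ksubspaceD(1)[OF U] by blast
  ultimately show ?thesis
    using vdim_rank_nullity[OF p(1) S] vdim_rank_nullity[OF p(1) U] by simp
qed

section \<open>Factoring linear maps, and small auxiliary facts\<close>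

text \<open>Dual to \<open>lin_lift\<close>. On the image of \<open>v\<close> the factor is forced,
  and well defined by the kernel condition; since \<open>v\<close> need not be onto, it is then
  extended from that subspace.\<close>

lemma lin_factor_gen:
  assumes v: "lin_on n m v" and f: "lin_on n l f"
    and ker: "\<And>x. x \<in> kvec n \<Longrightarrow> v x = 0 \<Longrightarrow> f x = 0"
  shows "\<exists>h. lin_on m l h \<and> (\<forall>x\<in>kvec n. h (v x) = f x)"
proof -
  define g where "g y = f (inv_into (kvec n) v y)" for y
  have gv: "g (v x) = f x" if x: "x \<in> kvec n" for x
  proof -
    let ?x = "inv_into (kvec n) v (v x)"
    have x': "?x \<in> kvec n" "v ?x = v x" using inv_into_into[OF imageI[OF x]] f_inv_into_f[OF imageI[OF x]] by auto
    have "f (?x - x) = 0"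
      by (rule ker) (use x x' lin_diff[OF v x'(1) x] in simp_all)
    then show ?thesis using lin_diff[OF f x'(1) x] by (simp add: g_def)
  qed
  have "\<exists>h. lin_on m l h \<and> (\<forall>y\<in>v ` kvec n. h y = g y)"
  proof (rule lin_extend)
    show "ksubspace m (v ` kvec n)" by (rule ksubspace_image[OF v]) simp
    fix y assume "y \<in> v ` kvec n"
    then obtain x where x: "x \<in> kvec n" "y = v x" by auto
    show "g y \<in> kvec l" using gv[OF x(1)] lin_in[OF f x(1)] x(2) by simp
    show "g (vscale c y) = vscale c (g y)" for c
      using gv[OF x(1)] gv[OF kvec_scale[OF x(1)]] lin_scale[OF f x(1)] lin_scale[OF v x(1)] x(2)
      by simp
    fix z assume "z \<in> v ` kvec n"
    then obtain w where w: "w \<in> kvec n" "z = v w" by auto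
    show "g (y + z) = g y + g z"
      using gv[OF x(1)] gv[OF w(1)] gv[OF kvec_add[OF x(1) w(1)]] lin_add[OF f x(1) w(1)]
        lin_add[OF v x(1) w(1)] x(2) w(2) by simp
  qed
  then show ?thesis using gv by auto
qed

lemma lin_retract:
  assumes "lin_on n m f" "inj_on f (kvec n)"
  shows "\<exists>r. lin_on m n r \<and> (\<forall>x\<in>kvec n. r (f x) = x)"
  using lin_factor_gen[OF assms(1) lin_id] lin_inj_zero[OF assms] by blast

lemma diff_exchange: "a - b = c - d \<Longrightarrow> r = b - d \<Longrightarrow> a - c = r" for a :: "'a::ab_group_add"
proof -
  assume 1: "a - b = c - d" and 2: "r = b - d"
  have "(a - c) - (b - d) = (a - b) - (c - d)" by (simp add: algebra_simps)
  then show "a - c = r" using 1 2 by simp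
qed

lemma kvec_trivial: "kvec n = ({0} :: (nat \<Rightarrow> 'k::field) set) \<Longrightarrow> n = 0"
proof (rule ccontr)
  assume k: "kvec n = ({0} :: (nat \<Rightarrow> 'k) set)" and "n \<noteq> 0"
  then have "(evec 0 :: nat \<Rightarrow> 'k) \<in> kvec n" by (intro evec_in) simp
  then have "evec 0 = (0 :: nat \<Rightarrow> 'k)" using k by simp
  then have "evec 0 0 = (0 :: 'k)" by (metis zero_fun_apply)
  then show False by (simp add: evec_def)
qed

locale acyclic_quiver = quiver V E src tgt
  for V :: "'v set" and E :: "'e set" and src tgt :: "'e \<Rightarrow> 'v" +
  assumes finite_V: "finite V" and finite_E: "finite E"
    and src_V: "a \<in> E \<Longrightarrow> src a \<in> V" and tgt_V: "a \<in> E \<Longrightarrow> tgt a \<in> V"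
    and acyclic_E: "acyclic {(src a, tgt a) | a. a \<in> E}"
begin

subsection \<open>Homomorphisms\<close>

lemma wf_lin: "wf_rep X \<Longrightarrow> a \<in> E \<Longrightarrow> lin_on (rdim X (src a)) (rdim X (tgt a)) (rmap X a)"
  by (simp add: wf_rep_def)

lemma wf_rdim: "wf_rep X \<Longrightarrow> i \<notin> V \<Longrightarrow> rdim X i = 0"
  by (simp add: wf_rep_def)

lemma hom_lin: "is_hom X Y f \<Longrightarrow> i \<in> V \<Longrightarrow> lin_on (rdim X i) (rdim Y i) (f i)"
  by (simp add: is_hom_def)

lemma hom_comm: "is_hom X Y f \<Longrightarrow> a \<in> E \<Longrightarrow> x \<in> kvec (rdim X (src a)) \<Longrightarrow>
    f (tgt a) (rmap X a x) = rmap Y a (f (src a) x)"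
  by (simp add: is_hom_def)

lemma hom_inI: "is_hom X Y f \<Longrightarrow> i \<in> V \<Longrightarrow> x \<in> kvec (rdim X i) \<Longrightarrow> f i x \<in> kvec (rdim Y i)"
  by (meson hom_lin lin_in)

lemma is_homI:
  assumes "\<And>i. i \<in> V \<Longrightarrow> lin_on (rdim X i) (rdim Y i) (f i)"
    and "\<And>a x. a \<in> E \<Longrightarrow> x \<in> kvec (rdim X (src a)) \<Longrightarrow>
      f (tgt a) (rmap X a x) = rmap Y a (f (src a) x)"
  shows "is_hom X Y f"
  using assms by (simp add: is_hom_def)

lemma hom_injD: "hom_inj X f \<Longrightarrow> i \<in> V \<Longrightarrow> f i x = f i y \<Longrightarrow>
    x \<in> kvec (rdim X i) \<Longrightarrow> y \<in> kvec (rdim X i) \<Longrightarrow> x = y"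
  unfolding hom_inj_def by (meson inj_onD)

lemma hom_surjD: "hom_surj X Y f \<Longrightarrow> i \<in> V \<Longrightarrow> y \<in> kvec (rdim Y i) \<Longrightarrow>
    \<exists>x\<in>kvec (rdim X i). y = f i x"
  unfolding hom_surj_def by blast

lemma wf_map: "wf_rep X \<Longrightarrow> a \<in> E \<Longrightarrow> x \<in> kvec (rdim X (src a)) \<Longrightarrow>
    rmap X a x \<in> kvec (rdim X (tgt a))"
  by (meson wf_lin lin_in)

lemma hom_compose: "is_hom X Y f \<Longrightarrow> is_hom Y Z g \<Longrightarrow> is_hom X Z (\<lambda>i x. g i (f i x))"
  by (rule is_homI) (auto intro: lin_comp hom_lin simp: hom_comm hom_inI src_V)

lemma hom_identity: "is_hom X X (\<lambda>i x. x)"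
  by (rule is_homI) (auto intro: lin_id)

text \<open>The lift is chosen vertex by vertex; compatibility with the arrows can be checked after
  applying \<open>f\<close>, because \<open>f\<close> is injective.\<close>

lemma hom_lift_inj:
  fixes X :: "('v, 'e, 'k::field) qrep"
  assumes f: "is_hom B X f" "hom_inj B f" and h: "is_hom A X h"
    and wf: "wf_rep A" "wf_rep B"
    and im: "\<And>i x. i \<in> V \<Longrightarrow> x \<in> kvec (rdim A i) \<Longrightarrow> h i x \<in> f i ` kvec (rdim B i)"
  shows "\<exists>h'. is_hom A B h' \<and> (\<forall>i\<in>V. \<forall>x\<in>kvec (rdim A i). f i (h' i x) = h i x)"
proof -
  have "\<forall>i\<in>V. \<exists>g. lin_on (rdim A i) (rdim B i) g \<and> (\<forall>x\<in>kvec (rdim A i). f i (g x) = h i x)"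
    using lin_lift[OF hom_lin[OF f(1)] hom_lin[OF h]] im by blast
  from bchoice[OF this] obtain g where
    g: "\<forall>i\<in>V. lin_on (rdim A i) (rdim B i) (g i) \<and> (\<forall>x\<in>kvec (rdim A i). f i (g i x) = h i x)" ..
  have "is_hom A B g"
  proof (rule is_homI)
    fix a and x :: "nat \<Rightarrow> 'k" assume a: "a \<in> E" and x: "x \<in> kvec (rdim A (src a))"
    have gx: "g (src a) x \<in> kvec (rdim B (src a))"
      using g src_V[OF a] x lin_in by blast
    have Ax: "rmap A a x \<in> kvec (rdim A (tgt a))" using lin_in[OF wf_lin[OF wf(1) a] x] .
    have "f (tgt a) (g (tgt a) (rmap A a x)) = h (tgt a) (rmap A a x)"
      using g tgt_V[OF a] Ax by blast
    also have "\<dots> = rmap X a (h (src a) x)" by (rule hom_comm[OF h a x])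
    also have "\<dots> = rmap X a (f (src a) (g (src a) x))" using g src_V[OF a] x by simp
    also have "\<dots> = f (tgt a) (rmap B a (g (src a) x))" using hom_comm[OF f(1) a gx] by simp
    finally have eq: "f (tgt a) (g (tgt a) (rmap A a x)) = f (tgt a) (rmap B a (g (src a) x))" .
    have "g (tgt a) (rmap A a x) \<in> kvec (rdim B (tgt a))"
      using g tgt_V[OF a] Ax lin_in by blast
    then show "g (tgt a) (rmap A a x) = rmap B a (g (src a) x)"
      by (rule hom_injD[OF f(2) tgt_V[OF a] eq _ wf_map[OF wf(2) a gx]])
  qed (use g in blast)
  then show ?thesis using g by blast
qed

text \<open>The factor is chosen vertex by vertex; compatibility with the arrows can be checked on
  vectors \<open>p (src a) x\<close>, because \<open>p\<close> is onto.\<close>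

lemma hom_factor_surj:
  fixes X :: "('v, 'e, 'k::field) qrep"
  assumes p: "is_hom X M p" "hom_surj X M p" and h: "is_hom X Z h"
    and wf: "wf_rep X" "wf_rep Z"
    and ker: "\<And>i x. i \<in> V \<Longrightarrow> x \<in> kvec (rdim X i) \<Longrightarrow> p i x = 0 \<Longrightarrow> h i x = 0"
  shows "\<exists>h'. is_hom M Z h' \<and> (\<forall>i\<in>V. \<forall>x\<in>kvec (rdim X i). h' i (p i x) = h i x)"
proof -
  have "\<forall>i\<in>V. \<exists>g. lin_on (rdim M i) (rdim Z i) g \<and> (\<forall>x\<in>kvec (rdim X i). g (p i x) = h i x)"
    using lin_factor_gen[OF hom_lin[OF p(1)] hom_lin[OF h]] ker by blast
  from bchoice[OF this] obtain g where
    g: "\<forall>i\<in>V. lin_on (rdim M i) (rdim Z i) (g i) \<and> (\<forall>x\<in>kvec (rdim X i). g i (p i x) = h i x)" ..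
  have "is_hom M Z g"
  proof (rule is_homI)
    fix a and y :: "nat \<Rightarrow> 'k" assume a: "a \<in> E" and y: "y \<in> kvec (rdim M (src a))"
    then obtain x where x: "x \<in> kvec (rdim X (src a))" "y = p (src a) x"
      using p(2) src_V[OF a] unfolding hom_surj_def by blast
    have Xx: "rmap X a x \<in> kvec (rdim X (tgt a))" using lin_in[OF wf_lin[OF wf(1) a] x(1)] .
    have "g (tgt a) (rmap M a y) = g (tgt a) (p (tgt a) (rmap X a x))"
      using hom_comm[OF p(1) a x(1)] x(2) by simp
    also have "\<dots> = rmap Z a (h (src a) x)" using g tgt_V[OF a] Xx hom_comm[OF h a x(1)] by simp
    also have "\<dots> = rmap Z a (g (src a) y)" using g src_V[OF a] x by simp
    finally show "g (tgt a) (rmap M a y) = rmap Z a (g (src a) y)" .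
  qed (use g in blast)
  then show ?thesis using g by blast
qed

lemma hom_inverse:
  fixes X :: "('v, 'e, 'k::field) qrep"
  assumes f: "is_hom X Y f" "hom_inj X f" "hom_surj X Y f" and wf: "wf_rep X" "wf_rep Y"
  shows "\<exists>g. is_hom Y X g \<and> hom_inj Y g \<and> hom_surj Y X g \<and>
    (\<forall>i\<in>V. \<forall>x\<in>kvec (rdim X i). g i (f i x) = x) \<and> (\<forall>i\<in>V. \<forall>y\<in>kvec (rdim Y i). f i (g i y) = y)"
proof -
  obtain g where g: "is_hom Y X g" "\<forall>i\<in>V. \<forall>y\<in>kvec (rdim Y i). f i (g i y) = y"
    using hom_lift_inj[OF f(1,2) hom_identity wf(2,1)] f(3) unfolding hom_surj_def by blast
  have gf: "\<forall>i\<in>V. \<forall>x\<in>kvec (rdim X i). g i (f i x) = x"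
  proof (intro ballI)
    fix i and x :: "nat \<Rightarrow> 'k" assume i: "i \<in> V" and x: "x \<in> kvec (rdim X i)"
    have fx: "f i x \<in> kvec (rdim Y i)" by (rule hom_inI[OF f(1) i x])
    show "g i (f i x) = x"
      by (rule hom_injD[OF f(2) i _ hom_inI[OF g(1) i fx] x]) (use g(2) i fx in blast)
  qed
  have "hom_inj Y g" unfolding hom_inj_def inj_on_def using g(2) by metis
  moreover have "hom_surj Y X g" unfolding hom_surj_def
  proof (intro ballI equalityI subsetI)
    fix i and x :: "nat \<Rightarrow> 'k" assume i: "i \<in> V" and x: "x \<in> kvec (rdim X i)"
    then show "x \<in> g i ` kvec (rdim Y i)"
      using gf hom_inI[OF f(1) i x] by (metis image_eqI)
  qed (use hom_inI[OF g(1)] in blast)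
  ultimately show ?thesis using g gf by blast
qed

lemma rep_iso_refl: "rep_iso X X"
  unfolding rep_iso_def hom_inj_def hom_surj_def using hom_identity by (intro exI[of _ "\<lambda>i x. x"]) auto

lemma rep_iso_sym: "rep_iso X Y \<Longrightarrow> wf_rep X \<Longrightarrow> wf_rep Y \<Longrightarrow> rep_iso Y X"
  unfolding rep_iso_def using hom_inverse by metis

lemma hom_inj_compose: "hom_inj X f \<Longrightarrow> is_hom X Y f \<Longrightarrow> hom_inj Y g \<Longrightarrow> hom_inj X (\<lambda>i x. g i (f i x))"
  unfolding hom_inj_def inj_on_def using hom_inI by meson

lemma hom_surj_compose: "hom_surj X Y f \<Longrightarrow> hom_surj Y Z g \<Longrightarrow> hom_surj X Z (\<lambda>i x. g i (f i x))"
  unfolding hom_surj_def by (metis image_image)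

lemma rep_iso_trans: "rep_iso X Y \<Longrightarrow> rep_iso Y Z \<Longrightarrow> rep_iso X Z"
  unfolding rep_iso_def using hom_compose hom_inj_compose hom_surj_compose by meson

lemma iso_class_eq_iff: "wf_rep X \<Longrightarrow> wf_rep Y \<Longrightarrow> iso_class X = iso_class Y \<longleftrightarrow> rep_iso X Y"
  unfolding iso_class_def using rep_iso_refl rep_iso_sym rep_iso_trans by blast

lemma iso_class_self: "wf_rep X \<Longrightarrow> X \<in> iso_class X"
  by (simp add: iso_class_def rep_iso_refl)

lemma iso_class_in: "wf_rep X \<Longrightarrow> iso_class X \<in> iso_classes"
  by (auto simp: iso_classes_def)

subsection \<open>Subrepresentations and quotients\<close>

definition sub_iso :: "('v, 'e, 'k::field) qrep \<Rightarrow> ('v \<Rightarrow> (nat \<Rightarrow> 'k) set) \<Rightarrow> ('v, 'e, 'k) qrep \<Rightarrow> bool" where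
  "sub_iso X U N \<longleftrightarrow> (\<exists>f. is_hom N X f \<and> hom_inj N f \<and> (\<forall>i\<in>V. f i ` kvec (rdim N i) = U i))"

definition quo_iso :: "('v, 'e, 'k::field) qrep \<Rightarrow> ('v \<Rightarrow> (nat \<Rightarrow> 'k) set) \<Rightarrow> ('v, 'e, 'k) qrep \<Rightarrow> bool" where
  "quo_iso X U M \<longleftrightarrow> (\<exists>g. is_hom X M g \<and> hom_surj X M g
      \<and> (\<forall>i\<in>V. {x \<in> kvec (rdim X i). g i x = 0} = U i))"

lemma subrep_sub: "subrep X U \<Longrightarrow> ksubspace (rdim X i) (U i)"
  by (simp add: subrep_def)

lemma subrep_map: "subrep X U \<Longrightarrow> a \<in> E \<Longrightarrow> x \<in> U (src a) \<Longrightarrow> rmap X a x \<in> U (tgt a)"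
  by (auto simp: subrep_def)

lemma subrep_outside: "wf_rep X \<Longrightarrow> subrep X U \<Longrightarrow> i \<notin> V \<Longrightarrow> U i = {0}"
  using subrep_sub[of X U i] wf_rdim[of X i] by (simp add: ksubspace_0)

text \<open>A subrepresentation is a family of subspaces, while a representation lives on coordinate
  spaces. \<open>subspace_param\<close> gives coordinates at each vertex, and the arrow maps are
  lifts of the restricted ones.\<close>

lemma sub_exists:
  fixes X :: "('v, 'e, 'k::field) qrep"
  assumes X: "wf_rep X" and U: "subrep X U"
  shows "\<exists>B. wf_rep B \<and> sub_iso X U B"
proof -
  have "\<forall>i\<in>V. \<exists>mf. lin_on (fst mf) (rdim X i) (snd mf) \<and> inj_on (snd mf) (kvec (fst mf))
      \<and> snd mf ` kvec (fst mf) = U i"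
  proof
    fix i
    from subspace_param[OF subrep_sub[OF U, of i]] obtain m j r where
      *: "lin_on m (rdim X i) j" "\<forall>x\<in>kvec m. r (j x) = x" "j ` kvec m = U i"
      by (elim exE conjE)
    then have "inj_on j (kvec m)" by (metis inj_onI)
    with * show "\<exists>mf. lin_on (fst mf) (rdim X i) (snd mf) \<and> inj_on (snd mf) (kvec (fst mf))
      \<and> snd mf ` kvec (fst mf) = U i" by (intro exI[of _ "(m, j)"]) simp
  qed
  from bchoice[OF this] obtain mf where mf: "\<forall>i\<in>V. lin_on (fst (mf i)) (rdim X i) (snd (mf i))
    \<and> inj_on (snd (mf i)) (kvec (fst (mf i))) \<and> snd (mf i) ` kvec (fst (mf i)) = U i" ..
  define d where "d i = (if i \<in> V then fst (mf i) else 0)" for i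
  define j where "j i = snd (mf i)" for i
  have j: "lin_on (d i) (rdim X i) (j i)" "inj_on (j i) (kvec (d i))" "j i ` kvec (d i) = U i"
    if "i \<in> V" for i using mf that by (auto simp: d_def j_def)
  have "\<forall>a\<in>E. \<exists>h. lin_on (d (src a)) (d (tgt a)) h \<and>
      (\<forall>x\<in>kvec (d (src a)). j (tgt a) (h x) = rmap X a (j (src a) x))"
  proof
    fix a assume a: "a \<in> E"
    show "\<exists>h. lin_on (d (src a)) (d (tgt a)) h \<and>
      (\<forall>x\<in>kvec (d (src a)). j (tgt a) (h x) = rmap X a (j (src a) x))"
    proof (rule lin_lift[OF j(1)[OF tgt_V[OF a]] lin_comp[OF j(1)[OF src_V[OF a]] wf_lin[OF X a]]])
      fix x :: "nat \<Rightarrow> 'k" assume "x \<in> kvec (d (src a))"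
      then have "j (src a) x \<in> U (src a)" using j(3)[OF src_V[OF a]] by blast
      then show "rmap X a (j (src a) x) \<in> j (tgt a) ` kvec (d (tgt a))"
        using subrep_map[OF U a] j(3)[OF tgt_V[OF a]] by simp
    qed
  qed
  from bchoice[OF this] obtain h where h: "\<forall>a\<in>E. lin_on (d (src a)) (d (tgt a)) (h a) \<and>
      (\<forall>x\<in>kvec (d (src a)). j (tgt a) (h a x) = rmap X a (j (src a) x))" ..
  let ?B = "\<lparr>rdim = d, rmap = h\<rparr>"
  have "wf_rep ?B" using h by (simp add: wf_rep_def d_def)
  moreover have "is_hom ?B X j" using j h by (simp add: is_hom_def)
  ultimately show ?thesis using j unfolding sub_iso_def hom_inj_def
    by (intro exI[of _ ?B] conjI exI[of _ j]) auto
qed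

lemma quo_exists:
  fixes X :: "('v, 'e, 'k::field) qrep"
  assumes X: "wf_rep X" and U: "subrep X U"
  shows "\<exists>B. wf_rep B \<and> quo_iso X U B"
proof -
  have "\<forall>i\<in>V. \<exists>mf. lin_on (rdim X i) (fst mf) (snd mf) \<and> snd mf ` kvec (rdim X i) = kvec (fst mf)
      \<and> {x \<in> kvec (rdim X i). snd mf x = 0} = U i"
  proof
    fix i
    from subspace_quotient[OF subrep_sub[OF U, of i]] obtain m p where
      *: "lin_on (rdim X i) m p" "p ` kvec (rdim X i) = kvec m" "{x \<in> kvec (rdim X i). p x = 0} = U i"
      by (elim exE conjE)
    then show "\<exists>mf. lin_on (rdim X i) (fst mf) (snd mf) \<and> snd mf ` kvec (rdim X i) = kvec (fst mf)
      \<and> {x \<in> kvec (rdim X i). snd mf x = 0} = U i" by (intro exI[of _ "(m, p)"]) simp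
  qed
  from bchoice[OF this] obtain mf where mf: "\<forall>i\<in>V. lin_on (rdim X i) (fst (mf i)) (snd (mf i))
      \<and> snd (mf i) ` kvec (rdim X i) = kvec (fst (mf i))
      \<and> {x \<in> kvec (rdim X i). snd (mf i) x = 0} = U i" ..
  define d where "d i = (if i \<in> V then fst (mf i) else 0)" for i
  define p where "p i = snd (mf i)" for i
  have p: "lin_on (rdim X i) (d i) (p i)" "p i ` kvec (rdim X i) = kvec (d i)"
    "{x \<in> kvec (rdim X i). p i x = 0} = U i"
    if "i \<in> V" for i using mf that by (auto simp: d_def p_def)
  have "\<forall>a\<in>E. \<exists>h. lin_on (d (src a)) (d (tgt a)) h \<and>
      (\<forall>x\<in>kvec (rdim X (src a)). h (p (src a) x) = p (tgt a) (rmap X a x))"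
  proof
    fix a assume a: "a \<in> E"
    show "\<exists>h. lin_on (d (src a)) (d (tgt a)) h \<and>
      (\<forall>x\<in>kvec (rdim X (src a)). h (p (src a) x) = p (tgt a) (rmap X a x))"
    proof (rule lin_factor_gen[OF p(1)[OF src_V[OF a]] lin_comp[OF wf_lin[OF X a] p(1)[OF tgt_V[OF a]]]])
      fix x :: "nat \<Rightarrow> 'k" assume "x \<in> kvec (rdim X (src a))" "p (src a) x = 0"
      then have "x \<in> U (src a)" using p(3)[OF src_V[OF a]] by blast
      then have "rmap X a x \<in> U (tgt a)" by (rule subrep_map[OF U a])
      then show "p (tgt a) (rmap X a x) = 0" using p(3)[OF tgt_V[OF a]] by blast
    qed
  qed
  from bchoice[OF this] obtain h where h: "\<forall>a\<in>E. lin_on (d (src a)) (d (tgt a)) (h a) \<and>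
      (\<forall>x\<in>kvec (rdim X (src a)). h a (p (src a) x) = p (tgt a) (rmap X a x))" ..
  let ?B = "\<lparr>rdim = d, rmap = h\<rparr>"
  have "wf_rep ?B" using h by (simp add: wf_rep_def d_def)
  moreover have "is_hom X ?B p" using p h by (simp add: is_hom_def)
  ultimately show ?thesis using p unfolding quo_iso_def hom_surj_def
    by (intro exI[of _ ?B] conjI exI[of _ p]) auto
qed

lemma sub_iso_unique:
  fixes X :: "('v, 'e, 'k::field) qrep"
  assumes "sub_iso X U B" "sub_iso X U B'" "wf_rep B" "wf_rep B'"
  shows "rep_iso B B'"
proof -
  obtain f where f: "is_hom B X f" "hom_inj B f" "\<forall>i\<in>V. f i ` kvec (rdim B i) = U i"
    using assms(1) unfolding sub_iso_def by (elim exE conjE)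
  obtain f' where f': "is_hom B' X f'" "hom_inj B' f'" "\<forall>i\<in>V. f' i ` kvec (rdim B' i) = U i"
    using assms(2) unfolding sub_iso_def by (elim exE conjE)
  obtain h where h: "is_hom B B' h" "\<forall>i\<in>V. \<forall>x\<in>kvec (rdim B i). f' i (h i x) = f i x"
    using hom_lift_inj[OF f'(1,2) f(1) assms(3,4)] f(3) f'(3) by blast
  have "hom_inj B h" unfolding hom_inj_def
  proof (intro ballI inj_onI)
    fix i and x y :: "nat \<Rightarrow> 'k" assume *: "i \<in> V" "x \<in> kvec (rdim B i)" "y \<in> kvec (rdim B i)" "h i x = h i y"
    then have "f i x = f i y" using h(2) by metis
    then show "x = y" using hom_injD[OF f(2)] * by blast
  qed
  moreover have "hom_surj B B' h" unfolding hom_surj_def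
  proof (intro ballI equalityI subsetI)
    fix i and y :: "nat \<Rightarrow> 'k" assume i: "i \<in> V" and y: "y \<in> kvec (rdim B' i)"
    then have "f' i y \<in> f i ` kvec (rdim B i)" using f(3)[rule_format, OF i] f'(3)[rule_format, OF i] by blast
    then obtain x where x: "x \<in> kvec (rdim B i)" "f' i y = f i x" by auto
    then have "f' i (h i x) = f' i y" using h(2) i by simp
    then have "h i x = y" using hom_injD[OF f'(2) i _ hom_inI[OF h(1) i x(1)] y] by blast
    then show "y \<in> h i ` kvec (rdim B i)" using x by blast
  qed (use hom_inI[OF h(1)] in blast)
  ultimately show ?thesis using h(1) unfolding rep_iso_def by blast
qed

lemma quo_iso_unique:
  fixes X :: "('v, 'e, 'k::field) qrep"
  assumes "quo_iso X U B" "quo_iso X U B'" "wf_rep X" "wf_rep B" "wf_rep B'"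
  shows "rep_iso B B'"
proof -
  obtain f where f: "is_hom X B f" "hom_surj X B f" "\<forall>i\<in>V. {x \<in> kvec (rdim X i). f i x = 0} = U i"
    using assms(1) unfolding quo_iso_def by (elim exE conjE)
  obtain f' where f': "is_hom X B' f'" "hom_surj X B' f'"
    "\<forall>i\<in>V. {x \<in> kvec (rdim X i). f' i x = 0} = U i"
    using assms(2) unfolding quo_iso_def by (elim exE conjE)
  have ker: "f i x = 0 \<longleftrightarrow> f' i x = 0" if "i \<in> V" "x \<in> kvec (rdim X i)" for i and x :: "nat \<Rightarrow> 'k"
    using f(3) f'(3) that by blast
  have "\<exists>h. is_hom B B' h \<and> (\<forall>i\<in>V. \<forall>x\<in>kvec (rdim X i). h i (f i x) = f' i x)"
    by (rule hom_factor_surj[OF f(1,2) f'(1) assms(3,5)]) (simp add: ker)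
  then obtain h where h: "is_hom B B' h" "\<forall>i\<in>V. \<forall>x\<in>kvec (rdim X i). h i (f i x) = f' i x"
    by (elim exE conjE)
  have "hom_inj B h" unfolding hom_inj_def
  proof (intro ballI lin_inj)
    fix i and y :: "nat \<Rightarrow> 'k" assume *: "i \<in> V" "y \<in> kvec (rdim B i)" "h i y = 0"
    then obtain x where x: "x \<in> kvec (rdim X i)" "y = f i x" using f(2) unfolding hom_surj_def by blast
    then have "f' i x = 0" using h(2) * by auto
    then show "y = 0" using ker x * by simp
  qed (rule hom_lin[OF h(1)])
  moreover have "hom_surj B B' h" unfolding hom_surj_def
  proof (intro ballI equalityI subsetI)
    fix i and y :: "nat \<Rightarrow> 'k" assume i: "i \<in> V" and y: "y \<in> kvec (rdim B' i)"
    then obtain x where x: "x \<in> kvec (rdim X i)" "y = f' i x" using f'(2) unfolding hom_surj_def by blast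
    then have "h i (f i x) = y" using h(2) i by simp
    then show "y \<in> h i ` kvec (rdim B i)" using hom_inI[OF f(1) i x(1)] by blast
  qed (use hom_inI[OF h(1)] in blast)
  ultimately show ?thesis using h(1) unfolding rep_iso_def by blast
qed

lemma sub_iso_cong: "sub_iso X U B \<Longrightarrow> rep_iso B' B \<Longrightarrow> sub_iso X U B'"
proof -
  assume "sub_iso X U B" "rep_iso B' B"
  then obtain f h where f: "is_hom B X f" "hom_inj B f" "\<forall>i\<in>V. f i ` kvec (rdim B i) = U i"
    and h: "is_hom B' B h" "hom_inj B' h" "hom_surj B' B h"
    unfolding sub_iso_def rep_iso_def by (elim exE conjE)
  have "\<forall>i\<in>V. (\<lambda>x. f i (h i x)) ` kvec (rdim B' i) = U i"
    using f(3) h(3) unfolding hom_surj_def by (metis image_image)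
  then show ?thesis unfolding sub_iso_def
    using hom_compose[OF h(1) f(1)] hom_inj_compose[OF h(2,1) f(2)] by blast
qed

lemma quo_iso_cong: "quo_iso X U B \<Longrightarrow> rep_iso B B' \<Longrightarrow> quo_iso X U B'"
proof -
  assume "quo_iso X U B" "rep_iso B B'"
  then obtain f h where f: "is_hom X B f" "hom_surj X B f"
    "\<forall>i\<in>V. {x \<in> kvec (rdim X i). f i x = 0} = U i"
    and h: "is_hom B B' h" "hom_inj B h" "hom_surj B B' h"
    unfolding quo_iso_def rep_iso_def by (elim exE conjE)
  have "{x \<in> kvec (rdim X i). h i (f i x) = 0} = {x \<in> kvec (rdim X i). f i x = 0}" if i: "i \<in> V" for i
    using lin_inj_zero[OF hom_lin[OF h(1) i]] h(2) i hom_inI[OF f(1) i] lin_zero[OF hom_lin[OF h(1) i]]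
    unfolding hom_inj_def by auto
  then show ?thesis unfolding quo_iso_def
    using hom_compose[OF f(1) h(1)] hom_surj_compose[OF f(2) h(3)] f(3) by auto
qed

lemma subrep_kernel: "is_hom X Y f \<Longrightarrow> wf_rep X \<Longrightarrow> wf_rep Y \<Longrightarrow>
    subrep X (\<lambda>i. if i \<in> V then {x \<in> kvec (rdim X i). f i x = 0} else {0})"
  unfolding subrep_def
  by (auto simp: src_V tgt_V hom_comm lin_in[OF wf_lin] lin_zero[OF wf_lin]
      intro: ksubspace_kernel hom_lin)

lemma subrep_image:
  fixes X :: "('v, 'e, 'k::field) qrep"
  assumes f: "is_hom X Y f" and X: "wf_rep X" and U: "subrep X U"
  shows "subrep Y (\<lambda>i. if i \<in> V then f i ` U i else {0})"
  unfolding subrep_def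
proof (intro conjI allI ballI image_subsetI)
  show "ksubspace (rdim Y i) (if i \<in> V then f i ` U i else {0})" for i
    using ksubspace_image[OF hom_lin[OF f] subrep_sub[OF U]] by simp
  fix a and y :: "nat \<Rightarrow> 'k" assume a: "a \<in> E" and "y \<in> (if src a \<in> V then f (src a) ` U (src a) else {0})"
  then obtain x where x: "x \<in> U (src a)" "y = f (src a) x" using src_V[OF a] by auto
  have "rmap Y a y = f (tgt a) (rmap X a x)"
    using hom_comm[OF f a ksubspaceD(1)[OF subrep_sub[OF U] x(1)]] x(2) by simp
  then show "rmap Y a y \<in> (if tgt a \<in> V then f (tgt a) ` U (tgt a) else {0})"
    using tgt_V[OF a] subrep_map[OF U a x(1)] by simp
qed

lemma subrep_vimage: "is_hom X Y f \<Longrightarrow> wf_rep X \<Longrightarrow> subrep Y U \<Longrightarrow>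
    subrep X (\<lambda>i. if i \<in> V then {x \<in> kvec (rdim X i). f i x \<in> U i} else {0})"
  unfolding subrep_def
  by (auto simp: src_V tgt_V hom_comm lin_in[OF wf_lin] image_subset_iff intro!: ksubspace_vimage[OF hom_lin])

lemma subrep_full: "wf_rep X \<Longrightarrow> subrep X (\<lambda>i. kvec (rdim X i))"
  unfolding subrep_def by (auto simp: lin_in[OF wf_lin])

subsection \<open>Extensions as cocycles\<close>

text \<open>\<open>Ext(A,B)\<close> is the cokernel of the map sending \<open>(\<phi>\<^sub>i : A\<^sub>i \<rightarrow> B\<^sub>i)\<^sub>i\<close> to
  \<open>(\<phi>\<^bsub>tgt a\<^esub> A\<^sub>a - B\<^sub>a \<phi>\<^bsub>src a\<^esub>)\<^sub>a\<close>; its kernel is \<open>Hom(A,B)\<close>.  In this form heredity and the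
  Euler form are immediate.\<close>

definition cocycle :: "('v, 'e, 'k::field) qrep \<Rightarrow> ('v, 'e, 'k) qrep
    \<Rightarrow> ('e \<Rightarrow> (nat \<Rightarrow> 'k) \<Rightarrow> nat \<Rightarrow> 'k) \<Rightarrow> bool" where
  "cocycle A B c \<longleftrightarrow> (\<forall>a\<in>E. lin_on (rdim A (src a)) (rdim B (tgt a)) (c a))"

definition cobound :: "('v, 'e, 'k::field) qrep \<Rightarrow> ('v, 'e, 'k) qrep
    \<Rightarrow> ('e \<Rightarrow> (nat \<Rightarrow> 'k) \<Rightarrow> nat \<Rightarrow> 'k) \<Rightarrow> bool" where
  "cobound A B c \<longleftrightarrow> (\<exists>\<phi>. (\<forall>i\<in>V. lin_on (rdim A i) (rdim B i) (\<phi> i)) \<and>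
     (\<forall>a\<in>E. \<forall>x\<in>kvec (rdim A (src a)).
        c a x = \<phi> (tgt a) (rmap A a x) - rmap B a (\<phi> (src a) x)))"

definition ext_zero :: "('v, 'e, 'k::field) qrep \<Rightarrow> ('v, 'e, 'k) qrep \<Rightarrow> bool" where
  "ext_zero A B \<longleftrightarrow> (\<forall>c. cocycle A B c \<longrightarrow> cobound A B c)"

definition hom_zero :: "('v, 'e, 'k::field) qrep \<Rightarrow> ('v, 'e, 'k) qrep \<Rightarrow> bool" where
  "hom_zero A B \<longleftrightarrow> (\<forall>f. is_hom A B f \<longrightarrow> (\<forall>i\<in>V. \<forall>x\<in>kvec (rdim A i). f i x = 0))"

definition ses :: "('v, 'e, 'k::field) qrep \<Rightarrow> ('v, 'e, 'k) qrep \<Rightarrow> ('v, 'e, 'k) qrep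
    \<Rightarrow> ('v \<Rightarrow> (nat \<Rightarrow> 'k) \<Rightarrow> (nat \<Rightarrow> 'k)) \<Rightarrow> ('v \<Rightarrow> (nat \<Rightarrow> 'k) \<Rightarrow> (nat \<Rightarrow> 'k)) \<Rightarrow> bool" where
  "ses A X C f g \<longleftrightarrow> wf_rep A \<and> wf_rep X \<and> wf_rep C \<and> is_hom A X f \<and> hom_inj A f
    \<and> is_hom X C g \<and> hom_surj X C g
    \<and> (\<forall>i\<in>V. {x \<in> kvec (rdim X i). g i x = 0} = f i ` kvec (rdim A i))"

lemma cocycle_lin: "cocycle A B c \<Longrightarrow> a \<in> E \<Longrightarrow> lin_on (rdim A (src a)) (rdim B (tgt a)) (c a)"
  by (simp add: cocycle_def)

lemma cocycle_post: "cocycle A B c \<Longrightarrow> is_hom B B' u \<Longrightarrow> cocycle A B' (\<lambda>a x. u (tgt a) (c a x))"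
  unfolding cocycle_def using lin_comp hom_lin tgt_V by blast

lemma cocycle_pre: "cocycle A B c \<Longrightarrow> is_hom A' A v \<Longrightarrow> cocycle A' B (\<lambda>a x. c a (v (src a) x))"
  unfolding cocycle_def using lin_comp hom_lin src_V by blast

lemma cobound_cong:
  "cobound A B c \<Longrightarrow> (\<And>a x. a \<in> E \<Longrightarrow> x \<in> kvec (rdim A (src a)) \<Longrightarrow> c' a x = c a x) \<Longrightarrow> cobound A B c'"
  unfolding cobound_def by (elim exE conjE, intro exI conjI) auto

lemma cobound_diff:
  fixes A B :: "('v, 'e, 'k::field) qrep"
  assumes "cobound A B c" "cobound A B c'" and wf: "wf_rep A" "wf_rep B"
  shows "cobound A B (\<lambda>a x. c a x - c' a x)"
proof -
  obtain \<phi> where \<phi>: "\<forall>i\<in>V. lin_on (rdim A i) (rdim B i) (\<phi> i)"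
    "\<forall>a\<in>E. \<forall>x\<in>kvec (rdim A (src a)). c a x = \<phi> (tgt a) (rmap A a x) - rmap B a (\<phi> (src a) x)"
    using assms(1) unfolding cobound_def by (elim exE conjE)
  obtain \<psi> where \<psi>: "\<forall>i\<in>V. lin_on (rdim A i) (rdim B i) (\<psi> i)"
    "\<forall>a\<in>E. \<forall>x\<in>kvec (rdim A (src a)). c' a x = \<psi> (tgt a) (rmap A a x) - rmap B a (\<psi> (src a) x)"
    using assms(2) unfolding cobound_def by (elim exE conjE)
  show ?thesis unfolding cobound_def
  proof (intro exI[of _ "\<lambda>i x. \<phi> i x - \<psi> i x"] conjI ballI)
    fix a and x :: "nat \<Rightarrow> 'k" assume a: "a \<in> E" and x: "x \<in> kvec (rdim A (src a))"
    have "rmap B a (\<phi> (src a) x - \<psi> (src a) x) = rmap B a (\<phi> (src a) x) - rmap B a (\<psi> (src a) x)"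
      by (rule lin_diff[OF wf_lin[OF wf(2) a]]) (use \<phi>(1) \<psi>(1) src_V[OF a] x lin_in in blast)+
    then show "c a x - c' a x = \<phi> (tgt a) (rmap A a x) - \<psi> (tgt a) (rmap A a x)
        - rmap B a (\<phi> (src a) x - \<psi> (src a) x)"
      using \<phi>(2) \<psi>(2) a x by simp
  qed (use \<phi>(1) \<psi>(1) lin_sub in blast)
qed

lemma cobound_zero: "wf_rep B \<Longrightarrow> cobound A B (\<lambda>a x. 0)"
  unfolding cobound_def
  by (intro exI[of _ "\<lambda>i x. 0"]) (auto simp: lin_const0 lin_zero[OF wf_lin])

lemma cobound_minus: "cobound A B c \<Longrightarrow> wf_rep A \<Longrightarrow> wf_rep B \<Longrightarrow> cobound A B (\<lambda>a x. - c a x)"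
  using cobound_diff[OF cobound_zero, of B A c] by simp

lemma cobound_add: "cobound A B c \<Longrightarrow> cobound A B c' \<Longrightarrow> wf_rep A \<Longrightarrow> wf_rep B \<Longrightarrow>
    cobound A B (\<lambda>a x. c a x + c' a x)"
  using cobound_diff[OF _ cobound_minus, of A B c c'] by simp

lemma cobound_pre:
  fixes A B :: "('v, 'e, 'k::field) qrep"
  assumes c: "cobound A B c" and v: "is_hom A' A v"
  shows "cobound A' B (\<lambda>a x. c a (v (src a) x))"
proof -
  obtain \<phi> where \<phi>: "\<forall>i\<in>V. lin_on (rdim A i) (rdim B i) (\<phi> i)"
    "\<forall>a\<in>E. \<forall>x\<in>kvec (rdim A (src a)). c a x = \<phi> (tgt a) (rmap A a x) - rmap B a (\<phi> (src a) x)"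
    using c unfolding cobound_def by (elim exE conjE)
  show ?thesis unfolding cobound_def
  proof (intro exI[of _ "\<lambda>i x. \<phi> i (v i x)"] conjI ballI)
    fix a and x :: "nat \<Rightarrow> 'k" assume a: "a \<in> E" and x: "x \<in> kvec (rdim A' (src a))"
    show "c a (v (src a) x) = \<phi> (tgt a) (v (tgt a) (rmap A' a x)) - rmap B a (\<phi> (src a) (v (src a) x))"
      using \<phi>(2) a hom_inI[OF v src_V[OF a] x] hom_comm[OF v a x] by simp
  qed (use \<phi>(1) lin_comp hom_lin[OF v] in blast)
qed

lemma cobound_post:
  fixes A B :: "('v, 'e, 'k::field) qrep"
  assumes c: "cobound A B c" and u: "is_hom B B' u" and wf: "wf_rep A" "wf_rep B"
  shows "cobound A B' (\<lambda>a x. u (tgt a) (c a x))"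
proof -
  obtain \<phi> where \<phi>: "\<forall>i\<in>V. lin_on (rdim A i) (rdim B i) (\<phi> i)"
    "\<forall>a\<in>E. \<forall>x\<in>kvec (rdim A (src a)). c a x = \<phi> (tgt a) (rmap A a x) - rmap B a (\<phi> (src a) x)"
    using c unfolding cobound_def by (elim exE conjE)
  show ?thesis unfolding cobound_def
  proof (intro exI[of _ "\<lambda>i x. u i (\<phi> i x)"] conjI ballI)
    fix a and x :: "nat \<Rightarrow> 'k" assume a: "a \<in> E" and x: "x \<in> kvec (rdim A (src a))"
    have px: "\<phi> (src a) x \<in> kvec (rdim B (src a))" using \<phi>(1) src_V[OF a] x lin_in by blast
    have pA: "\<phi> (tgt a) (rmap A a x) \<in> kvec (rdim B (tgt a))"
      using \<phi>(1) tgt_V[OF a] wf_map[OF wf(1) a x] lin_in by blast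
    show "u (tgt a) (c a x) = u (tgt a) (\<phi> (tgt a) (rmap A a x)) - rmap B' a (u (src a) (\<phi> (src a) x))"
      using \<phi>(2) a x lin_diff[OF hom_lin[OF u tgt_V[OF a]] pA wf_map[OF wf(2) a px]]
        hom_comm[OF u a px] by simp
  qed (use \<phi>(1) lin_comp hom_lin[OF u] in blast)
qed

text \<open>Heredity: a cocycle obeys no relation between arrows, so composing with vertexwise
  linear retractions \<open>r\<close> extends it from \<open>A'\<close> to \<open>A\<close>, even
  though \<open>r\<close> need not be a homomorphism. A splitting over \<open>A\<close> is then
  restricted along \<open>i\<close>.\<close>

lemma ext_zero_sub:
  assumes e: "ext_zero A B" and i: "is_hom A' A i" "hom_inj A' i"
  shows "ext_zero A' B"
  unfolding ext_zero_def
proof (intro allI impI)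
  fix c assume c: "cocycle A' B c"
  have "\<forall>j\<in>V. \<exists>r. lin_on (rdim A j) (rdim A' j) r \<and> (\<forall>x\<in>kvec (rdim A' j). r (i j x) = x)"
    using lin_retract hom_lin[OF i(1)] i(2) unfolding hom_inj_def by blast
  from bchoice[OF this] obtain r where r: "\<forall>j\<in>V. lin_on (rdim A j) (rdim A' j) (r j)
    \<and> (\<forall>x\<in>kvec (rdim A' j). r j (i j x) = x)" ..
  have "cocycle A B (\<lambda>a x. c a (r (src a) x))"
    using c r src_V lin_comp unfolding cocycle_def by blast
  then have "cobound A B (\<lambda>a x. c a (r (src a) x))" using e by (simp add: ext_zero_def)
  then have "cobound A' B (\<lambda>a x. c a (r (src a) (i (src a) x)))" by (rule cobound_pre[OF _ i(1)])
  then show "cobound A' B c" by (rule cobound_cong) (use r src_V in simp)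
qed

text \<open>Heredity in the second argument: Ext(A,-) is right exact, because vertexwise linear
  sections \<open>s\<close> of \<open>p\<close> lift every cocycle to \<open>B\<close>.\<close>

lemma ext_zero_quo:
  assumes e: "ext_zero A B" and p: "is_hom B B' p" "hom_surj B B' p" and wf: "wf_rep A" "wf_rep B"
  shows "ext_zero A B'"
  unfolding ext_zero_def
proof (intro allI impI)
  fix c assume c: "cocycle A B' c"
  have "\<forall>j\<in>V. \<exists>s. lin_on (rdim B' j) (rdim B j) s \<and> (\<forall>x\<in>kvec (rdim B' j). p j (s x) = x)"
    using lin_section hom_lin[OF p(1)] p(2) unfolding hom_surj_def by blast
  from bchoice[OF this] obtain s where s: "\<forall>j\<in>V. lin_on (rdim B' j) (rdim B j) (s j)
    \<and> (\<forall>x\<in>kvec (rdim B' j). p j (s j x) = x)" ..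
  have "cocycle A B (\<lambda>a x. s (tgt a) (c a x))"
    using c s tgt_V lin_comp unfolding cocycle_def by blast
  then have "cobound A B (\<lambda>a x. s (tgt a) (c a x))" using e by (simp add: ext_zero_def)
  then have "cobound A B' (\<lambda>a x. p (tgt a) (s (tgt a) (c a x)))" by (rule cobound_post[OF _ p(1) wf])
  then show "cobound A B' c"
    by (rule cobound_cong) (use s tgt_V lin_in[OF cocycle_lin[OF c]] in simp)
qed

text \<open>The class of the sequence is the failure of a linear section \<open>s\<close> to commute
  with the arrows; \<open>g\<close> kills this defect, so it comes from \<open>A\<close>.\<close>

lemma ses_section_cocycle:
  fixes A X C :: "('v, 'e, 'k::field) qrep"
  assumes "ses A X C f g"
  shows "\<exists>s c. (\<forall>i\<in>V. lin_on (rdim C i) (rdim X i) (s i)) \<and>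
    (\<forall>i\<in>V. \<forall>y\<in>kvec (rdim C i). g i (s i y) = y) \<and> cocycle C A c \<and>
    (\<forall>a\<in>E. \<forall>y\<in>kvec (rdim C (src a)).
      f (tgt a) (c a y) = rmap X a (s (src a) y) - s (tgt a) (rmap C a y))"
proof -
  have wf: "wf_rep A" "wf_rep X" "wf_rep C" and f: "is_hom A X f" "hom_inj A f"
    and g: "is_hom X C g" "hom_surj X C g"
    and ex: "\<And>i. i \<in> V \<Longrightarrow> {x \<in> kvec (rdim X i). g i x = 0} = f i ` kvec (rdim A i)"
    using assms unfolding ses_def by auto
  have "\<forall>j\<in>V. \<exists>s. lin_on (rdim C j) (rdim X j) s \<and> (\<forall>y\<in>kvec (rdim C j). g j (s y) = y)"
    using lin_section hom_lin[OF g(1)] g(2) unfolding hom_surj_def by blast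
  from bchoice[OF this] obtain s where s': "\<forall>j\<in>V. lin_on (rdim C j) (rdim X j) (s j)
    \<and> (\<forall>y\<in>kvec (rdim C j). g j (s j y) = y)" ..
  then have s: "\<And>j. j \<in> V \<Longrightarrow> lin_on (rdim C j) (rdim X j) (s j)"
    and gs: "\<And>j y. j \<in> V \<Longrightarrow> y \<in> kvec (rdim C j) \<Longrightarrow> g j (s j y) = y" by auto
  have "\<forall>a\<in>E. \<exists>c. lin_on (rdim C (src a)) (rdim A (tgt a)) c \<and>
    (\<forall>y\<in>kvec (rdim C (src a)). f (tgt a) (c y) = rmap X a (s (src a) y) - s (tgt a) (rmap C a y))"
  proof
    fix a assume a: "a \<in> E"
    note st = src_V[OF a] tgt_V[OF a]
    show "\<exists>c. lin_on (rdim C (src a)) (rdim A (tgt a)) c \<and>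
      (\<forall>y\<in>kvec (rdim C (src a)). f (tgt a) (c y) = rmap X a (s (src a) y) - s (tgt a) (rmap C a y))"
    proof (rule lin_lift[OF hom_lin[OF f(1) st(2)]])
      show L: "lin_on (rdim C (src a)) (rdim X (tgt a))
          (\<lambda>y. rmap X a (s (src a) y) - s (tgt a) (rmap C a y))"
        by (intro lin_sub lin_comp[OF s[OF st(1)] wf_lin[OF wf(2) a]]
            lin_comp[OF wf_lin[OF wf(3) a] s[OF st(2)]])
      fix y :: "nat \<Rightarrow> 'k" assume y: "y \<in> kvec (rdim C (src a))"
      have sy: "s (src a) y \<in> kvec (rdim X (src a))" by (rule lin_in[OF s[OF st(1)] y])
      have sC: "s (tgt a) (rmap C a y) \<in> kvec (rdim X (tgt a))"
        by (rule lin_in[OF s[OF st(2)] wf_map[OF wf(3) a y]])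
      have "g (tgt a) (rmap X a (s (src a) y) - s (tgt a) (rmap C a y)) = 0"
        using lin_diff[OF hom_lin[OF g(1) st(2)] wf_map[OF wf(2) a sy] sC]
          hom_comm[OF g(1) a sy] gs[OF st(1) y] gs[OF st(2) wf_map[OF wf(3) a y]] by simp
      then show "rmap X a (s (src a) y) - s (tgt a) (rmap C a y) \<in> f (tgt a) ` kvec (rdim A (tgt a))"
        using ex[OF st(2)] lin_in[OF L y] by blast
    qed
  qed
  from bchoice[OF this] obtain c where c: "\<forall>a\<in>E. lin_on (rdim C (src a)) (rdim A (tgt a)) (c a) \<and>
    (\<forall>y\<in>kvec (rdim C (src a)). f (tgt a) (c a y) = rmap X a (s (src a) y) - s (tgt a) (rmap C a y))" ..
  then show ?thesis using s gs unfolding cocycle_def by (intro exI[of _ s] exI[of _ c]) auto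
qed

text \<open>If the defect of \<open>s\<close> is the coboundary of \<open>\<phi>\<close>, then the
  corrected section \<open>s + f \<phi>\<close> commutes with the arrows.\<close>

lemma ses_cobound_split:
  fixes A X C :: "('v, 'e, 'k::field) qrep"
  assumes ses: "ses A X C f g"
    and s: "\<forall>i\<in>V. lin_on (rdim C i) (rdim X i) (s i)"
    and gs: "\<forall>i\<in>V. \<forall>y\<in>kvec (rdim C i). g i (s i y) = y"
    and c: "\<forall>a\<in>E. \<forall>y\<in>kvec (rdim C (src a)).
      f (tgt a) (c a y) = rmap X a (s (src a) y) - s (tgt a) (rmap C a y)"
    and cob: "cobound C A c"
  shows "\<exists>s'. is_hom C X s' \<and> (\<forall>i\<in>V. \<forall>y\<in>kvec (rdim C i). g i (s' i y) = y)"
proof -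
  have wf: "wf_rep A" "wf_rep X" "wf_rep C" and f: "is_hom A X f" "hom_inj A f"
    and g: "is_hom X C g" "hom_surj X C g"
    and ex: "\<And>i. i \<in> V \<Longrightarrow> {x \<in> kvec (rdim X i). g i x = 0} = f i ` kvec (rdim A i)"
    using ses unfolding ses_def by auto
  obtain \<phi> where \<phi>: "\<forall>i\<in>V. lin_on (rdim C i) (rdim A i) (\<phi> i)"
    "\<forall>a\<in>E. \<forall>y\<in>kvec (rdim C (src a)). c a y = \<phi> (tgt a) (rmap C a y) - rmap A a (\<phi> (src a) y)"
    using cob unfolding cobound_def by (elim exE conjE)
  have p: "\<phi> i y \<in> kvec (rdim A i)" if "i \<in> V" "y \<in> kvec (rdim C i)" for i y
    using \<phi>(1) that lin_in by blast
  have si: "s i y \<in> kvec (rdim X i)" if "i \<in> V" "y \<in> kvec (rdim C i)" for i y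
    using s that lin_in by blast
  let ?s = "\<lambda>i y. s i y + f i (\<phi> i y)"
  have "is_hom C X ?s"
  proof (rule is_homI)
    fix i assume i: "i \<in> V"
    show "lin_on (rdim C i) (rdim X i) (?s i)"
      by (rule lin_plus[OF s[rule_format, OF i] lin_comp[OF \<phi>(1)[rule_format, OF i] hom_lin[OF f(1) i]]])
  next
    fix a and y :: "nat \<Rightarrow> 'k" assume a: "a \<in> E" and y: "y \<in> kvec (rdim C (src a))"
    note st = src_V[OF a] tgt_V[OF a]
    have Cy: "rmap C a y \<in> kvec (rdim C (tgt a))" by (rule wf_map[OF wf(3) a y])
    have "f (tgt a) (c a y) = f (tgt a) (\<phi> (tgt a) (rmap C a y)) - f (tgt a) (rmap A a (\<phi> (src a) y))"
      using \<phi>(2) a y lin_diff[OF hom_lin[OF f(1) st(2)] p[OF st(2) Cy] wf_map[OF wf(1) a p[OF st(1) y]]]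
      by simp
    then have "rmap X a (s (src a) y) - s (tgt a) (rmap C a y) =
       f (tgt a) (\<phi> (tgt a) (rmap C a y)) - rmap X a (f (src a) (\<phi> (src a) y))"
      using c a y hom_comm[OF f(1) a p[OF st(1) y]] by simp
    moreover have "rmap X a (?s (src a) y) = rmap X a (s (src a) y) + rmap X a (f (src a) (\<phi> (src a) y))"
      by (rule lin_add[OF wf_lin[OF wf(2) a] si[OF st(1) y] hom_inI[OF f(1) st(1) p[OF st(1) y]]])
    ultimately show "?s (tgt a) (rmap C a y) = rmap X a (?s (src a) y)"
      by (simp add: algebra_simps)
  qed
  moreover have "g i (?s i y) = y" if i: "i \<in> V" and y: "y \<in> kvec (rdim C i)" for i y
  proof -
    have fp: "f i (\<phi> i y) \<in> kvec (rdim X i)" by (rule hom_inI[OF f(1) i p[OF i y]])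
    have "g i (f i (\<phi> i y)) = 0" using ex[OF i] p[OF i y] by blast
    then show ?thesis using lin_add[OF hom_lin[OF g(1) i] si[OF i y] fp] gs i y by simp
  qed
  ultimately show ?thesis by blast
qed

lemma ses_split:
  assumes "ses A X C f g" "ext_zero C A"
  shows "\<exists>s. is_hom C X s \<and> (\<forall>i\<in>V. \<forall>y\<in>kvec (rdim C i). g i (s i y) = y)"
proof -
  obtain s c where "\<forall>i\<in>V. lin_on (rdim C i) (rdim X i) (s i)"
    "\<forall>i\<in>V. \<forall>y\<in>kvec (rdim C i). g i (s i y) = y" "cocycle C A c"
    "\<forall>a\<in>E. \<forall>y\<in>kvec (rdim C (src a)).
      f (tgt a) (c a y) = rmap X a (s (src a) y) - s (tgt a) (rmap C a y)"
    using ses_section_cocycle[OF assms(1)] by (elim exE conjE)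
  note sc = this
  have "cobound C A c" using sc(3) assms(2) by (simp add: ext_zero_def)
  from ses_cobound_split[OF assms(1) sc(1,2,4) this] show ?thesis .
qed

lemma ses_exists:
  assumes "wf_rep X" "subrep X U"
  shows "\<exists>A C f g. ses A X C f g \<and> (\<forall>i\<in>V. f i ` kvec (rdim A i) = U i)"
proof -
  obtain A where A: "wf_rep A" "sub_iso X U A" using sub_exists[OF assms] by blast
  obtain C where C: "wf_rep C" "quo_iso X U C" using quo_exists[OF assms] by blast
  obtain f where f: "is_hom A X f" "hom_inj A f" "\<forall>i\<in>V. f i ` kvec (rdim A i) = U i"
    using A(2) unfolding sub_iso_def by (elim exE conjE)
  obtain g where "is_hom X C g" "hom_surj X C g" "\<forall>i\<in>V. {x \<in> kvec (rdim X i). g i x = 0} = U i"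
    using C(2) unfolding quo_iso_def by (elim exE conjE)
  then have "ses A X C f g" unfolding ses_def using A C f assms(1) by auto
  then show ?thesis using f(3) by blast
qed

subsection \<open>The extension defined by a cocycle\<close>

text \<open>The arrow \<open>a\<close> acts block triangularly on B + A, with rows
  (\<open>rmap B a\<close>, \<open>c a\<close>) and (0, \<open>rmap A a\<close>). The subobject
  \<open>B\<close> comes first among the arguments, whereas a cocycle in Ext(A,B) names the quotient
  \<open>A\<close> first.\<close>

definition ext_rep :: "('v, 'e, 'k::field) qrep \<Rightarrow> ('v, 'e, 'k) qrep
    \<Rightarrow> ('e \<Rightarrow> (nat \<Rightarrow> 'k) \<Rightarrow> nat \<Rightarrow> 'k) \<Rightarrow> ('v, 'e, 'k) qrep" where
  "ext_rep B A c = \<lparr>rdim = (\<lambda>i. rdim B i + rdim A i),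
     rmap = (\<lambda>a x. join (rdim B (tgt a))
        (rmap B a (pr1 (rdim B (src a)) x) + c a (pr2 (rdim B (src a)) x))
        (rmap A a (pr2 (rdim B (src a)) x)))\<rparr>"

definition ext_in :: "('v, 'e, 'k::field) qrep \<Rightarrow> 'v \<Rightarrow> (nat \<Rightarrow> 'k) \<Rightarrow> nat \<Rightarrow> 'k" where
  "ext_in B i x = join (rdim B i) x 0"

definition ext_pr :: "('v, 'e, 'k::field) qrep \<Rightarrow> 'v \<Rightarrow> (nat \<Rightarrow> 'k) \<Rightarrow> nat \<Rightarrow> 'k" where
  "ext_pr B i x = pr2 (rdim B i) x"

lemma ext_rep_dim [simp]: "rdim (ext_rep B A c) i = rdim B i + rdim A i"
  by (simp add: ext_rep_def)

lemma ext_rep_map: "y \<in> kvec (rdim B (src a)) \<Longrightarrow> rmap (ext_rep B A c) a (join (rdim B (src a)) y z) =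
    join (rdim B (tgt a)) (rmap B a y + c a z) (rmap A a z)"
  by (simp add: ext_rep_def)

lemma ext_rep_wf:
  assumes "wf_rep A" "wf_rep B" "cocycle A B c"
  shows "wf_rep (ext_rep B A c)"
  unfolding wf_rep_def
proof (intro conjI allI impI ballI)
  fix a assume a: "a \<in> E"
  have "lin_on (rdim B (src a) + rdim A (src a)) (rdim B (tgt a) + rdim A (tgt a))
    (\<lambda>x. join (rdim B (tgt a))
        (rmap B a (pr1 (rdim B (src a)) x) + c a (pr2 (rdim B (src a)) x))
        (rmap A a (pr2 (rdim B (src a)) x)))"
    by (intro lin_join lin_plus lin_comp[OF lin_pr1 wf_lin[OF assms(2) a]]
        lin_comp[OF lin_pr2 cocycle_lin[OF assms(3) a]] lin_comp[OF lin_pr2 wf_lin[OF assms(1) a]])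
  then show "lin_on (rdim (ext_rep B A c) (src a)) (rdim (ext_rep B A c) (tgt a)) (rmap (ext_rep B A c) a)"
    by (simp add: ext_rep_def)
qed (use assms in \<open>auto simp: wf_rep_def\<close>)

lemma lin_ext_in: "lin_on (rdim B i) (rdim B i + m) (ext_in B i)"
  unfolding ext_in_def by (rule lin_join[OF lin_id lin_const0])

lemma lin_ext_pr: "lin_on (rdim B i + m) m (ext_pr B i)"
  unfolding ext_pr_def by (rule lin_pr2)

lemma lin_ext_sec: "lin_on m (rdim B i + m) (join (rdim B i) 0)"
  using lin_join[OF lin_const0 lin_id] .

lemma ext_in_hom:
  assumes "wf_rep A" "wf_rep B" "cocycle A B c"
  shows "is_hom B (ext_rep B A c) (ext_in B)"
  by (rule is_homI)
    (simp_all add: lin_ext_in, simp add: ext_in_def ext_rep_map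
      lin_zero[OF wf_lin[OF assms(1)]] lin_zero[OF cocycle_lin[OF assms(3)]] del: join_pr)

lemma ext_pr_hom: "is_hom (ext_rep B A c) A (ext_pr B)"
  by (rule is_homI) (auto simp: lin_ext_pr, simp add: ext_pr_def ext_rep_def)

lemma ext_in_inj: "hom_inj B (ext_in B)"
  unfolding hom_inj_def inj_on_def ext_in_def by (metis pr_join(1))

lemma ext_pr_surj:
  fixes A :: "('v, 'e, 'k::field) qrep"
  shows "hom_surj (ext_rep B A c) A (ext_pr B)"
  unfolding hom_surj_def
proof (intro ballI equalityI subsetI)
  fix i and y :: "nat \<Rightarrow> 'k" assume y: "y \<in> kvec (rdim A i)"
  show "y \<in> ext_pr B i ` kvec (rdim (ext_rep B A c) i)"
    by (rule image_eqI[of _ _ "join (rdim B i) 0 y"]) (simp_all add: ext_pr_def join_in y)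
qed (auto simp: lin_in[OF lin_ext_pr])

subsection \<open>The Euler form\<close>

definition euler :: "('v \<Rightarrow> nat) \<Rightarrow> ('v \<Rightarrow> nat) \<Rightarrow> int" where
  "euler d e = (\<Sum>i\<in>V. int (d i * e i)) - (\<Sum>a\<in>E. int (d (src a) * e (tgt a)))"

text \<open>The two terms of the complex that computes Hom and Ext, as finite sets of extensional
  families, with \<open>codiff\<close> as differential. Their sizes are powers of
  \<open>CARD('k)\<close> whose exponents differ by the Euler form.\<close>

definition cochains0 :: "('v, 'e, 'k::field) qrep \<Rightarrow> ('v, 'e, 'k) qrep \<Rightarrow> ('v \<Rightarrow> (nat \<Rightarrow> 'k) \<Rightarrow> nat \<Rightarrow> 'k) set" where
  "cochains0 A B = PiE V (\<lambda>i. lins (rdim A i) (rdim B i))"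

definition cochains1 :: "('v, 'e, 'k::field) qrep \<Rightarrow> ('v, 'e, 'k) qrep \<Rightarrow> ('e \<Rightarrow> (nat \<Rightarrow> 'k) \<Rightarrow> nat \<Rightarrow> 'k) set" where
  "cochains1 A B = PiE E (\<lambda>a. lins (rdim A (src a)) (rdim B (tgt a)))"

definition codiff :: "('v, 'e, 'k::field) qrep \<Rightarrow> ('v, 'e, 'k) qrep
    \<Rightarrow> ('v \<Rightarrow> (nat \<Rightarrow> 'k) \<Rightarrow> nat \<Rightarrow> 'k) \<Rightarrow> 'e \<Rightarrow> (nat \<Rightarrow> 'k) \<Rightarrow> nat \<Rightarrow> 'k" where
  "codiff A B \<phi> = (\<lambda>a\<in>E. \<lambda>x\<in>kvec (rdim A (src a)).
     \<phi> (tgt a) (rmap A a x) - rmap B a (\<phi> (src a) x))"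

lemma cochains_card:
  fixes A B :: "('v, 'e, 'k::{finite,field}) qrep"
  shows "int (card (cochains0 A B)) = int (CARD('k)) ^ (\<Sum>i\<in>V. rdim A i * rdim B i)"
    and "int (card (cochains1 A B)) = int (CARD('k)) ^ (\<Sum>a\<in>E. rdim A (src a) * rdim B (tgt a))"
    and "finite (cochains0 A B)" "finite (cochains1 A B)"
  by (simp_all add: cochains0_def cochains1_def card_PiE finite_V finite_E card_lins power_sum finite_PiE)

lemma codiff_in:
  assumes wf: "wf_rep A" "wf_rep B" and p: "\<phi> \<in> cochains0 A B"
  shows "codiff A B \<phi> \<in> cochains1 A B"
  unfolding codiff_def cochains1_def
proof (rule restrict_PiE_iff[THEN iffD2], intro ballI)
  fix a assume a: "a \<in> E"
  have l: "lin_on (rdim A i) (rdim B i) (\<phi> i)" if "i \<in> V" for i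
    using p that by (auto simp: cochains0_def lins_def PiE_iff)
  have "lin_on (rdim A (src a)) (rdim B (tgt a)) (\<lambda>x. \<phi> (tgt a) (rmap A a x) - rmap B a (\<phi> (src a) x))"
    by (intro lin_sub lin_comp[OF wf_lin[OF wf(1) a] l] lin_comp[OF l wf_lin[OF wf(2) a]] src_V tgt_V a)
  then show "(\<lambda>x\<in>kvec (rdim A (src a)). \<phi> (tgt a) (rmap A a x) - rmap B a (\<phi> (src a) x))
      \<in> lins (rdim A (src a)) (rdim B (tgt a))"
    unfolding lins_def by (auto intro: lin_cong)
qed

lemma restrict_cochain:
  "\<forall>i\<in>V. lin_on (rdim A i) (rdim B i) (f i) \<Longrightarrow>
    (\<lambda>i\<in>V. restrict (f i) (kvec (rdim A i))) \<in> cochains0 A B"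
  unfolding cochains0_def lins_def by (auto intro: lin_cong)

text \<open>Elements with equal image under \<open>codiff\<close> differ by a homomorphism. If there
  is none but 0, \<open>codiff\<close> is injective and the two cochain spaces compare in
  size.\<close>

lemma euler_hom_zero:
  fixes A B :: "('v, 'e, 'k::{finite,field}) qrep"
  assumes wf: "wf_rep A" "wf_rep B" and h: "hom_zero A B"
  shows "euler (rdim A) (rdim B) \<le> 0"
proof -
  have "inj_on (codiff A B) (cochains0 A B)"
  proof (rule inj_onI)
    fix \<phi> \<psi> assume p: "\<phi> \<in> cochains0 A B" "\<psi> \<in> cochains0 A B" and eq: "codiff A B \<phi> = codiff A B \<psi>"
    have l: "lin_on (rdim A i) (rdim B i) (\<phi> i)" "lin_on (rdim A i) (rdim B i) (\<psi> i)" if "i \<in> V" for i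
      using p that by (auto simp: cochains0_def lins_def PiE_iff)
    have "is_hom A B (\<lambda>i x. \<phi> i x - \<psi> i x)"
    proof (rule is_homI)
      fix a and x :: "nat \<Rightarrow> 'k" assume a: "a \<in> E" and x: "x \<in> kvec (rdim A (src a))"
      have "\<phi> (tgt a) (rmap A a x) - rmap B a (\<phi> (src a) x) =
          \<psi> (tgt a) (rmap A a x) - rmap B a (\<psi> (src a) x)"
        using fun_cong[OF fun_cong[OF eq, of a], of x] a x by (simp add: codiff_def)
      moreover have "rmap B a (\<phi> (src a) x - \<psi> (src a) x) = rmap B a (\<phi> (src a) x) - rmap B a (\<psi> (src a) x)"
        by (rule lin_diff[OF wf_lin[OF wf(2) a] lin_in[OF l(1)[OF src_V[OF a]] x]
              lin_in[OF l(2)[OF src_V[OF a]] x]])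
      ultimately show "\<phi> (tgt a) (rmap A a x) - \<psi> (tgt a) (rmap A a x) =
          rmap B a (\<phi> (src a) x - \<psi> (src a) x)"
        by (rule diff_exchange)
    qed (use l lin_sub in blast)
    then have z: "\<phi> i x = \<psi> i x" if "i \<in> V" "x \<in> kvec (rdim A i)" for i x
      using h[unfolded hom_zero_def, rule_format, OF _ that] by fastforce
    show "\<phi> = \<psi>"
    proof (rule PiE_ext[OF p[unfolded cochains0_def]])
      fix i assume i: "i \<in> V"
      show "\<phi> i = \<psi> i"
        by (rule extensionalityI[of _ "kvec (rdim A i)"])
          (use p i z in \<open>auto simp: cochains0_def lins_def PiE_iff\<close>)
    qed
  qed
  then have "card (cochains0 A B) \<le> card (cochains1 A B)"
    using codiff_in[OF wf] cochains_card(4) by (intro card_inj_on_le) auto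
  then have "int (card (cochains0 A B)) \<le> int (card (cochains1 A B))" by simp
  then have "(\<Sum>i\<in>V. rdim A i * rdim B i) \<le> (\<Sum>a\<in>E. rdim A (src a) * rdim B (tgt a))"
    unfolding cochains_card using card_field_gt1[where 'k='k] by simp
  then show ?thesis by (simp add: euler_def flip: of_nat_sum of_nat_mult)
qed

text \<open>Vanishing Ext makes \<open>codiff\<close> surjective, and a nonzero homomorphism has the
  same image as 0. So \<open>codiff\<close> is not injective and \<open>cochains0\<close> is
  strictly larger.\<close>

lemma euler_ext_zero:
  fixes A B :: "('v, 'e, 'k::{finite,field}) qrep"
  assumes wf: "wf_rep A" "wf_rep B" and e: "ext_zero A B" and h: "\<not> hom_zero A B"
  shows "euler (rdim A) (rdim B) > 0"
proof -
  have surj: "codiff A B ` cochains0 A B = cochains1 A B"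
  proof (intro equalityI subsetI)
    fix c assume c: "c \<in> cochains1 A B"
    then have "cocycle A B c" by (auto simp: cocycle_def cochains1_def lins_def PiE_iff)
    then have "cobound A B c" using e by (simp add: ext_zero_def)
    then obtain \<phi> where \<phi>: "\<forall>i\<in>V. lin_on (rdim A i) (rdim B i) (\<phi> i)"
      "\<forall>a\<in>E. \<forall>x\<in>kvec (rdim A (src a)). c a x = \<phi> (tgt a) (rmap A a x) - rmap B a (\<phi> (src a) x)"
      unfolding cobound_def by (elim exE conjE)
    let ?p = "\<lambda>i\<in>V. restrict (\<phi> i) (kvec (rdim A i))"
    have "c = codiff A B ?p"
    proof (rule PiE_ext[OF c[unfolded cochains1_def]
          codiff_in[OF wf restrict_cochain[OF \<phi>(1)], unfolded cochains1_def]])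
      fix a assume a: "a \<in> E"
      show "c a = codiff A B ?p a"
        by (rule extensionalityI[of _ "kvec (rdim A (src a))"])
          (use c a \<phi>(2) src_V[OF a] tgt_V[OF a] wf_map[OF wf(1) a] in
            \<open>auto simp: cochains1_def lins_def PiE_iff codiff_def\<close>)
    qed
    then show "c \<in> codiff A B ` cochains0 A B" using restrict_cochain[OF \<phi>(1)] by blast
  qed (use codiff_in[OF wf] in blast)
  obtain f j x where f: "is_hom A B f" and jx: "j \<in> V" "x \<in> kvec (rdim A j)" "f j x \<noteq> 0"
    using h unfolding hom_zero_def by blast
  let ?f = "\<lambda>i\<in>V. restrict (f i) (kvec (rdim A i))"
  let ?z = "\<lambda>i\<in>V. restrict (\<lambda>x. 0) (kvec (rdim A i)) :: (nat \<Rightarrow> 'k) \<Rightarrow> nat \<Rightarrow> 'k"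
  have f0: "?f \<in> cochains0 A B" by (rule restrict_cochain) (use hom_lin[OF f] in blast)
  have z0: "?z \<in> cochains0 A B" by (rule restrict_cochain) (simp add: lin_const0)
  have "codiff A B ?f = codiff A B ?z"
    unfolding codiff_def
    by (intro restrict_ext) (simp add: src_V tgt_V wf_map[OF wf(1)] hom_comm[OF f] lin_zero[OF wf_lin[OF wf(2)]])
  moreover have "?f \<noteq> ?z"
  proof
    assume "?f = ?z"
    then have "?f j x = ?z j x" by simp
    then show False using jx by simp
  qed
  ultimately have "\<not> inj_on (codiff A B) (cochains0 A B)" using f0 z0 by (meson inj_onD)
  then have "card (cochains1 A B) < card (cochains0 A B)"
    using surj card_image_le[OF cochains_card(3)] eq_card_imp_inj_on[OF cochains_card(3)]
    by (metis le_neq_implies_less)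
  then have "int (card (cochains1 A B)) < int (card (cochains0 A B))" by simp
  then have "(\<Sum>a\<in>E. rdim A (src a) * rdim B (tgt a)) < (\<Sum>i\<in>V. rdim A i * rdim B i)"
    unfolding cochains_card using card_field_gt1[where 'k='k] by simp
  then show ?thesis by (simp add: euler_def flip: of_nat_sum of_nat_mult)
qed

subsection \<open>Almost split sequences\<close>

text \<open>An almost split sequence from \<open>L\<close> to \<open>N\<close> with its middle term eliminated: both lifting
  properties become the vanishing of a pullback or pushforward of the extension class.\<close>

definition ar_cocycle :: "('v, 'e, 'k::field) qrep \<Rightarrow> ('v, 'e, 'k) qrep
    \<Rightarrow> ('e \<Rightarrow> (nat \<Rightarrow> 'k) \<Rightarrow> nat \<Rightarrow> 'k) \<Rightarrow> bool" where
  "ar_cocycle N L \<xi> \<longleftrightarrow> wf_rep N \<and> wf_rep L \<and> cocycle N L \<xi> \<and> \<not> cobound N L \<xi>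
     \<and> (\<forall>(Y::('v,'e,'k) qrep) h. wf_rep Y \<and> is_hom Y N h \<and> \<not> split_epi Y N h
          \<longrightarrow> cobound Y L (\<lambda>a x. \<xi> a (h (src a) x)))
     \<and> (\<forall>(Y::('v,'e,'k) qrep) h. wf_rep Y \<and> is_hom L Y h \<and> \<not> split_mono L Y h
          \<longrightarrow> cobound N Y (\<lambda>a x. h (tgt a) (\<xi> a x)))"

lemma split_epi_iff: "split_epi Y N h \<longleftrightarrow>
    (\<exists>s. is_hom N Y s \<and> (\<forall>i\<in>V. \<forall>x\<in>kvec (rdim N i). h i (s i x) = x))"
  by (simp add: split_epi_def hom_comp_eq_def hom_id_def)

lemma split_mono_iff: "split_mono L Y h \<longleftrightarrow>
    (\<exists>r. is_hom Y L r \<and> (\<forall>i\<in>V. \<forall>x\<in>kvec (rdim L i). r i (h i x) = x))"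
  by (simp add: split_mono_def hom_comp_eq_def hom_id_def)

lemma almost_split_ses: "almost_split L M N f g \<Longrightarrow> ses L M N f g"
  by (simp add: almost_split_def ses_def)

text \<open>A linear section \<open>\<sigma>\<close> of \<open>g\<close> translates factorisations
  into splittings: a lift of \<open>h\<close> through \<open>g\<close> makes the pulled back class a
  coboundary, and an extension of \<open>h\<close> along \<open>f\<close> does the same for the
  pushforward.\<close>

lemma almost_split_cocycle:
  fixes L M N :: "('v, 'e, 'k::field) qrep"
  assumes as: "almost_split L M N f g"
  shows "\<exists>\<xi>. ar_cocycle N L \<xi>"
proof -
  note ses = almost_split_ses[OF as]
  have wf: "wf_rep L" "wf_rep M" "wf_rep N" and f: "is_hom L M f" "hom_inj L f"
    and g: "is_hom M N g" "hom_surj M N g"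
    and ex: "\<And>i. i \<in> V \<Longrightarrow> {x \<in> kvec (rdim M i). g i x = 0} = f i ` kvec (rdim L i)"
    using ses unfolding ses_def by auto
  have nsplit: "\<not> split_epi M N g" using as by (simp add: almost_split_def)
  obtain \<sigma> \<xi> where \<sigma>: "\<forall>i\<in>V. lin_on (rdim N i) (rdim M i) (\<sigma> i)"
    and gs: "\<forall>i\<in>V. \<forall>y\<in>kvec (rdim N i). g i (\<sigma> i y) = y" and c: "cocycle N L \<xi>"
    and \<xi>: "\<forall>a\<in>E. \<forall>y\<in>kvec (rdim N (src a)).
      f (tgt a) (\<xi> a y) = rmap M a (\<sigma> (src a) y) - \<sigma> (tgt a) (rmap N a y)"
    using ses_section_cocycle[OF ses] by (elim exE conjE)
  have si: "\<sigma> i y \<in> kvec (rdim M i)" if "i \<in> V" "y \<in> kvec (rdim N i)" for i y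
    using \<sigma> that lin_in by blast
  have 1: "\<not> cobound N L \<xi>"
    using ses_cobound_split[OF ses \<sigma> gs \<xi>] nsplit unfolding split_epi_iff by blast
  have 2: "cobound Y L (\<lambda>a x. \<xi> a (h (src a) x))"
    if Y: "wf_rep Y" and h: "is_hom Y N h" and ns: "\<not> split_epi Y N h" for Y h
  proof -
    have "\<exists>h'. is_hom Y M h' \<and> hom_comp_eq Y g h' h"
      using as Y h ns unfolding almost_split_def by blast
    then obtain h' where h': "is_hom Y M h'" "\<forall>i\<in>V. \<forall>x\<in>kvec (rdim Y i). g i (h' i x) = h i x"
      unfolding hom_comp_eq_def by (elim exE conjE)
    \<comment> \<open>\<open>h'\<close> and \<open>\<sigma> h\<close> both lift \<open>h\<close>
      along \<open>g\<close>, the first as a homomorphism and the second only linearly. Their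
      difference lies in the image of \<open>f\<close> and provides the splitting cochain
      \<open>p\<close>.\<close>
    have "\<forall>i\<in>V. \<exists>p. lin_on (rdim Y i) (rdim L i) p \<and>
        (\<forall>x\<in>kvec (rdim Y i). f i (p x) = h' i x - \<sigma> i (h i x))"
    proof
      fix i assume i: "i \<in> V"
      show "\<exists>p. lin_on (rdim Y i) (rdim L i) p \<and>
        (\<forall>x\<in>kvec (rdim Y i). f i (p x) = h' i x - \<sigma> i (h i x))"
      proof (rule lin_lift[OF hom_lin[OF f(1) i]])
        show l: "lin_on (rdim Y i) (rdim M i) (\<lambda>x. h' i x - \<sigma> i (h i x))"
          by (rule lin_sub[OF hom_lin[OF h'(1) i] lin_comp[OF hom_lin[OF h i] \<sigma>[rule_format, OF i]]])
        fix x :: "nat \<Rightarrow> 'k" assume x: "x \<in> kvec (rdim Y i)"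
        have "g i (h' i x - \<sigma> i (h i x)) = 0"
          using lin_diff[OF hom_lin[OF g(1) i] hom_inI[OF h'(1) i x] si[OF i hom_inI[OF h i x]]]
            h'(2) gs i x hom_inI[OF h i x] by simp
        then show "h' i x - \<sigma> i (h i x) \<in> f i ` kvec (rdim L i)"
          using ex[OF i] lin_in[OF l x] by blast
      qed
    qed
    from bchoice[OF this] obtain p where p: "\<forall>i\<in>V. lin_on (rdim Y i) (rdim L i) (p i) \<and>
        (\<forall>x\<in>kvec (rdim Y i). f i (p i x) = h' i x - \<sigma> i (h i x))" ..
    then have pl: "lin_on (rdim Y i) (rdim L i) (p i)" if "i \<in> V" for i using that by blast
    have fp: "f i (p i x) = h' i x - \<sigma> i (h i x)" if "i \<in> V" "x \<in> kvec (rdim Y i)" for i x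
      using p that by blast
    show ?thesis unfolding cobound_def
    proof (intro exI[of _ p] conjI ballI)
      fix a and x :: "nat \<Rightarrow> 'k" assume a: "a \<in> E" and x: "x \<in> kvec (rdim Y (src a))"
      note st = src_V[OF a] tgt_V[OF a]
      have hx: "h (src a) x \<in> kvec (rdim N (src a))" by (rule hom_inI[OF h st(1) x])
      have Yx: "rmap Y a x \<in> kvec (rdim Y (tgt a))" by (rule wf_map[OF Y a x])
      have pY: "p (tgt a) (rmap Y a x) \<in> kvec (rdim L (tgt a))" by (rule lin_in[OF pl[OF st(2)] Yx])
      have px: "p (src a) x \<in> kvec (rdim L (src a))" by (rule lin_in[OF pl[OF st(1)] x])
      have Lp: "rmap L a (p (src a) x) \<in> kvec (rdim L (tgt a))" by (rule wf_map[OF wf(1) a px])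
      have "f (tgt a) (p (tgt a) (rmap Y a x) - rmap L a (p (src a) x)) =
          (h' (tgt a) (rmap Y a x) - \<sigma> (tgt a) (h (tgt a) (rmap Y a x)))
          - rmap M a (h' (src a) x - \<sigma> (src a) (h (src a) x))"
        using lin_diff[OF hom_lin[OF f(1) st(2)] pY Lp] fp[OF st(2) Yx] hom_comm[OF f(1) a px]
          fp[OF st(1) x] by simp
      also have "\<dots> = rmap M a (\<sigma> (src a) (h (src a) x)) - \<sigma> (tgt a) (rmap N a (h (src a) x))"
        using lin_diff[OF wf_lin[OF wf(2) a] hom_inI[OF h'(1) st(1) x] si[OF st(1) hx]]
          hom_comm[OF h'(1) a x] hom_comm[OF h a x] by simp
      also have "\<dots> = f (tgt a) (\<xi> a (h (src a) x))" using \<xi> a hx by simp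
      finally have eq: "f (tgt a) (\<xi> a (h (src a) x)) =
        f (tgt a) (p (tgt a) (rmap Y a x) - rmap L a (p (src a) x))" by simp
      show "\<xi> a (h (src a) x) = p (tgt a) (rmap Y a x) - rmap L a (p (src a) x)"
        by (rule hom_injD[OF f(2) st(2) eq lin_in[OF cocycle_lin[OF c a] hx] kvec_diff[OF pY Lp]])
    qed (rule pl)
  qed
  have 3: "cobound N Y (\<lambda>a x. h (tgt a) (\<xi> a x))"
    if Y: "wf_rep Y" and h: "is_hom L Y h" and ns: "\<not> split_mono L Y h" for Y h
  proof -
    have "\<exists>h'. is_hom M Y h' \<and> hom_comp_eq L h' f h"
      using as Y h ns unfolding almost_split_def by blast
    then obtain h' where h': "is_hom M Y h'" "\<forall>i\<in>V. \<forall>x\<in>kvec (rdim L i). h' i (f i x) = h i x"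
      unfolding hom_comp_eq_def by (elim exE conjE)
    \<comment> \<open>The minus sign is needed because \<open>f \<xi>\<close> is the arrow map after
      \<open>\<sigma>\<close> minus \<open>\<sigma>\<close> after the arrow map, opposite to the
      sign in \<open>cobound\<close>.\<close>
    show ?thesis unfolding cobound_def
    proof (intro exI[of _ "\<lambda>i x. - h' i (\<sigma> i x)"] conjI ballI)
      fix i assume i: "i \<in> V"
      show "lin_on (rdim N i) (rdim Y i) (\<lambda>x. - h' i (\<sigma> i x))"
        by (rule lin_uminus[OF lin_comp[OF \<sigma>[rule_format, OF i] hom_lin[OF h'(1) i]]])
    next
      fix a and x :: "nat \<Rightarrow> 'k" assume a: "a \<in> E" and x: "x \<in> kvec (rdim N (src a))"
      note st = src_V[OF a] tgt_V[OF a]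
      have Nx: "rmap N a x \<in> kvec (rdim N (tgt a))" by (rule wf_map[OF wf(3) a x])
      have "h (tgt a) (\<xi> a x) = h' (tgt a) (f (tgt a) (\<xi> a x))"
        using h'(2) st(2) lin_in[OF cocycle_lin[OF c a] x] by simp
      also have "\<dots> = h' (tgt a) (rmap M a (\<sigma> (src a) x) - \<sigma> (tgt a) (rmap N a x))"
        using \<xi> a x by simp
      also have "\<dots> = rmap Y a (h' (src a) (\<sigma> (src a) x)) - h' (tgt a) (\<sigma> (tgt a) (rmap N a x))"
        using lin_diff[OF hom_lin[OF h'(1) st(2)] wf_map[OF wf(2) a si[OF st(1) x]] si[OF st(2) Nx]]
          hom_comm[OF h'(1) a si[OF st(1) x]] by simp
      also have "\<dots> = - h' (tgt a) (\<sigma> (tgt a) (rmap N a x)) - rmap Y a (- h' (src a) (\<sigma> (src a) x))"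
        using lin_minus[OF wf_lin[OF Y a] hom_inI[OF h'(1) st(1) si[OF st(1) x]]] by simp
      finally show "h (tgt a) (\<xi> a x) =
        - h' (tgt a) (\<sigma> (tgt a) (rmap N a x)) - rmap Y a (- h' (src a) (\<sigma> (src a) x))" .
    qed
  qed
  show ?thesis unfolding ar_cocycle_def using wf c 1 2 3 by blast
qed

lemma ar_D:
  fixes N L :: "('v, 'e, 'k::field) qrep"
  assumes "ar_cocycle N L \<xi>"
  shows "wf_rep N" "wf_rep L" "cocycle N L \<xi>" "\<not> cobound N L \<xi>"
    "wf_rep Y \<Longrightarrow> is_hom Y N h \<Longrightarrow> \<not> split_epi Y N h \<Longrightarrow> cobound Y L (\<lambda>a x. \<xi> a (h (src a) x))"
    "wf_rep Y \<Longrightarrow> is_hom L Y h \<Longrightarrow> \<not> split_mono L Y h \<Longrightarrow> cobound N Y (\<lambda>a x. h (tgt a) (\<xi> a x))"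
  using assms unfolding ar_cocycle_def by blast+

text \<open>The \<open>Z\<close> component of a section of the extension splits \<open>c\<close> up
  to sign, which is why \<open>- c\<close> is treated first.\<close>

lemma ext_pr_split_cobound:
  fixes N Z :: "('v, 'e, 'k::field) qrep"
  assumes N: "wf_rep N" and Z: "wf_rep Z" and c: "cocycle N Z c"
    and s: "is_hom N (ext_rep Z N c) s" "\<forall>i\<in>V. \<forall>x\<in>kvec (rdim N i). ext_pr Z i (s i x) = x"
  shows "cobound N Z c"
proof -
  have sl: "lin_on (rdim N i) (rdim Z i + rdim N i) (s i)" if "i \<in> V" for i
    using hom_lin[OF s(1) that] by simp
  have "cobound N Z (\<lambda>a x. - c a x)" unfolding cobound_def
  proof (intro exI[of _ "\<lambda>i x. - pr1 (rdim Z i) (s i x)"] conjI ballI)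
    fix i assume i: "i \<in> V"
    show "lin_on (rdim N i) (rdim Z i) (\<lambda>x. - pr1 (rdim Z i) (s i x))"
      by (rule lin_uminus[OF lin_comp[OF sl[OF i] lin_pr1]])
  next
    fix a and x :: "nat \<Rightarrow> 'k" assume a: "a \<in> E" and x: "x \<in> kvec (rdim N (src a))"
    note st = src_V[OF a] tgt_V[OF a]
    have sx: "s (src a) x \<in> kvec (rdim Z (src a) + rdim N (src a))" by (rule lin_in[OF sl[OF st(1)] x])
    have p: "pr1 (rdim Z (src a)) (s (src a) x) \<in> kvec (rdim Z (src a))" by (rule lin_in[OF lin_pr1 sx])
    have "s (tgt a) (rmap N a x) = rmap (ext_rep Z N c) a (s (src a) x)" by (rule hom_comm[OF s(1) a x])
    then have "pr1 (rdim Z (tgt a)) (s (tgt a) (rmap N a x)) =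
       rmap Z a (pr1 (rdim Z (src a)) (s (src a) x)) + c a (pr2 (rdim Z (src a)) (s (src a) x))"
      using wf_map[OF Z a p] lin_in[OF cocycle_lin[OF c a] lin_in[OF lin_pr2 sx]]
      by (simp add: ext_rep_def)
    moreover have "pr2 (rdim Z (src a)) (s (src a) x) = x" using s(2) st x by (simp add: ext_pr_def)
    ultimately show "- c a x = - pr1 (rdim Z (tgt a)) (s (tgt a) (rmap N a x))
        - rmap Z a (- pr1 (rdim Z (src a)) (s (src a) x))"
      using lin_minus[OF wf_lin[OF Z a] p] by simp
  qed
  from cobound_minus[OF this N Z] show ?thesis by simp
qed

text \<open>Restricting a retraction onto \<open>L\<close> to the linear summand \<open>Z\<close>
  gives the cochain \<open>\<phi>\<close>; compatibility with the arrows on vectors (0, z) says that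
  its coboundary is \<open>- c\<close>.\<close>

lemma ext_in_split_cobound:
  fixes L Z :: "('v, 'e, 'k::field) qrep"
  assumes Z: "wf_rep Z" and L: "wf_rep L" and c: "cocycle Z L c"
    and r: "is_hom (ext_rep L Z c) L r" "\<forall>i\<in>V. \<forall>x\<in>kvec (rdim L i). r i (ext_in L i x) = x"
  shows "cobound Z L c"
proof -
  let ?j = "\<lambda>i. join (rdim L i)"
  have rl: "lin_on (rdim L i + rdim Z i) (rdim L i) (r i)" if "i \<in> V" for i
    using hom_lin[OF r(1) that] by simp
  define \<phi> where "\<phi> i z = r i (?j i 0 z)" for i z
  have \<phi>l: "lin_on (rdim Z i) (rdim L i) (\<phi> i)" if "i \<in> V" for i
    unfolding \<phi>_def by (rule lin_comp[OF lin_ext_sec rl[OF that]])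
  have "cobound Z L (\<lambda>a x. - c a x)" unfolding cobound_def
  proof (intro exI[of _ \<phi>] conjI ballI \<phi>l)
    fix a and z :: "nat \<Rightarrow> 'k" assume a: "a \<in> E" and z: "z \<in> kvec (rdim Z (src a))"
    note st = src_V[OF a] tgt_V[OF a]
    have cz: "c a z \<in> kvec (rdim L (tgt a))" by (rule lin_in[OF cocycle_lin[OF c a] z])
    have Zz: "rmap Z a z \<in> kvec (rdim Z (tgt a))" by (rule wf_map[OF Z a z])
    have "r (tgt a) (rmap (ext_rep L Z c) a (?j (src a) 0 z)) = rmap L a (\<phi> (src a) z)"
      using hom_comm[OF r(1) a, of "?j (src a) 0 z"] join_in[OF zero_in_kvec z] by (simp add: \<phi>_def)
    moreover have "rmap (ext_rep L Z c) a (?j (src a) 0 z) = ?j (tgt a) (c a z) 0 + ?j (tgt a) 0 (rmap Z a z)"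
      using lin_zero[OF wf_lin[OF L a]] join_split[OF cz, of "rmap Z a z"] by (simp add: ext_rep_map)
    moreover have "r (tgt a) (?j (tgt a) (c a z) 0 + ?j (tgt a) 0 (rmap Z a z)) =
       c a z + \<phi> (tgt a) (rmap Z a z)"
      using lin_add[OF rl[OF st(2)] join_in[OF cz zero_in_kvec] join_in[OF zero_in_kvec Zz]]
        r(2) st cz by (simp add: \<phi>_def ext_in_def)
    ultimately show "- c a z = \<phi> (tgt a) (rmap Z a z) - rmap L a (\<phi> (src a) z)"
      by (simp add: algebra_simps)
  qed
  from cobound_minus[OF this Z L] show ?thesis by simp
qed

text \<open>The next four lemmas are the non-degeneracy of the pairings
  \<open>Hom(Z,L) \<times> Ext(N,Z) \<rightarrow> Ext(N,L)\<close> and \<open>Ext(Z,L) \<times> Hom(N,Z) \<rightarrow> Ext(N,L)\<close> on the class \<open>\<xi>\<close>: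
  every nonzero element is paired with some element to \<open>\<xi>\<close>.\<close>

lemma ar_factor_ext_left:
  fixes N L Z :: "('v, 'e, 'k::field) qrep"
  assumes ar: "ar_cocycle N L \<xi>" and Z: "wf_rep Z" and c: "cocycle N Z c" and nc: "\<not> cobound N Z c"
  shows "\<exists>u. is_hom Z L u \<and> cobound N L (\<lambda>a x. \<xi> a x - u (tgt a) (c a x))"
proof -
  note wf = ar_D(1,2)[OF ar]
  let ?X = "ext_rep Z N c"
  let ?j = "\<lambda>i. join (rdim Z i)"
  have X: "wf_rep ?X" by (rule ext_rep_wf[OF wf(1) Z c])
  \<comment> \<open>A section of \<open>ext_pr Z\<close> would split \<open>c\<close>, so
    \<open>\<xi>\<close> vanishes when pulled back to \<open>?X\<close>. The resulting cochain
    \<open>\<psi>\<close> on Z + N is cut into \<open>u\<close> on \<open>Z\<close> and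
    \<open>\<phi>\<close> on \<open>N\<close>: the arrow equation on \<open>Z\<close> makes
    \<open>u\<close> a homomorphism, and on \<open>N\<close> it gives the relation between
    \<open>\<xi>\<close> and \<open>c\<close>.\<close>
  have "\<not> split_epi ?X N (ext_pr Z)"
    using ext_pr_split_cobound[OF wf(1) Z c] nc unfolding split_epi_iff by blast
  from ar_D(5)[OF ar X ext_pr_hom this] obtain \<psi> where
    \<psi>: "\<forall>i\<in>V. lin_on (rdim Z i + rdim N i) (rdim L i) (\<psi> i)"
    "\<forall>a\<in>E. \<forall>x\<in>kvec (rdim Z (src a) + rdim N (src a)).
       \<xi> a (ext_pr Z (src a) x) = \<psi> (tgt a) (rmap ?X a x) - rmap L a (\<psi> (src a) x)"
    unfolding cobound_def ext_rep_dim by (elim exE conjE)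
  define u where "u i z = \<psi> i (?j i z 0)" for i z
  define \<phi> where "\<phi> i n = \<psi> i (?j i 0 n)" for i n
  have ul: "lin_on (rdim Z i) (rdim L i) (u i)" if "i \<in> V" for i
    unfolding u_def by (rule lin_comp[OF lin_join[OF lin_id lin_const0] \<psi>(1)[rule_format, OF that]])
  have \<phi>l: "lin_on (rdim N i) (rdim L i) (\<phi> i)" if "i \<in> V" for i
    unfolding \<phi>_def by (rule lin_comp[OF lin_ext_sec \<psi>(1)[rule_format, OF that]])
  have \<psi>s: "\<psi> i (?j i z n) = u i z + \<phi> i n" if "i \<in> V" "z \<in> kvec (rdim Z i)" "n \<in> kvec (rdim N i)" for i z n
    unfolding u_def \<phi>_def
    by (subst join_split[OF that(2)], rule lin_add[OF \<psi>(1)[rule_format, OF that(1)]])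
      (use that(3) join_in[OF that(2) zero_in_kvec] join_in[OF zero_in_kvec that(3)] in simp_all)
  have "is_hom Z L u"
  proof (rule is_homI[OF ul])
    fix a and z :: "nat \<Rightarrow> 'k" assume a: "a \<in> E" and z: "z \<in> kvec (rdim Z (src a))"
    have "\<xi> a (ext_pr Z (src a) (?j (src a) z 0)) =
        \<psi> (tgt a) (rmap ?X a (?j (src a) z 0)) - rmap L a (\<psi> (src a) (?j (src a) z 0))"
      using \<psi>(2) a join_in[OF z zero_in_kvec] by blast
    then show "u (tgt a) (rmap Z a z) = rmap L a (u (src a) z)"
      using z lin_zero[OF cocycle_lin[OF ar_D(3)[OF ar] a]] lin_zero[OF cocycle_lin[OF c a]]
        lin_zero[OF wf_lin[OF wf(1) a]]
      by (simp add: ext_pr_def ext_rep_map u_def)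
  qed
  moreover have "cobound N L (\<lambda>a x. \<xi> a x - u (tgt a) (c a x))" unfolding cobound_def
  proof (intro exI[of _ \<phi>] conjI ballI \<phi>l)
    fix a and n :: "nat \<Rightarrow> 'k" assume a: "a \<in> E" and n: "n \<in> kvec (rdim N (src a))"
    have "\<xi> a (ext_pr Z (src a) (?j (src a) 0 n)) =
        \<psi> (tgt a) (rmap ?X a (?j (src a) 0 n)) - rmap L a (\<psi> (src a) (?j (src a) 0 n))"
      using \<psi>(2) a join_in[OF zero_in_kvec n] by blast
    moreover have "\<psi> (tgt a) (rmap ?X a (?j (src a) 0 n)) = u (tgt a) (c a n) + \<phi> (tgt a) (rmap N a n)"
      using \<psi>s[OF tgt_V[OF a] lin_in[OF cocycle_lin[OF c a] n] wf_map[OF wf(1) a n]]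
        lin_zero[OF wf_lin[OF Z a]] by (simp add: ext_rep_map)
    ultimately show "\<xi> a n - u (tgt a) (c a n) = \<phi> (tgt a) (rmap N a n) - rmap L a (\<phi> (src a) n)"
      by (simp add: ext_pr_def \<phi>_def)
  qed
  ultimately show ?thesis by blast
qed

lemma ar_factor_ext_right:
  fixes N L Z :: "('v, 'e, 'k::field) qrep"
  assumes ar: "ar_cocycle N L \<xi>" and Z: "wf_rep Z" and c: "cocycle Z L c" and nc: "\<not> cobound Z L c"
  shows "\<exists>v. is_hom N Z v \<and> cobound N L (\<lambda>a x. \<xi> a x - c a (v (src a) x))"
proof -
  note wf = ar_D(1,2)[OF ar]
  let ?X = "ext_rep L Z c"
  let ?j = "\<lambda>i. join (rdim L i)"
  have X: "wf_rep ?X" by (rule ext_rep_wf[OF Z wf(2) c])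
  have "\<not> split_mono L ?X (ext_in L)"
    using ext_in_split_cobound[OF Z wf(2) c] nc unfolding split_mono_iff by blast
  from ar_D(6)[OF ar X ext_in_hom[OF Z wf(2) c] this] obtain \<psi> where
    \<psi>: "\<forall>i\<in>V. lin_on (rdim N i) (rdim L i + rdim Z i) (\<psi> i)"
    "\<forall>a\<in>E. \<forall>x\<in>kvec (rdim N (src a)).
       ext_in L (tgt a) (\<xi> a x) = \<psi> (tgt a) (rmap N a x) - rmap ?X a (\<psi> (src a) x)"
    unfolding cobound_def ext_rep_dim by (elim exE conjE)
  \<comment> \<open>The components of \<open>\<psi>\<close> in \<open>L\<close> and in
    \<open>Z\<close>. The second commutes with the arrows, and the first shows that
    \<open>\<xi> + c v\<close> is a coboundary; this is why \<open>- v\<close> is the homomorphism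
    finally used.\<close>
  define w where "w i n = pr1 (rdim L i) (\<psi> i n)" for i n
  define v where "v i n = pr2 (rdim L i) (\<psi> i n)" for i n
  have wl: "lin_on (rdim N i) (rdim L i) (w i)" if "i \<in> V" for i
    unfolding w_def by (rule lin_comp[OF \<psi>(1)[rule_format, OF that] lin_pr1])
  have vl: "lin_on (rdim N i) (rdim Z i) (v i)" if "i \<in> V" for i
    unfolding v_def by (rule lin_comp[OF \<psi>(1)[rule_format, OF that] lin_pr2])
  have eqs: "rmap Z a (v (src a) n) = v (tgt a) (rmap N a n) \<and>
      \<xi> a n = w (tgt a) (rmap N a n) - (rmap L a (w (src a) n) + c a (v (src a) n))"
    if a: "a \<in> E" and n: "n \<in> kvec (rdim N (src a))" for a n
  proof -
    note st = src_V[OF a] tgt_V[OF a]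
    have xn: "\<xi> a n \<in> kvec (rdim L (tgt a))" by (rule lin_in[OF cocycle_lin[OF ar_D(3)[OF ar] a] n])
    have Nn: "rmap N a n \<in> kvec (rdim N (tgt a))" by (rule wf_map[OF wf(1) a n])
    have "\<psi> (tgt a) (rmap N a n) = ext_in L (tgt a) (\<xi> a n) + rmap ?X a (\<psi> (src a) n)"
      using \<psi>(2)[rule_format, OF a n] by simp
    also have "\<dots> = ?j (tgt a) (\<xi> a n + (rmap L a (w (src a) n) + c a (v (src a) n)))
        (rmap Z a (v (src a) n))"
      by (simp add: ext_in_def ext_rep_def join_add w_def v_def)
    finally have e: "\<psi> (tgt a) (rmap N a n) = \<dots>" .
    have k: "\<xi> a n + (rmap L a (w (src a) n) + c a (v (src a) n)) \<in> kvec (rdim L (tgt a))"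
      by (intro kvec_add xn wf_map[OF wf(2) a] lin_in[OF wl[OF st(1)] n]
          lin_in[OF cocycle_lin[OF c a]] lin_in[OF vl[OF st(1)] n])
    have "v (tgt a) (rmap N a n) = rmap Z a (v (src a) n)"
      unfolding v_def[of "tgt a"] e by simp
    moreover have "w (tgt a) (rmap N a n) = \<xi> a n + (rmap L a (w (src a) n) + c a (v (src a) n))"
      unfolding w_def[of "tgt a"] e using k by simp
    ultimately show ?thesis by simp
  qed
  have "is_hom N Z (\<lambda>i x. - v i x)"
  proof (rule is_homI)
    fix a and n :: "nat \<Rightarrow> 'k" assume a: "a \<in> E" and n: "n \<in> kvec (rdim N (src a))"
    show "- v (tgt a) (rmap N a n) = rmap Z a (- v (src a) n)"
      using eqs[OF a n] lin_minus[OF wf_lin[OF Z a] lin_in[OF vl[OF src_V[OF a]] n]] by simp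
  qed (rule lin_uminus[OF vl])
  moreover have "cobound N L (\<lambda>a x. \<xi> a x - c a (- v (src a) x))" unfolding cobound_def
  proof (intro exI[of _ w] conjI ballI wl)
    fix a and n :: "nat \<Rightarrow> 'k" assume a: "a \<in> E" and n: "n \<in> kvec (rdim N (src a))"
    show "\<xi> a n - c a (- v (src a) n) = w (tgt a) (rmap N a n) - rmap L a (w (src a) n)"
      using eqs[OF a n] lin_minus[OF cocycle_lin[OF c a] lin_in[OF vl[OF src_V[OF a]] n]] by simp
  qed
  ultimately show ?thesis by blast
qed

lemma ar_factor_hom_left:
  fixes N L Z :: "('v, 'e, 'k::field) qrep"
  assumes ar: "ar_cocycle N L \<xi>" and Z: "wf_rep Z" and u: "is_hom Z L u"
    and nz: "i \<in> V" "x \<in> kvec (rdim Z i)" "u i x \<noteq> 0"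
  shows "\<exists>c. cocycle N Z c \<and> cobound N L (\<lambda>a x. \<xi> a x - u (tgt a) (c a x))"
proof -
  note wf = ar_D(1,2)[OF ar]
  note \<xi> = ar_D(3)[OF ar]
  have "subrep L (\<lambda>i. if i \<in> V then u i ` kvec (rdim Z i) else {0})"
    by (rule subrep_image[OF u Z subrep_full[OF Z]])
  from quo_exists[OF wf(2) this] obtain Q p where Q: "wf_rep Q" and p: "is_hom L Q p" "hom_surj L Q p"
    and ker': "\<forall>i\<in>V. {x \<in> kvec (rdim L i). p i x = 0} = (if i \<in> V then u i ` kvec (rdim Z i) else {0})"
    unfolding quo_iso_def by (elim exE conjE)
  have ker: "{x \<in> kvec (rdim L i). p i x = 0} = u i ` kvec (rdim Z i)" if "i \<in> V" for i
    using ker' that by simp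
  \<comment> \<open>\<open>p\<close> is the cokernel of \<open>u\<close> and kills the nonzero
    vector \<open>u i x\<close>, so it has no retraction and \<open>\<xi>\<close> vanishes in
    Ext(N,Q).\<close>
  have "\<not> split_mono L Q p"
  proof
    assume "split_mono L Q p"
    then obtain r where r: "is_hom Q L r" "\<forall>i\<in>V. \<forall>x\<in>kvec (rdim L i). r i (p i x) = x"
      unfolding split_mono_iff by (elim exE conjE)
    have "p i (u i x) = 0" using ker[OF nz(1)] nz(2) by blast
    moreover have "r i (p i (u i x)) = u i x" using r(2) nz(1) hom_inI[OF u nz(1,2)] by blast
    ultimately show False using nz(3) lin_zero[OF hom_lin[OF r(1) nz(1)]] by simp
  qed
  from ar_D(6)[OF ar Q p(1) this] obtain \<phi> where \<phi>: "\<forall>i\<in>V. lin_on (rdim N i) (rdim Q i) (\<phi> i)"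
    "\<forall>a\<in>E. \<forall>x\<in>kvec (rdim N (src a)). p (tgt a) (\<xi> a x) = \<phi> (tgt a) (rmap N a x) - rmap Q a (\<phi> (src a) x)"
    unfolding cobound_def by (elim exE conjE)
  have "\<forall>i\<in>V. \<exists>\<psi>. lin_on (rdim N i) (rdim L i) \<psi> \<and> (\<forall>x\<in>kvec (rdim N i). p i (\<psi> x) = \<phi> i x)"
  proof
    fix i assume i: "i \<in> V"
    show "\<exists>\<psi>. lin_on (rdim N i) (rdim L i) \<psi> \<and> (\<forall>x\<in>kvec (rdim N i). p i (\<psi> x) = \<phi> i x)"
      using lin_lift[OF hom_lin[OF p(1) i] \<phi>(1)[rule_format, OF i]]
        lin_in[OF \<phi>(1)[rule_format, OF i]] p(2) i unfolding hom_surj_def by blast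
  qed
  from bchoice[OF this] obtain \<psi> where \<psi>: "\<forall>i\<in>V. lin_on (rdim N i) (rdim L i) (\<psi> i) \<and>
    (\<forall>x\<in>kvec (rdim N i). p i (\<psi> i x) = \<phi> i x)" ..
  have \<psi>l: "lin_on (rdim N i) (rdim L i) (\<psi> i)" if "i \<in> V" for i using \<psi> that by blast
  have p\<psi>: "p i (\<psi> i x) = \<phi> i x" if "i \<in> V" "x \<in> kvec (rdim N i)" for i x using \<psi> that by blast
  \<comment> \<open>After lifting the splitting from \<open>Q\<close> to the cochain
    \<open>\<psi>\<close> in \<open>L\<close>, the cocycle \<open>\<xi>\<close> minus the coboundary
    of \<open>\<psi>\<close> takes values in the image of \<open>u\<close>, so it lifts to
    \<open>Z\<close>.\<close>
  have "\<forall>a\<in>E. \<exists>c. lin_on (rdim N (src a)) (rdim Z (tgt a)) c \<and> (\<forall>x\<in>kvec (rdim N (src a)).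
    u (tgt a) (c x) = \<xi> a x - (\<psi> (tgt a) (rmap N a x) - rmap L a (\<psi> (src a) x)))"
  proof
    fix a assume a: "a \<in> E"
    note st = src_V[OF a] tgt_V[OF a]
    show "\<exists>c. lin_on (rdim N (src a)) (rdim Z (tgt a)) c \<and> (\<forall>x\<in>kvec (rdim N (src a)).
      u (tgt a) (c x) = \<xi> a x - (\<psi> (tgt a) (rmap N a x) - rmap L a (\<psi> (src a) x)))"
    proof (rule lin_lift[OF hom_lin[OF u st(2)]])
      show l: "lin_on (rdim N (src a)) (rdim L (tgt a))
         (\<lambda>x. \<xi> a x - (\<psi> (tgt a) (rmap N a x) - rmap L a (\<psi> (src a) x)))"
        by (intro lin_sub cocycle_lin[OF \<xi> a] lin_comp[OF wf_lin[OF wf(1) a] \<psi>l[OF st(2)]]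
            lin_comp[OF \<psi>l[OF st(1)] wf_lin[OF wf(2) a]])
      fix x :: "nat \<Rightarrow> 'k" assume x: "x \<in> kvec (rdim N (src a))"
      have Nx: "rmap N a x \<in> kvec (rdim N (tgt a))" by (rule wf_map[OF wf(1) a x])
      have k: "\<xi> a x \<in> kvec (rdim L (tgt a))" "\<psi> (src a) x \<in> kvec (rdim L (src a))"
        "\<psi> (tgt a) (rmap N a x) \<in> kvec (rdim L (tgt a))"
        using lin_in[OF cocycle_lin[OF \<xi> a] x] lin_in[OF \<psi>l[OF st(1)] x] lin_in[OF \<psi>l[OF st(2)] Nx] .
      have Lk: "rmap L a (\<psi> (src a) x) \<in> kvec (rdim L (tgt a))" by (rule wf_map[OF wf(2) a k(2)])
      note pd = lin_diff[OF hom_lin[OF p(1) st(2)]]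
      have "p (tgt a) (\<xi> a x - (\<psi> (tgt a) (rmap N a x) - rmap L a (\<psi> (src a) x))) = 0"
        using pd[OF k(1) kvec_diff[OF k(3) Lk]] pd[OF k(3) Lk] hom_comm[OF p(1) a k(2)]
          p\<psi>[OF st(1) x] p\<psi>[OF st(2) Nx] \<phi>(2)[rule_format, OF a x] by simp
      then show "\<xi> a x - (\<psi> (tgt a) (rmap N a x) - rmap L a (\<psi> (src a) x)) \<in> u (tgt a) ` kvec (rdim Z (tgt a))"
        using ker[OF st(2)] lin_in[OF l x] by blast
    qed
  qed
  from bchoice[OF this] obtain c where c: "\<forall>a\<in>E. lin_on (rdim N (src a)) (rdim Z (tgt a)) (c a) \<and>
    (\<forall>x\<in>kvec (rdim N (src a)).
      u (tgt a) (c a x) = \<xi> a x - (\<psi> (tgt a) (rmap N a x) - rmap L a (\<psi> (src a) x)))" ..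
  have "cobound N L (\<lambda>a x. \<xi> a x - u (tgt a) (c a x))" unfolding cobound_def
    by (intro exI[of _ \<psi>] conjI ballI \<psi>l) (use c in auto)
  moreover have "cocycle N Z c" using c by (simp add: cocycle_def)
  ultimately show ?thesis by blast
qed

lemma ar_factor_hom_right:
  fixes N L Z :: "('v, 'e, 'k::field) qrep"
  assumes ar: "ar_cocycle N L \<xi>" and Z: "wf_rep Z" and v: "is_hom N Z v"
    and nz: "i \<in> V" "x \<in> kvec (rdim N i)" "v i x \<noteq> 0"
  shows "\<exists>c. cocycle Z L c \<and> cobound N L (\<lambda>a x. \<xi> a x - c a (v (src a) x))"
proof -
  note wf = ar_D(1,2)[OF ar]
  note \<xi> = ar_D(3)[OF ar]
  from sub_exists[OF wf(1) subrep_kernel[OF v wf(1) Z]] obtain K j where K: "wf_rep K"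
    and j: "is_hom K N j" "hom_inj K j"
    and im': "\<forall>i\<in>V. j i ` kvec (rdim K i) = (if i \<in> V then {x \<in> kvec (rdim N i). v i x = 0} else {0})"
    unfolding sub_iso_def by (elim exE conjE)
  have im: "j i ` kvec (rdim K i) = {x \<in> kvec (rdim N i). v i x = 0}" if "i \<in> V" for i
    using im' that by simp
  \<comment> \<open>\<open>j\<close> is the inclusion of the kernel of \<open>v\<close>; it misses
    \<open>x\<close>, so it has no section and \<open>\<xi>\<close> vanishes on
    \<open>K\<close>.\<close>
  have "\<not> split_epi K N j"
  proof
    assume "split_epi K N j"
    then obtain s where s: "is_hom N K s" "\<forall>i\<in>V. \<forall>x\<in>kvec (rdim N i). j i (s i x) = x"
      unfolding split_epi_iff by (elim exE conjE)
    have "j i (s i x) \<in> j i ` kvec (rdim K i)" using hom_inI[OF s(1) nz(1,2)] by blast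
    then show False using im[OF nz(1)] s(2) nz by simp
  qed
  from ar_D(5)[OF ar K j(1) this] obtain \<phi> where \<phi>: "\<forall>i\<in>V. lin_on (rdim K i) (rdim L i) (\<phi> i)"
    "\<forall>a\<in>E. \<forall>x\<in>kvec (rdim K (src a)). \<xi> a (j (src a) x) = \<phi> (tgt a) (rmap K a x) - rmap L a (\<phi> (src a) x)"
    unfolding cobound_def by (elim exE conjE)
  have "\<forall>i\<in>V. \<exists>\<psi>. lin_on (rdim N i) (rdim L i) \<psi> \<and> (\<forall>x\<in>kvec (rdim K i). \<psi> (j i x) = \<phi> i x)"
  proof
    fix i assume i: "i \<in> V"
    show "\<exists>\<psi>. lin_on (rdim N i) (rdim L i) \<psi> \<and> (\<forall>x\<in>kvec (rdim K i). \<psi> (j i x) = \<phi> i x)"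
    proof (rule lin_factor_gen[OF hom_lin[OF j(1) i] \<phi>(1)[rule_format, OF i]])
      fix x :: "nat \<Rightarrow> 'k" assume x: "x \<in> kvec (rdim K i)" "j i x = 0"
      have "inj_on (j i) (kvec (rdim K i))" using j(2) i by (simp add: hom_inj_def)
      from lin_inj_zero[OF hom_lin[OF j(1) i] this x] show "\<phi> i x = 0"
        using lin_zero[OF \<phi>(1)[rule_format, OF i]] by simp
    qed
  qed
  from bchoice[OF this] obtain \<psi> where \<psi>: "\<forall>i\<in>V. lin_on (rdim N i) (rdim L i) (\<psi> i) \<and>
    (\<forall>x\<in>kvec (rdim K i). \<psi> i (j i x) = \<phi> i x)" ..
  have \<psi>l: "lin_on (rdim N i) (rdim L i) (\<psi> i)" if "i \<in> V" for i using \<psi> that by blast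
  have \<psi>j: "\<psi> i (j i x) = \<phi> i x" if "i \<in> V" "x \<in> kvec (rdim K i)" for i x using \<psi> that by blast
  \<comment> \<open>After extending the splitting from \<open>K\<close> to the cochain
    \<open>\<psi>\<close> on \<open>N\<close>, the cocycle \<open>\<xi>\<close> minus the coboundary
    of \<open>\<psi>\<close> vanishes on the kernel of \<open>v\<close>, so it factors through
    \<open>v\<close>.\<close>
  have "\<forall>a\<in>E. \<exists>c. lin_on (rdim Z (src a)) (rdim L (tgt a)) c \<and> (\<forall>x\<in>kvec (rdim N (src a)).
    c (v (src a) x) = \<xi> a x - (\<psi> (tgt a) (rmap N a x) - rmap L a (\<psi> (src a) x)))"
  proof
    fix a assume a: "a \<in> E"
    note st = src_V[OF a] tgt_V[OF a]
    show "\<exists>c. lin_on (rdim Z (src a)) (rdim L (tgt a)) c \<and> (\<forall>x\<in>kvec (rdim N (src a)).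
      c (v (src a) x) = \<xi> a x - (\<psi> (tgt a) (rmap N a x) - rmap L a (\<psi> (src a) x)))"
    proof (rule lin_factor_gen[OF hom_lin[OF v st(1)]])
      show "lin_on (rdim N (src a)) (rdim L (tgt a))
         (\<lambda>x. \<xi> a x - (\<psi> (tgt a) (rmap N a x) - rmap L a (\<psi> (src a) x)))"
        by (intro lin_sub cocycle_lin[OF \<xi> a] lin_comp[OF wf_lin[OF wf(1) a] \<psi>l[OF st(2)]]
            lin_comp[OF \<psi>l[OF st(1)] wf_lin[OF wf(2) a]])
      fix x :: "nat \<Rightarrow> 'k" assume x: "x \<in> kvec (rdim N (src a))" "v (src a) x = 0"
      then obtain k where k: "k \<in> kvec (rdim K (src a))" "x = j (src a) k" using im[OF st(1)] by blast
      have "\<psi> (tgt a) (rmap N a x) = \<phi> (tgt a) (rmap K a k)"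
        using k(2) hom_comm[OF j(1) a k(1)] \<psi>j[OF st(2) wf_map[OF K a k(1)]] by simp
      then show "\<xi> a x - (\<psi> (tgt a) (rmap N a x) - rmap L a (\<psi> (src a) x)) = 0"
        using k(2) \<phi>(2)[rule_format, OF a k(1)] \<psi>j[OF st(1) k(1)] by simp
    qed
  qed
  from bchoice[OF this] obtain c where c: "\<forall>a\<in>E. lin_on (rdim Z (src a)) (rdim L (tgt a)) (c a) \<and>
    (\<forall>x\<in>kvec (rdim N (src a)).
      c a (v (src a) x) = \<xi> a x - (\<psi> (tgt a) (rmap N a x) - rmap L a (\<psi> (src a) x)))" ..
  have "cobound N L (\<lambda>a x. \<xi> a x - c a (v (src a) x))" unfolding cobound_def
    by (intro exI[of _ \<psi>] conjI ballI \<psi>l) (use c in auto)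
  moreover have "cocycle Z L c" using c by (simp add: cocycle_def)
  ultimately show ?thesis by blast
qed

lemma cobound_diff_cancel:
  assumes "cobound A B (\<lambda>a x. c a x - d a x)" "cobound A B d" "wf_rep A" "wf_rep B"
  shows "cobound A B c"
  using cobound_add[OF assms] by simp

lemma hom_zeroD: "hom_zero A B \<Longrightarrow> is_hom A B f \<Longrightarrow> i \<in> V \<Longrightarrow> x \<in> kvec (rdim A i) \<Longrightarrow> f i x = 0"
  unfolding hom_zero_def by blast

text \<open>A nonzero element on one side pairs to \<open>\<xi>\<close> with some element on the
  other; if the other side is zero, \<open>\<xi>\<close> becomes a coboundary.\<close>

lemma ar_ext_zero_left:
  fixes N L Z :: "('v, 'e, 'k::field) qrep"
  assumes ar: "ar_cocycle N L \<xi>" and Z: "wf_rep Z"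
  shows "ext_zero N Z \<longleftrightarrow> hom_zero Z L"
proof
  assume e: "ext_zero N Z"
  show "hom_zero Z L" unfolding hom_zero_def
  proof (intro allI impI ballI, rule ccontr)
    fix u i and x :: "nat \<Rightarrow> 'k"
    assume u: "is_hom Z L u" and "i \<in> V" "x \<in> kvec (rdim Z i)" "u i x \<noteq> 0"
    from ar_factor_hom_left[OF ar Z this] obtain c where c: "cocycle N Z c"
      "cobound N L (\<lambda>a x. \<xi> a x - u (tgt a) (c a x))" by (elim exE conjE)
    have "cobound N Z c" using e c(1) by (simp add: ext_zero_def)
    from cobound_diff_cancel[OF c(2) cobound_post[OF this u ar_D(1)[OF ar] Z] ar_D(1,2)[OF ar]]
    show False using ar_D(4)[OF ar] by simp
  qed
next
  assume h: "hom_zero Z L"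
  show "ext_zero N Z" unfolding ext_zero_def
  proof (intro allI impI, rule ccontr)
    fix c assume c: "cocycle N Z c" "\<not> cobound N Z c"
    from ar_factor_ext_left[OF ar Z this] obtain u where u: "is_hom Z L u"
      "cobound N L (\<lambda>a x. \<xi> a x - u (tgt a) (c a x))" by (elim exE conjE)
    have "cobound N L \<xi>"
      by (rule cobound_cong[OF u(2)])
        (simp add: hom_zeroD[OF h u(1) tgt_V] lin_in[OF cocycle_lin[OF c(1)]] del: zero_fun_apply)
    then show False using ar_D(4)[OF ar] by simp
  qed
qed

lemma ar_ext_zero_right:
  fixes N L Z :: "('v, 'e, 'k::field) qrep"
  assumes ar: "ar_cocycle N L \<xi>" and Z: "wf_rep Z"
  shows "ext_zero Z L \<longleftrightarrow> hom_zero N Z"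
proof
  assume e: "ext_zero Z L"
  show "hom_zero N Z" unfolding hom_zero_def
  proof (intro allI impI ballI, rule ccontr)
    fix v i and x :: "nat \<Rightarrow> 'k"
    assume v: "is_hom N Z v" and "i \<in> V" "x \<in> kvec (rdim N i)" "v i x \<noteq> 0"
    from ar_factor_hom_right[OF ar Z this] obtain c where c: "cocycle Z L c"
      "cobound N L (\<lambda>a x. \<xi> a x - c a (v (src a) x))" by (elim exE conjE)
    have "cobound Z L c" using e c(1) by (simp add: ext_zero_def)
    from cobound_diff_cancel[OF c(2) cobound_pre[OF this v] ar_D(1,2)[OF ar]]
    show False using ar_D(4)[OF ar] by simp
  qed
next
  assume h: "hom_zero N Z"
  show "ext_zero Z L" unfolding ext_zero_def
  proof (intro allI impI, rule ccontr)
    fix c assume c: "cocycle Z L c" "\<not> cobound Z L c"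
    from ar_factor_ext_right[OF ar Z this] obtain v where v: "is_hom N Z v"
      "cobound N L (\<lambda>a x. \<xi> a x - c a (v (src a) x))" by (elim exE conjE)
    have "cobound N L \<xi>"
      by (rule cobound_cong[OF v(2)])
        (simp add: hom_zeroD[OF h v(1) src_V] lin_zero[OF cocycle_lin[OF c(1)]] del: zero_fun_apply)
    then show False using ar_D(4)[OF ar] by simp
  qed
qed

section \<open>Bricks and their transport along almost split sequences\<close>

text \<open>Says that the endomorphism ring is a division ring, since bijective homomorphisms are
  invertible by \<open>hom_inverse\<close>.\<close>

definition brick :: "('v, 'e, 'k::field) qrep \<Rightarrow> bool" where
  "brick X \<longleftrightarrow> wf_rep X \<and> \<not> is_zero_rep X \<and>
     (\<forall>f. is_hom X X f \<longrightarrow> (\<forall>i\<in>V. \<forall>x\<in>kvec (rdim X i). f i x = 0) \<or> (hom_inj X f \<and> hom_surj X X f))"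

lemma hom_endo_surj_inj:
  fixes X :: "('v, 'e, 'k::{finite,field}) qrep"
  assumes "hom_surj X X f" shows "hom_inj X f"
  using assms unfolding hom_surj_def hom_inj_def by (auto intro!: eq_card_imp_inj_on)

lemma hom_endo_inj_surj:
  fixes X :: "('v, 'e, 'k::{finite,field}) qrep"
  assumes "hom_inj X f" "is_hom X X f" shows "hom_surj X X f"
  using assms(1) hom_inI[OF assms(2)] unfolding hom_surj_def hom_inj_def
  by (auto intro!: endo_inj_surj[OF finite_kvec])

lemma brickI:
  assumes "wf_rep X" "\<not> is_zero_rep X"
    "\<And>f i x. is_hom X X f \<Longrightarrow> i \<in> V \<Longrightarrow> x \<in> kvec (rdim X i) \<Longrightarrow> f i x \<noteq> 0 \<Longrightarrow> hom_inj X f \<and> hom_surj X X f"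
  shows "brick X"
  using assms unfolding brick_def by blast

lemma brick_inverse:
  assumes "brick X" "is_hom X X f" "\<not> (\<forall>i\<in>V. \<forall>x\<in>kvec (rdim X i). f i x = 0)"
  shows "\<exists>g. is_hom X X g \<and> (\<forall>i\<in>V. \<forall>x\<in>kvec (rdim X i). g i (f i x) = x) \<and>
    (\<forall>i\<in>V. \<forall>y\<in>kvec (rdim X i). f i (g i y) = y)"
proof -
  have "hom_inj X f" "hom_surj X X f" "wf_rep X" using assms unfolding brick_def by blast+
  from hom_inverse[OF assms(2) this(1,2,3,3)] show ?thesis by (elim exE conjE) (intro exI conjI)
qed

lemma ar_not_zero:
  assumes ar: "ar_cocycle N L \<xi>"
  shows "\<not> is_zero_rep N" "\<not> is_zero_rep L"
proof -
  note wf = ar_D(1,2)[OF ar] and \<xi> = ar_D(3)[OF ar]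
  show "\<not> is_zero_rep N"
  proof
    assume z: "is_zero_rep N"
    have "cobound N L \<xi>"
      by (rule cobound_cong[OF cobound_zero[OF wf(2)]])
        (use z src_V lin_zero[OF cocycle_lin[OF \<xi>]] in \<open>simp add: is_zero_rep_def\<close>)
    then show False using ar_D(4)[OF ar] by simp
  qed
  show "\<not> is_zero_rep L"
  proof
    assume z: "is_zero_rep L"
    have "cobound N L \<xi>"
      by (rule cobound_cong[OF cobound_zero[OF wf(2)]])
        (use z tgt_V lin_in[OF cocycle_lin[OF \<xi>]] in \<open>simp add: is_zero_rep_def\<close>)
    then show False using ar_D(4)[OF ar] by simp
  qed
qed

text \<open>Modulo coboundaries: if \<open>f\<close> is nonzero and not a split epimorphism, then \<open>\<xi> = c f\<close> and
  \<open>\<xi> = u c\<close> with \<open>u\<close> invertible, whence \<open>\<xi> = u\<^sup>-\<^sup>1 \<xi> f = 0\<close>.\<close>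

lemma ar_brick_left:
  fixes N L :: "('v, 'e, 'k::{finite,field}) qrep"
  assumes ar: "ar_cocycle N L \<xi>" and L: "brick L"
  shows "brick N"
proof (rule brickI)
  note wf = ar_D(1,2)[OF ar]
  show "wf_rep N" by (rule wf)
  show "\<not> is_zero_rep N" by (rule ar_not_zero[OF ar])
  fix f i and x :: "nat \<Rightarrow> 'k"
  assume f: "is_hom N N f" and nz: "i \<in> V" "x \<in> kvec (rdim N i)" "f i x \<noteq> 0"
  have "split_epi N N f"
  proof (rule ccontr)
    assume "\<not> split_epi N N f"
    note \<xi>f = ar_D(5)[OF ar wf(1) f this]
    from ar_factor_hom_right[OF ar wf(1) f nz] obtain c where c: "cocycle N L c"
      "cobound N L (\<lambda>a x. \<xi> a x - c a (f (src a) x))" by (elim exE conjE)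
    have "\<not> cobound N L c"
      using cobound_diff_cancel[OF c(2) cobound_pre[OF _ f] wf] ar_D(4)[OF ar] by blast
    from ar_factor_ext_left[OF ar wf(2) c(1) this] obtain u where u: "is_hom L L u"
      "cobound N L (\<lambda>a x. \<xi> a x - u (tgt a) (c a x))" by (elim exE conjE)
    have "\<not> (\<forall>i\<in>V. \<forall>x\<in>kvec (rdim L i). u i x = 0)"
    proof
      assume z: "\<forall>i\<in>V. \<forall>x\<in>kvec (rdim L i). u i x = 0"
      have "cobound N L \<xi>"
        by (rule cobound_cong[OF u(2)]) (use z tgt_V lin_in[OF cocycle_lin[OF c(1)]] in \<open>simp del: zero_fun_apply\<close>)
      then show False using ar_D(4)[OF ar] by simp
    qed
    from brick_inverse[OF L u(1) this] obtain w where w: "is_hom L L w"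
      "\<forall>i\<in>V. \<forall>x\<in>kvec (rdim L i). w i (u i x) = x" by (elim exE conjE)
    have "cobound N L (\<lambda>a x. c a x - w (tgt a) (\<xi> a x))"
    proof (rule cobound_cong[OF cobound_minus[OF cobound_post[OF u(2) w(1) wf] wf]])
      fix a and x :: "nat \<Rightarrow> 'k" assume a: "a \<in> E" and x: "x \<in> kvec (rdim N (src a))"
      have k: "\<xi> a x \<in> kvec (rdim L (tgt a))" "c a x \<in> kvec (rdim L (tgt a))"
        using lin_in[OF cocycle_lin[OF ar_D(3)[OF ar] a] x] lin_in[OF cocycle_lin[OF c(1) a] x] .
      show "c a x - w (tgt a) (\<xi> a x) = - w (tgt a) (\<xi> a x - u (tgt a) (c a x))"
        using lin_diff[OF hom_lin[OF w(1) tgt_V[OF a]] k(1) hom_inI[OF u(1) tgt_V[OF a] k(2)]]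
          w(2) tgt_V[OF a] k(2) by simp
    qed
    from cobound_diff_cancel[OF cobound_pre[OF this f] cobound_post[OF \<xi>f w(1) wf] wf]
    have "cobound N L (\<lambda>a x. c a (f (src a) x))" .
    from cobound_diff_cancel[OF c(2) this wf] show False using ar_D(4)[OF ar] by simp
  qed
  then obtain s where s: "is_hom N N s" "\<forall>i\<in>V. \<forall>x\<in>kvec (rdim N i). f i (s i x) = x"
    unfolding split_epi_iff by (elim exE conjE)
  have "hom_surj N N f" unfolding hom_surj_def
  proof (intro ballI equalityI subsetI)
    fix i and x :: "nat \<Rightarrow> 'k" assume i: "i \<in> V" and x: "x \<in> kvec (rdim N i)"
    show "x \<in> f i ` kvec (rdim N i)"
      by (rule image_eqI[OF _ hom_inI[OF s(1) i x]]) (use s(2) i x in simp)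
  qed (use hom_inI[OF f] in blast)
  then show "hom_inj N f \<and> hom_surj N N f" using hom_endo_surj_inj by blast
qed

text \<open>Modulo coboundaries: if \<open>f\<close> is nonzero and not a split monomorphism, then
  \<open>f \<xi> = 0\<close>, \<open>\<xi> = f c\<close> and \<open>\<xi> = c v\<close> with
  \<open>v\<close> invertible of inverse \<open>w\<close>. Hence \<open>c = \<xi> w\<close> and
  \<open>\<xi> = f \<xi> w = 0\<close>.\<close>

lemma ar_brick_right:
  fixes N L :: "('v, 'e, 'k::{finite,field}) qrep"
  assumes ar: "ar_cocycle N L \<xi>" and N: "brick N"
  shows "brick L"
proof (rule brickI)
  note wf = ar_D(1,2)[OF ar]
  show "wf_rep L" by (rule wf)
  show "\<not> is_zero_rep L" by (rule ar_not_zero[OF ar])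
  fix f i and x :: "nat \<Rightarrow> 'k"
  assume f: "is_hom L L f" and nz: "i \<in> V" "x \<in> kvec (rdim L i)" "f i x \<noteq> 0"
  have "split_mono L L f"
  proof (rule ccontr)
    assume "\<not> split_mono L L f"
    note f\<xi> = ar_D(6)[OF ar wf(2) f this]
    from ar_factor_hom_left[OF ar wf(2) f nz] obtain c where c: "cocycle N L c"
      "cobound N L (\<lambda>a x. \<xi> a x - f (tgt a) (c a x))" by (elim exE conjE)
    have "\<not> cobound N L c"
      using cobound_diff_cancel[OF c(2) cobound_post[OF _ f wf] wf] ar_D(4)[OF ar] by blast
    from ar_factor_ext_right[OF ar wf(1) c(1) this] obtain v where v: "is_hom N N v"
      "cobound N L (\<lambda>a x. \<xi> a x - c a (v (src a) x))" by (elim exE conjE)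
    have "\<not> (\<forall>i\<in>V. \<forall>x\<in>kvec (rdim N i). v i x = 0)"
    proof
      assume z: "\<forall>i\<in>V. \<forall>x\<in>kvec (rdim N i). v i x = 0"
      have "cobound N L \<xi>"
        by (rule cobound_cong[OF v(2)]) (use z src_V lin_zero[OF cocycle_lin[OF c(1)]] in \<open>simp del: zero_fun_apply\<close>)
      then show False using ar_D(4)[OF ar] by simp
    qed
    from brick_inverse[OF N v(1) this] obtain w where w: "is_hom N N w"
      "\<forall>i\<in>V. \<forall>x\<in>kvec (rdim N i). v i (w i x) = x" by (elim exE conjE)
    have "cobound N L (\<lambda>a x. c a x - \<xi> a (w (src a) x))"
      by (rule cobound_cong[OF cobound_minus[OF cobound_pre[OF v(2) w(1)] wf]])
        (use w(2) src_V in simp)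
    from cobound_post[OF this f wf]
    have "cobound N L (\<lambda>a x. f (tgt a) (c a x) - f (tgt a) (\<xi> a (w (src a) x)))"
    proof (rule cobound_cong)
      fix a and x :: "nat \<Rightarrow> 'k" assume a: "a \<in> E" and x: "x \<in> kvec (rdim N (src a))"
      show "f (tgt a) (c a x) - f (tgt a) (\<xi> a (w (src a) x)) = f (tgt a) (c a x - \<xi> a (w (src a) x))"
        by (rule lin_diff[OF hom_lin[OF f tgt_V[OF a]] lin_in[OF cocycle_lin[OF c(1) a] x]
              lin_in[OF cocycle_lin[OF ar_D(3)[OF ar] a] hom_inI[OF w(1) src_V[OF a] x]], symmetric])
    qed
    from cobound_diff_cancel[OF this cobound_pre[OF f\<xi> w(1)] wf]
    have "cobound N L (\<lambda>a x. f (tgt a) (c a x))" .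
    from cobound_diff_cancel[OF c(2) this wf] show False using ar_D(4)[OF ar] by simp
  qed
  then obtain r where r: "is_hom L L r" "\<forall>i\<in>V. \<forall>x\<in>kvec (rdim L i). r i (f i x) = x"
    unfolding split_mono_iff by (elim exE conjE)
  have "hom_inj L f" unfolding hom_inj_def inj_on_def using r(2) by metis
  then show "hom_inj L f \<and> hom_surj L L f" using hom_endo_inj_surj[OF _ f] by blast
qed

subsection \<open>Projective and injective indecomposables\<close>

text \<open>Lifting the identity of \<open>P\<close> along the projection of the extension given by
  a cocycle yields a section.\<close>

lemma projective_ext_zero:
  fixes P Z :: "('v, 'e, 'k::field) qrep"
  assumes "projective_rep P" "wf_rep Z"
  shows "ext_zero P Z"
  unfolding ext_zero_def
proof (intro allI impI)
  fix c assume c: "cocycle P Z c"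
  have P: "wf_rep P" using assms(1) by (simp add: projective_rep_def)
  have "\<exists>h'. is_hom P (ext_rep Z P c) h' \<and> hom_comp_eq P (ext_pr Z) h' (\<lambda>i x. x)"
    by (rule assms(1)[unfolded projective_rep_def, THEN conjunct2, rule_format,
          of "ext_rep Z P c" P "ext_pr Z" "\<lambda>i x. x"])
      (intro conjI ext_rep_wf[OF P assms(2) c] P ext_pr_hom ext_pr_surj hom_identity)
  then obtain s where "is_hom P (ext_rep Z P c) s" "\<forall>i\<in>V. \<forall>x\<in>kvec (rdim P i). ext_pr Z i (s i x) = x"
    unfolding hom_comp_eq_def by (elim exE conjE)
  then show "cobound P Z c" by (rule ext_pr_split_cobound[OF P assms(2) c])
qed

lemma injective_ext_zero:
  fixes I Z :: "('v, 'e, 'k::field) qrep"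
  assumes "injective_rep I" "wf_rep Z"
  shows "ext_zero Z I"
  unfolding ext_zero_def
proof (intro allI impI)
  fix c assume c: "cocycle Z I c"
  have I: "wf_rep I" using assms(1) by (simp add: injective_rep_def)
  have "\<exists>h'. is_hom (ext_rep I Z c) I h' \<and> hom_comp_eq I h' (ext_in I) (\<lambda>i x. x)"
    by (rule assms(1)[unfolded injective_rep_def, THEN conjunct2, rule_format,
          of I "ext_rep I Z c" "ext_in I" "\<lambda>i x. x"])
      (intro conjI ext_rep_wf[OF assms(2) I c] I ext_in_hom[OF assms(2) I c] ext_in_inj hom_identity)
  then obtain r where "is_hom (ext_rep I Z c) I r" "\<forall>i\<in>V. \<forall>x\<in>kvec (rdim I i). r i (ext_in I i x) = x"
    unfolding hom_comp_eq_def by (elim exE conjE)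
  then show "cobound Z I c" by (rule ext_in_split_cobound[OF assms(2) I c])
qed

lemma indecomposable_ses_ext_zero:
  fixes X :: "('v, 'e, 'k::field) qrep"
  assumes ses: "ses A X C f g" and X: "indecomposable X" and e: "ext_zero C A"
  shows "is_zero_rep A \<or> is_zero_rep C"
proof -
  have wf: "wf_rep A" "wf_rep X" "wf_rep C" and f: "is_hom A X f" "hom_inj A f"
    and g: "is_hom X C g" "hom_surj X C g"
    and ex: "\<And>i. i \<in> V \<Longrightarrow> {x \<in> kvec (rdim X i). g i x = 0} = f i ` kvec (rdim A i)"
    using ses unfolding ses_def by auto
  obtain s where s: "is_hom C X s" "\<forall>i\<in>V. \<forall>y\<in>kvec (rdim C i). g i (s i y) = y"
    using ses_split[OF ses e] by (elim exE conjE)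
  let ?U = "\<lambda>i. if i \<in> V then f i ` kvec (rdim A i) else {0}"
  let ?W = "\<lambda>i. if i \<in> V then s i ` kvec (rdim C i) else {0}"
  have S: "subrep X ?U" "subrep X ?W"
    using subrep_image[OF f(1) wf(1) subrep_full[OF wf(1)]]
      subrep_image[OF s(1) wf(3) subrep_full[OF wf(3)]] by auto
  have D: "?U i \<inter> ?W i = {0} \<and> {u + w | u w. u \<in> ?U i \<and> w \<in> ?W i} = kvec (rdim X i)"
    if i: "i \<in> V" for i
  proof (intro conjI equalityI subsetI)
    fix x assume "x \<in> ?U i \<inter> ?W i"
    then have "x \<in> f i ` kvec (rdim A i)" "x \<in> s i ` kvec (rdim C i)" using i by auto
    then obtain y where y: "y \<in> kvec (rdim C i)" "x = s i y" "g i x = 0" using ex[OF i] by blast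
    then show "x \<in> {0}" using s(2) i lin_zero[OF hom_lin[OF s(1) i]] by auto
  next
    fix x :: "nat \<Rightarrow> 'k" assume "x \<in> {0}"
    moreover have "0 \<in> f i ` kvec (rdim A i)" "0 \<in> s i ` kvec (rdim C i)"
      using lin_zero[OF hom_lin[OF f(1) i]] lin_zero[OF hom_lin[OF s(1) i]] zero_in_kvec
      by (metis image_eqI)+
    ultimately show "x \<in> ?U i \<inter> ?W i" using i by simp
  next
    fix x assume "x \<in> {u + w | u w. u \<in> ?U i \<and> w \<in> ?W i}"
    then show "x \<in> kvec (rdim X i)" using i hom_inI[OF f(1) i] hom_inI[OF s(1) i] by auto
  next
    fix x :: "nat \<Rightarrow> 'k" assume x: "x \<in> kvec (rdim X i)"
    have gx: "g i x \<in> kvec (rdim C i)" by (rule hom_inI[OF g(1) i x])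
    have sg: "s i (g i x) \<in> kvec (rdim X i)" by (rule hom_inI[OF s(1) i gx])
    have "g i (x - s i (g i x)) = 0"
      using lin_diff[OF hom_lin[OF g(1) i] x sg] s(2) i gx by simp
    then have "x - s i (g i x) \<in> f i ` kvec (rdim A i)" using ex[OF i] kvec_diff[OF x sg] by blast
    moreover have "s i (g i x) \<in> s i ` kvec (rdim C i)" using gx by blast
    ultimately show "x \<in> {u + w | u w. u \<in> ?U i \<and> w \<in> ?W i}"
      using i by (intro CollectI exI[of _ "x - s i (g i x)"] exI[of _ "s i (g i x)"]) simp
  qed
  have "(\<forall>i\<in>V. ?U i = {0}) \<or> (\<forall>i\<in>V. ?W i = {0})"
    by (rule X[unfolded indecomposable_def, THEN conjunct2, THEN conjunct2, THEN spec[of _ ?U],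
          THEN spec[of _ ?W], THEN mp, OF conjI[OF S(1) conjI[OF S(2) ballI[OF D]]]])
  then show ?thesis
  proof
    assume U: "\<forall>i\<in>V. ?U i = {0}"
    have "rdim A i = 0" if i: "i \<in> V" for i
    proof (rule kvec_trivial[where 'k = 'k], intro equalityI subsetI)
      fix x :: "nat \<Rightarrow> 'k" assume x: "x \<in> kvec (rdim A i)"
      have "f i ` kvec (rdim A i) = {0}" using U i by auto
      then have "f i x = f i 0" using imageI[OF x, of "f i"] lin_zero[OF hom_lin[OF f(1) i]] by simp
      then show "x \<in> {0}" using hom_injD[OF f(2) i _ x zero_in_kvec] by simp
    qed simp
    then show ?thesis by (simp add: is_zero_rep_def)
  next
    assume W: "\<forall>i\<in>V. ?W i = {0}"
    have "rdim C i = 0" if i: "i \<in> V" for i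
    proof (rule kvec_trivial[where 'k = 'k], intro equalityI subsetI)
      fix x :: "nat \<Rightarrow> 'k" assume x: "x \<in> kvec (rdim C i)"
      have "s i ` kvec (rdim C i) = {0}" using W i by auto
      then have "s i x = 0" using imageI[OF x, of "s i"] by simp
      then have "g i (s i x) = 0" using lin_zero[OF hom_lin[OF g(1) i]] by simp
      then show "x \<in> {0}" using s(2) i x by simp
    qed simp
    then show ?thesis by (simp add: is_zero_rep_def)
  qed
qed

text \<open>The image \<open>Q\<close> of a nonzero \<open>f\<close> embeds into \<open>P\<close>,
  so by heredity Ext(Q,K) = 0 for the kernel \<open>K\<close>. The sequence from \<open>K\<close>
  over \<open>P\<close> to \<open>Q\<close> splits, and indecomposability leaves
  \<open>K = 0\<close>.\<close>

lemma projective_brick: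
  fixes P :: "('v, 'e, 'k::{finite,field}) qrep"
  assumes P: "indecomposable P" "projective_rep P"
  shows "brick P"
proof (rule brickI)
  show wf: "wf_rep P" and "\<not> is_zero_rep P" using P(1) by (simp_all add: indecomposable_def)
  fix f i and x :: "nat \<Rightarrow> 'k"
  assume f: "is_hom P P f" and nz: "i \<in> V" "x \<in> kvec (rdim P i)" "f i x \<noteq> 0"
  from ses_exists[OF wf subrep_kernel[OF f wf wf]] obtain K Q j p where ses: "ses K P Q j p"
    and jK': "\<forall>i\<in>V. j i ` kvec (rdim K i) = (if i \<in> V then {x \<in> kvec (rdim P i). f i x = 0} else {0})"
    by (elim exE conjE)
  have wf': "wf_rep K" "wf_rep Q" and p: "is_hom P Q p" "hom_surj P Q p"
    and ker: "\<And>i. i \<in> V \<Longrightarrow> {x \<in> kvec (rdim P i). p i x = 0} = {x \<in> kvec (rdim P i). f i x = 0}"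
    using ses jK' unfolding ses_def by auto
  have "\<exists>q. is_hom Q P q \<and> (\<forall>i\<in>V. \<forall>x\<in>kvec (rdim P i). q i (p i x) = f i x)"
    by (rule hom_factor_surj[OF p f wf wf]) (use ker in blast)
  then obtain q where q: "is_hom Q P q" "\<forall>i\<in>V. \<forall>x\<in>kvec (rdim P i). q i (p i x) = f i x"
    by (elim exE conjE)
  have "hom_inj Q q" unfolding hom_inj_def
  proof (intro ballI lin_inj[OF hom_lin[OF q(1)]])
    fix i and y :: "nat \<Rightarrow> 'k" assume i: "i \<in> V" and y: "y \<in> kvec (rdim Q i)" and z: "q i y = 0"
    obtain x where x: "x \<in> kvec (rdim P i)" "y = p i x" using hom_surjD[OF p(2) i y] by blast
    then have "f i x = 0" using q(2) i z by auto
    then show "y = 0" using ker[OF i] x by blast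
  qed
  from ext_zero_sub[OF projective_ext_zero[OF P(2) wf'(1)] q(1) this]
  have "is_zero_rep K \<or> is_zero_rep Q" by (rule indecomposable_ses_ext_zero[OF ses P(1)])
  moreover have "\<not> is_zero_rep Q"
  proof
    assume "is_zero_rep Q"
    then have "p i x = 0" using hom_inI[OF p(1) nz(1,2)] nz(1) by (simp add: is_zero_rep_def)
    then show False using ker[OF nz(1)] nz(2,3) by blast
  qed
  ultimately have K: "is_zero_rep K" by blast
  have "hom_inj P f" unfolding hom_inj_def
  proof (intro ballI lin_inj[OF hom_lin[OF f]])
    fix i and y :: "nat \<Rightarrow> 'k" assume i: "i \<in> V" and y: "y \<in> kvec (rdim P i)" and z: "f i y = 0"
    then have "y \<in> j i ` kvec (rdim K i)" using jK' i by auto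
    moreover have "kvec (rdim K i) = ({0} :: (nat \<Rightarrow> 'k) set)" using K i by (simp add: is_zero_rep_def)
    moreover have "j i 0 = 0" using ses i lin_zero[OF hom_lin] unfolding ses_def by blast
    ultimately show "y = 0" by simp
  qed
  then show "hom_inj P f \<and> hom_surj P P f" using hom_endo_inj_surj f by blast
qed

text \<open>The image \<open>U\<close> of a nonzero \<open>f\<close> is a quotient of
  \<open>I\<close>, so by heredity Ext(C,U) = 0 for the cokernel \<open>C\<close>. The sequence from
  \<open>U\<close> over \<open>I\<close> to \<open>C\<close> splits, and indecomposability leaves
  \<open>C = 0\<close>.\<close>

lemma injective_brick:
  fixes I :: "('v, 'e, 'k::{finite,field}) qrep"
  assumes I: "indecomposable I" "injective_rep I"
  shows "brick I"
proof (rule brickI)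
  show wf: "wf_rep I" and "\<not> is_zero_rep I" using I(1) by (simp_all add: indecomposable_def)
  fix f i and x :: "nat \<Rightarrow> 'k"
  assume f: "is_hom I I f" and nz: "i \<in> V" "x \<in> kvec (rdim I i)" "f i x \<noteq> 0"
  from ses_exists[OF wf subrep_image[OF f wf subrep_full[OF wf]]] obtain U C j p where ses: "ses U I C j p"
    and jU': "\<forall>i\<in>V. j i ` kvec (rdim U i) = (if i \<in> V then f i ` kvec (rdim I i) else {0})"
    by (elim exE conjE)
  have jU: "j i ` kvec (rdim U i) = f i ` kvec (rdim I i)" if "i \<in> V" for i using jU' that by simp
  have wf': "wf_rep U" "wf_rep C" and j: "is_hom U I j" "hom_inj U j" and p: "is_hom I C p"
    and ker: "\<And>i. i \<in> V \<Longrightarrow> {x \<in> kvec (rdim I i). p i x = 0} = j i ` kvec (rdim U i)"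
    using ses unfolding ses_def by auto
  have "\<exists>h. is_hom I U h \<and> (\<forall>i\<in>V. \<forall>x\<in>kvec (rdim I i). j i (h i x) = f i x)"
    by (rule hom_lift_inj[OF j f wf wf'(1)]) (use jU in blast)
  then obtain h where h: "is_hom I U h" "\<forall>i\<in>V. \<forall>x\<in>kvec (rdim I i). j i (h i x) = f i x"
    by (elim exE conjE)
  have "hom_surj I U h" unfolding hom_surj_def
  proof (intro ballI equalityI subsetI)
    fix i and y :: "nat \<Rightarrow> 'k" assume i: "i \<in> V" and y: "y \<in> kvec (rdim U i)"
    then have "j i y \<in> f i ` kvec (rdim I i)" using jU[OF i] by blast
    then obtain x where x: "x \<in> kvec (rdim I i)" "j i y = j i (h i x)" using h(2) i by auto
    then have "y = h i x" using hom_injD[OF j(2) i x(2) y hom_inI[OF h(1) i x(1)]] by simp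
    then show "y \<in> h i ` kvec (rdim I i)" using x(1) by blast
  qed (use hom_inI[OF h(1)] in blast)
  from ext_zero_quo[OF injective_ext_zero[OF I(2) wf'(2)] h(1) this wf'(2) wf]
  have "is_zero_rep U \<or> is_zero_rep C" by (rule indecomposable_ses_ext_zero[OF ses I(1)])
  moreover have "\<not> is_zero_rep U"
  proof
    assume "is_zero_rep U"
    then have "h i x = 0" using hom_inI[OF h(1) nz(1,2)] nz(1) by (simp add: is_zero_rep_def)
    moreover have "j i (h i x) = f i x" using h(2) nz(1,2) by blast
    ultimately show False using nz(3) lin_zero[OF hom_lin[OF j(1) nz(1)]] by metis
  qed
  ultimately have C: "is_zero_rep C" by blast
  have "hom_surj I I f" unfolding hom_surj_def
  proof (intro ballI equalityI subsetI)
    fix i and y :: "nat \<Rightarrow> 'k" assume i: "i \<in> V" and y: "y \<in> kvec (rdim I i)"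
    have "p i y = 0" using hom_inI[OF p i y] C i by (simp add: is_zero_rep_def)
    then show "y \<in> f i ` kvec (rdim I i)" using ker[OF i] jU[OF i] y by blast
  qed (use hom_inI[OF f] in blast)
  then show "hom_inj I f \<and> hom_surj I I f" using hom_endo_surj_inj by blast
qed

subsection \<open>Levels of preprojectives and preinjectives\<close>

text \<open>\<open>proj_level n X\<close> says \<open>X = \<tau>\<^sup>-\<^sup>n P\<close> and \<open>inj_level n X\<close> says \<open>X = \<tau>\<^sup>n I\<close>, with \<open>P\<close> an
  indecomposable projective and \<open>I\<close> an indecomposable injective.\<close>

inductive proj_level :: "nat \<Rightarrow> ('v, 'e, 'k::field) qrep \<Rightarrow> bool" where
  proj: "indecomposable P \<Longrightarrow> projective_rep P \<Longrightarrow> proj_level 0 P"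
| tau_inv: "proj_level n L \<Longrightarrow> almost_split L M N f g \<Longrightarrow> proj_level (Suc n) N"

inductive inj_level :: "nat \<Rightarrow> ('v, 'e, 'k::field) qrep \<Rightarrow> bool" where
  inj: "indecomposable I \<Longrightarrow> injective_rep I \<Longrightarrow> inj_level 0 I"
| tau: "inj_level n N \<Longrightarrow> almost_split L M N f g \<Longrightarrow> inj_level (Suc n) L"

lemma preproj_indec_level: "preproj_indec X \<Longrightarrow> \<exists>n. proj_level n X"
  by (induction rule: preproj_indec.induct) (blast intro: proj_level.intros)+

lemma preinj_indec_level: "preinj_indec X \<Longrightarrow> \<exists>n. inj_level n X"
  by (induction rule: preinj_indec.induct) (blast intro: inj_level.intros)+

definition exceptional :: "('v, 'e, 'k::field) qrep \<Rightarrow> bool" where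
  "exceptional X \<longleftrightarrow> brick X \<and> ext_zero X X"

text \<open>Along an almost split sequence Ext(L,L) = 0, Hom(N,L) = 0 and Ext(N,N) = 0 are
  equivalent, by taking \<open>Z\<close> to be \<open>L\<close> or \<open>N\<close> in the two
  Auslander-Reiten formulas.\<close>

lemma proj_level_exceptional:
  fixes X :: "('v, 'e, 'k::{finite,field}) qrep"
  shows "proj_level n X \<Longrightarrow> exceptional X"
proof (induction rule: proj_level.induct)
  case (proj P)
  then have "wf_rep P" by (simp add: indecomposable_def)
  then show ?case unfolding exceptional_def
    by (intro conjI projective_brick projective_ext_zero proj)
next
  case (tau_inv n L M N f g)
  obtain \<xi> where ar: "ar_cocycle N L \<xi>" using almost_split_cocycle[OF tau_inv.hyps(2)] by blast
  have "hom_zero N L" using tau_inv.IH ar_ext_zero_right[OF ar ar_D(2)[OF ar]]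
    by (simp add: exceptional_def)
  then show ?case using tau_inv.IH ar_ext_zero_left[OF ar ar_D(1)[OF ar]] ar_brick_left[OF ar]
    by (simp add: exceptional_def)
qed

lemma inj_level_exceptional:
  fixes X :: "('v, 'e, 'k::{finite,field}) qrep"
  shows "inj_level n X \<Longrightarrow> exceptional X"
proof (induction rule: inj_level.induct)
  case (inj I)
  then have "wf_rep I" by (simp add: indecomposable_def)
  then show ?case unfolding exceptional_def
    by (intro conjI injective_brick injective_ext_zero inj)
next
  case (tau n N L M f g)
  obtain \<xi> where ar: "ar_cocycle N L \<xi>" using almost_split_cocycle[OF tau.hyps(2)] by blast
  have "hom_zero N L" using tau.IH ar_ext_zero_left[OF ar ar_D(1)[OF ar]]
    by (simp add: exceptional_def)
  then show ?case using tau.IH ar_ext_zero_right[OF ar ar_D(2)[OF ar]] ar_brick_right[OF ar]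
    by (simp add: exceptional_def)
qed

lemma exceptional_wf: "exceptional X \<Longrightarrow> wf_rep X"
  by (simp add: exceptional_def brick_def)

text \<open>Applying \<tau> to both arguments keeps Hom nonzero: if Hom(X,N') is nonzero, then so
  are Ext(N',L) and Hom(L,L'). When the target reaches level 0 it is projective, and a source of
  positive level would give it a nonzero Ext.\<close>

lemma proj_level_hom:
  fixes X Y :: "('v, 'e, 'k::{finite,field}) qrep"
  shows "proj_level m Y \<Longrightarrow> proj_level n X \<Longrightarrow> \<not> hom_zero X Y \<Longrightarrow> n \<le> m"
proof (induction arbitrary: n X rule: proj_level.induct)
  case (proj P)
  show ?case
    using proj.prems(1)
  proof cases
    case (tau_inv n' L M f g)
    obtain \<xi> where ar: "ar_cocycle X L \<xi>" using almost_split_cocycle[OF tau_inv(3)] by blast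
    have "wf_rep P" using proj.hyps by (simp add: projective_rep_def)
    then have "\<not> ext_zero P L" using ar_ext_zero_right[OF ar] proj.prems(2) by blast
    then show ?thesis using projective_ext_zero[OF proj.hyps(2) ar_D(2)[OF ar]] by blast
  qed simp
next
  case (tau_inv m L' M' N' f' g')
  show ?case
    using tau_inv.prems(1)
  proof cases
    case (tau_inv n' L M f g)
    obtain \<xi> where ar: "ar_cocycle X L \<xi>" using almost_split_cocycle[OF tau_inv(3)] by blast
    obtain \<xi>' where ar': "ar_cocycle N' L' \<xi>'" using almost_split_cocycle[OF \<open>almost_split L' M' N' f' g'\<close>] by blast
    have "\<not> ext_zero N' L" using ar_ext_zero_right[OF ar ar_D(1)[OF ar']] \<open>\<not> hom_zero X N'\<close> by blast
    then have "\<not> hom_zero L L'" using ar_ext_zero_left[OF ar' ar_D(2)[OF ar]] by blast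
    then show ?thesis using tau_inv.IH tau_inv by simp
  qed simp
qed

text \<open>A nonzero Ext(X,Y) is a nonzero Hom(Y,L) with \<open>L\<close> one level below
  \<open>X\<close>; this step makes the inequality strict.\<close>

lemma proj_level_ext:
  fixes X Y :: "('v, 'e, 'k::{finite,field}) qrep"
  assumes X: "proj_level n X" and Y: "proj_level m Y" and e: "\<not> ext_zero X Y"
  shows "m < n"
  using X
proof cases
  case proj
  then show ?thesis using projective_ext_zero exceptional_wf[OF proj_level_exceptional[OF Y]] e by blast
next
  case (tau_inv n' L M f g)
  obtain \<xi> where ar: "ar_cocycle X L \<xi>" using almost_split_cocycle[OF tau_inv(3)] by blast
  have "\<not> hom_zero Y L" using ar_ext_zero_left[OF ar exceptional_wf[OF proj_level_exceptional[OF Y]]] e by blast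
  then show ?thesis using proj_level_hom[OF tau_inv(2) Y] tau_inv(1) by simp
qed

text \<open>Dual to \<open>proj_level_hom\<close>: the induction runs on the source
  \<open>Y\<close>, and \<tau> inverse is applied to both arguments.\<close>

lemma inj_level_hom:
  fixes X Y :: "('v, 'e, 'k::{finite,field}) qrep"
  shows "inj_level m Y \<Longrightarrow> inj_level n X \<Longrightarrow> \<not> hom_zero Y X \<Longrightarrow> n \<le> m"
proof (induction arbitrary: n X rule: inj_level.induct)
  case (inj I)
  show ?case
    using inj.prems(1)
  proof cases
    case (tau n' N M f g)
    obtain \<xi> where ar: "ar_cocycle N X \<xi>" using almost_split_cocycle[OF tau(3)] by blast
    have "wf_rep I" using inj.hyps by (simp add: injective_rep_def)
    then have "\<not> ext_zero N I" using ar_ext_zero_left[OF ar] inj.prems(2) by blast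
    then show ?thesis using injective_ext_zero[OF inj.hyps(2) ar_D(1)[OF ar]] by blast
  qed simp
next
  case (tau m N' L' M' f' g')
  show ?case
    using tau.prems(1)
  proof cases
    case (tau n' N M f g)
    obtain \<xi> where ar: "ar_cocycle N X \<xi>" using almost_split_cocycle[OF tau(3)] by blast
    obtain \<xi>' where ar': "ar_cocycle N' L' \<xi>'" using almost_split_cocycle[OF \<open>almost_split L' M' N' f' g'\<close>] by blast
    have "\<not> ext_zero N L'" using ar_ext_zero_left[OF ar ar_D(2)[OF ar']] \<open>\<not> hom_zero L' X\<close> by blast
    then have "\<not> hom_zero N' N" using ar_ext_zero_right[OF ar' ar_D(1)[OF ar]] by blast
    then show ?thesis using tau.IH tau by simp
  qed simp
qed

text \<open>Levels are counted from the injectives, so a nonzero Ext now forces the smaller level on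
  its first argument, opposite to \<open>proj_level_ext\<close>.\<close>

lemma inj_level_ext:
  fixes X Y :: "('v, 'e, 'k::{finite,field}) qrep"
  assumes Y: "inj_level n Y" and X: "inj_level m X" and e: "\<not> ext_zero X Y"
  shows "m < n"
  using Y
proof cases
  case inj
  then show ?thesis using injective_ext_zero exceptional_wf[OF inj_level_exceptional[OF X]] e by blast
next
  case (tau n' N M f g)
  obtain \<xi> where ar: "ar_cocycle N Y \<xi>" using almost_split_cocycle[OF tau(3)] by blast
  have "\<not> hom_zero N X" using ar_ext_zero_right[OF ar exceptional_wf[OF inj_level_exceptional[OF X]]] e by blast
  then show ?thesis using inj_level_hom[OF tau(2) X] tau(1) by simp
qed

subsection \<open>Direct sum decompositions\<close>

definition tdim :: "('v, 'e, 'k) qrep \<Rightarrow> nat" where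
  "tdim X = (\<Sum>i\<in>V. rdim X i)"

lemma tdim_zero: "tdim X = 0 \<longleftrightarrow> is_zero_rep X"
  by (simp add: tdim_def is_zero_rep_def finite_V)

lemma hom_image_dim:
  fixes X :: "('v, 'e, 'k::{finite,field}) qrep"
  assumes "hom_inj X f" "i \<in> V" shows "vdim (f i ` kvec (rdim X i)) = rdim X i"
  using vdim_image[of "f i" "kvec (rdim X i)"] assms by (simp add: hom_inj_def)

lemma ses_dim:
  fixes X :: "('v, 'e, 'k::{finite,field}) qrep"
  assumes "ses A X C f g" "i \<in> V"
  shows "rdim X i = rdim A i + rdim C i"
proof -
  have f: "hom_inj A f" and g: "is_hom X C g" "hom_surj X C g"
    and ex: "{x \<in> kvec (rdim X i). g i x = 0} = f i ` kvec (rdim A i)"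
    using assms unfolding ses_def by auto
  have "rdim X i = vdim (g i ` kvec (rdim X i)) + vdim {x \<in> kvec (rdim X i). g i x = 0}"
    using vdim_rank_nullity[OF hom_lin[OF g(1) assms(2)] ksubspace_kvec] by simp
  then show ?thesis using g(2) assms(2) hom_image_dim[OF f assms(2)] unfolding ex hom_surj_def by simp
qed

lemma ses_tdim:
  fixes X :: "('v, 'e, 'k::{finite,field}) qrep"
  assumes "ses A X C f g" shows "tdim X = tdim A + tdim C"
  using ses_dim[OF assms] by (simp add: tdim_def sum.distrib)

lemma direct_summandI:
  "is_hom N X f \<Longrightarrow> is_hom X N r \<Longrightarrow> (\<And>i x. i \<in> V \<Longrightarrow> x \<in> kvec (rdim N i) \<Longrightarrow> r i (f i x) = x)
    \<Longrightarrow> direct_summand N X"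
  unfolding direct_summand_def hom_comp_eq_def hom_id_def by blast

lemma direct_summandE:
  assumes "direct_summand N X"
  obtains f r where "is_hom N X f" "is_hom X N r" "\<forall>i\<in>V. \<forall>x\<in>kvec (rdim N i). r i (f i x) = x"
  using assms unfolding direct_summand_def hom_comp_eq_def hom_id_def by (elim exE conjE)

lemma direct_summand_trans:
  assumes "direct_summand A B" "direct_summand B C" shows "direct_summand A C"
proof -
  obtain f r where f: "is_hom A B f" "is_hom B A r" "\<forall>i\<in>V. \<forall>x\<in>kvec (rdim A i). r i (f i x) = x"
    by (rule direct_summandE[OF assms(1)])
  obtain f' r' where f': "is_hom B C f'" "is_hom C B r'" "\<forall>i\<in>V. \<forall>x\<in>kvec (rdim B i). r' i (f' i x) = x"
    by (rule direct_summandE[OF assms(2)])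
  show ?thesis
    by (rule direct_summandI[OF hom_compose[OF f(1) f'(1)] hom_compose[OF f'(2) f(2)]])
      (use f(3) f'(3) hom_inI[OF f(1)] in simp)
qed

lemma direct_summand_refl: "direct_summand X X"
  by (rule direct_summandI[OF hom_identity hom_identity]) simp

text \<open>The complement is the kernel of the retraction \<open>r\<close>; the idempotent
  \<open>x - f i (r i x)\<close> maps into it and supplies the projection \<open>q\<close>.\<close>

lemma summand_complement:
  fixes X :: "('v, 'e, 'k::field) qrep"
  assumes f: "is_hom Y X f" "is_hom X Y r" "\<forall>i\<in>V. \<forall>x\<in>kvec (rdim Y i). r i (f i x) = x"
    and wf: "wf_rep X" "wf_rep Y"
  shows "\<exists>K j q. ses K X Y j r \<and> is_hom X K q \<and>
    (\<forall>i\<in>V. \<forall>x\<in>kvec (rdim K i). q i (j i x) = x) \<and>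
    (\<forall>i\<in>V. \<forall>x\<in>kvec (rdim X i). j i (q i x) + f i (r i x) = x)"
proof -
  from sub_exists[OF wf(1) subrep_kernel[OF f(2) wf]] obtain K j where K: "wf_rep K"
    and j: "is_hom K X j" "hom_inj K j"
    and im': "\<forall>i\<in>V. j i ` kvec (rdim K i) = (if i \<in> V then {x \<in> kvec (rdim X i). r i x = 0} else {0})"
    unfolding sub_iso_def by (elim exE conjE)
  have im: "j i ` kvec (rdim K i) = {x \<in> kvec (rdim X i). r i x = 0}" if "i \<in> V" for i
    using im' that by simp
  have "hom_surj X Y r" unfolding hom_surj_def
  proof (intro ballI equalityI subsetI)
    fix i and y :: "nat \<Rightarrow> 'k" assume i: "i \<in> V" and y: "y \<in> kvec (rdim Y i)"
    show "y \<in> r i ` kvec (rdim X i)"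
      by (rule image_eqI[OF _ hom_inI[OF f(1) i y]]) (use f(3) i y in simp)
  qed (use hom_inI[OF f(2)] in blast)
  then have ses: "ses K X Y j r" unfolding ses_def using K wf j f(2) im by simp
  let ?e = "\<lambda>i x. x - f i (r i x)"
  have e: "is_hom X X ?e"
  proof (rule is_homI)
    fix i assume i: "i \<in> V"
    show "lin_on (rdim X i) (rdim X i) (?e i)"
      by (rule lin_sub[OF lin_id lin_comp[OF hom_lin[OF f(2) i] hom_lin[OF f(1) i]]])
  next
    fix a and x :: "nat \<Rightarrow> 'k" assume a: "a \<in> E" and x: "x \<in> kvec (rdim X (src a))"
    have rx: "r (src a) x \<in> kvec (rdim Y (src a))" by (rule hom_inI[OF f(2) src_V[OF a] x])
    show "?e (tgt a) (rmap X a x) = rmap X a (?e (src a) x)"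
      using lin_diff[OF wf_lin[OF wf(1) a] x hom_inI[OF f(1) src_V[OF a] rx]]
        hom_comm[OF f(2) a x] hom_comm[OF f(1) a rx] by simp
  qed
  have "\<exists>q. is_hom X K q \<and> (\<forall>i\<in>V. \<forall>x\<in>kvec (rdim X i). j i (q i x) = ?e i x)"
  proof (rule hom_lift_inj[OF j e wf(1) K])
    fix i and x :: "nat \<Rightarrow> 'k" assume i: "i \<in> V" and x: "x \<in> kvec (rdim X i)"
    have rx: "r i x \<in> kvec (rdim Y i)" by (rule hom_inI[OF f(2) i x])
    have "r i (?e i x) = 0"
      using lin_diff[OF hom_lin[OF f(2) i] x hom_inI[OF f(1) i rx]] f(3) i rx by simp
    then show "?e i x \<in> j i ` kvec (rdim K i)" using im[OF i] hom_inI[OF e i x] by blast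
  qed
  then obtain q where q: "is_hom X K q" "\<forall>i\<in>V. \<forall>x\<in>kvec (rdim X i). j i (q i x) = ?e i x"
    by (elim exE conjE)
  have "q i (j i x) = x" if i: "i \<in> V" and x: "x \<in> kvec (rdim K i)" for i x
  proof -
    have jx: "j i x \<in> kvec (rdim X i)" by (rule hom_inI[OF j(1) i x])
    have "r i (j i x) = 0" using im[OF i] x by blast
    then have "j i (q i (j i x)) = j i x" using q(2) i jx lin_zero[OF hom_lin[OF f(1) i]] by simp
    then show ?thesis by (rule hom_injD[OF j(2) i _ hom_inI[OF q(1) i jx] x])
  qed
  moreover have "j i (q i x) + f i (r i x) = x" if "i \<in> V" "x \<in> kvec (rdim X i)" for i x
    using q(2) that by simp
  ultimately show ?thesis using ses q(1) by blast
qed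

text \<open>A decomposition of \<open>X\<close> into nonzero subrepresentations \<open>U\<close> and
  \<open>W\<close> yields a direct summand \<open>A\<close> realising \<open>U\<close>, of smaller
  total dimension because \<open>W\<close> is nonzero.\<close>

lemma indecomposable_summand_exists:
  fixes X :: "('v, 'e, 'k::{finite,field}) qrep"
  assumes "wf_rep X" "\<not> is_zero_rep X"
  shows "\<exists>Y. indecomposable Y \<and> direct_summand Y X"
  using assms
proof (induction "tdim X" arbitrary: X rule: less_induct)
  case less
  show ?case
  proof (cases "indecomposable X")
    case True
    then show ?thesis using direct_summand_refl by blast
  next
    case False
    with less.prems have "\<exists>U W. (subrep X U \<and> subrep X W \<and>
        (\<forall>i\<in>V. U i \<inter> W i = {0} \<and> {u + w | u w. u \<in> U i \<and> w \<in> W i} = kvec (rdim X i)))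
      \<and> \<not> ((\<forall>i\<in>V. U i = {0}) \<or> (\<forall>i\<in>V. W i = {0}))"
      by (simp only: indecomposable_def not_all not_imp simp_thms)
    then obtain U W where UW: "subrep X U" "subrep X W"
      "\<forall>i\<in>V. U i \<inter> W i = {0} \<and> {u + w | u w. u \<in> U i \<and> w \<in> W i} = kvec (rdim X i)"
      "\<not> (\<forall>i\<in>V. U i = {0})" "\<not> (\<forall>i\<in>V. W i = {0})"
      unfolding de_Morgan_disj by (elim exE conjE)
    from ses_exists[OF less.prems(1) UW(2)] obtain B C f g where ses: "ses B X C f g"
      and im: "\<forall>i\<in>V. f i ` kvec (rdim B i) = W i" by (elim exE conjE)
    from sub_exists[OF less.prems(1) UW(1)] obtain A h where A: "wf_rep A" and
      h: "is_hom A X h" "hom_inj A h" "\<forall>i\<in>V. h i ` kvec (rdim A i) = U i"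
      unfolding sub_iso_def by (elim exE conjE)
    have wfC: "wf_rep C" and g: "is_hom X C g" "hom_surj X C g"
      and ker: "\<And>i. i \<in> V \<Longrightarrow> {x \<in> kvec (rdim X i). g i x = 0} = W i"
      and fB: "is_hom B X f"
      using ses im unfolding ses_def by auto
    \<comment> \<open>The inclusion of \<open>U\<close> followed by the quotient map by
      \<open>W\<close> is an isomorphism because the two are complementary; its inverse after
      \<open>g\<close> is the retraction onto \<open>A\<close>.\<close>
    let ?m = "\<lambda>i x. g i (h i x)"
    have m: "is_hom A C ?m" by (rule hom_compose[OF h(1) g(1)])
    have minj: "hom_inj A ?m" unfolding hom_inj_def
    proof (intro ballI lin_inj[OF hom_lin[OF m]])
      fix i and x :: "nat \<Rightarrow> 'k" assume i: "i \<in> V" and x: "x \<in> kvec (rdim A i)" and z: "g i (h i x) = 0"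
      have "h i x \<in> W i" using ker[OF i] z hom_inI[OF h(1) i x] by blast
      moreover have "h i x \<in> U i" using h(3) i x by blast
      ultimately have "h i x \<in> {0}" using UW(3) i by blast
      then have "h i x = h i 0" using lin_zero[OF hom_lin[OF h(1) i]] by simp
      then show "x = 0" by (rule hom_injD[OF h(2) i _ x zero_in_kvec])
    qed
    have msurj: "hom_surj A C ?m" unfolding hom_surj_def
    proof (intro ballI equalityI subsetI)
      fix i and y :: "nat \<Rightarrow> 'k" assume i: "i \<in> V" and y: "y \<in> kvec (rdim C i)"
      obtain x where x: "x \<in> kvec (rdim X i)" "y = g i x" using hom_surjD[OF g(2) i y] by blast
      then obtain u w where uw: "x = u + w" "u \<in> U i" "w \<in> W i" using UW(3) i by blast
      obtain z where z: "z \<in> kvec (rdim A i)" "u = h i z" using h(3) i uw(2) by blast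
      have "w \<in> kvec (rdim X i)" "g i w = 0" using ker[OF i] uw(3) by blast+
      then have "y = g i (h i z)"
        using x(2) uw(1) z lin_add[OF hom_lin[OF g(1) i] hom_inI[OF h(1) i z(1)]] by simp
      then show "y \<in> ?m i ` kvec (rdim A i)" using z(1) by blast
    qed (use hom_inI[OF m] in blast)
    from hom_inverse[OF m minj msurj A wfC] obtain n where n: "is_hom C A n"
      "\<forall>i\<in>V. \<forall>x\<in>kvec (rdim A i). n i (g i (h i x)) = x" by (elim exE conjE)
    have AX: "direct_summand A X"
      by (rule direct_summandI[OF h(1) hom_compose[OF g(1) n(1)]]) (use n(2) in simp)
    have dimAC: "rdim A i = rdim C i" if i: "i \<in> V" for i
      using hom_image_dim[OF minj i] msurj i unfolding hom_surj_def by simp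
    have "\<not> is_zero_rep B"
    proof
      assume B: "is_zero_rep B"
      have "W i = {0}" if i: "i \<in> V" for i
        using im[rule_format, OF i] i B lin_zero[OF hom_lin[OF fB i]]
        by (metis image_empty image_insert is_zero_rep_def kvec_0)
      then show False using UW(5) by blast
    qed
    then have "tdim A < tdim X"
      using ses_tdim[OF ses] dimAC tdim_zero[of B] by (simp add: tdim_def)
    moreover have "\<not> is_zero_rep A"
    proof
      assume A: "is_zero_rep A"
      have "U i = {0}" if i: "i \<in> V" for i
        using h(3)[rule_format, OF i] i A lin_zero[OF hom_lin[OF h(1) i]]
        by (metis image_empty image_insert is_zero_rep_def kvec_0)
      then show False using UW(4) by blast
    qed
    ultimately obtain Y where "indecomposable Y" "direct_summand Y A"
      using less.hyps[of A] A by blast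
    then show ?thesis using direct_summand_trans[OF _ AX] by blast
  qed
qed

lemma ext_zero_zero_left: "is_zero_rep X \<Longrightarrow> wf_rep Y \<Longrightarrow> ext_zero X Y"
  unfolding ext_zero_def
  by (intro allI impI, rule cobound_cong[OF cobound_zero])
    (auto simp: is_zero_rep_def src_V lin_zero[OF cocycle_lin])

lemma ext_zero_zero_right: "is_zero_rep X \<Longrightarrow> wf_rep X \<Longrightarrow> ext_zero Y X"
  unfolding ext_zero_def
proof (intro allI impI)
  fix c assume X: "is_zero_rep X" "wf_rep X" and c: "cocycle Y X c"
  show "cobound Y X c"
    by (rule cobound_cong[OF cobound_zero[OF X(2)]])
      (use lin_in[OF cocycle_lin[OF c]] X(1) tgt_V in \<open>simp add: is_zero_rep_def\<close>)
qed

text \<open>Additivity of Ext, splitting off one indecomposable summand \<open>Z\<close> at a time.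
  Summands of its complement \<open>K\<close> are summands of \<open>X\<close>, so the hypothesis
  passes to \<open>K\<close>; the two projections reassemble a cocycle from its parts.\<close>

lemma ext_zero_summands:
  fixes X Y :: "('v, 'e, 'k::{finite,field}) qrep"
  assumes Y: "wf_rep Y" and X: "wf_rep X"
  shows "(\<And>Z. indecomposable Z \<Longrightarrow> direct_summand Z X \<Longrightarrow> ext_zero Y Z) \<Longrightarrow> ext_zero Y X"
    and "(\<And>Z. indecomposable Z \<Longrightarrow> direct_summand Z X \<Longrightarrow> ext_zero Z Y) \<Longrightarrow> ext_zero X Y"
proof -
  have "((\<forall>Z. indecomposable Z \<and> direct_summand Z X \<longrightarrow> ext_zero Y Z) \<longrightarrow> ext_zero Y X) \<and>
    ((\<forall>Z. indecomposable Z \<and> direct_summand Z X \<longrightarrow> ext_zero Z Y) \<longrightarrow> ext_zero X Y)"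
    using X
  proof (induction "tdim X" arbitrary: X rule: less_induct)
    case less
    show ?case
    proof (cases "is_zero_rep X")
      case True
      then show ?thesis using ext_zero_zero_left ext_zero_zero_right less.prems Y by blast
    next
      case False
      then obtain Z where Z: "indecomposable Z" "direct_summand Z X"
        using indecomposable_summand_exists[OF less.prems] by blast
      have wZ: "wf_rep Z" using Z(1) by (simp add: indecomposable_def)
      obtain f r where f: "is_hom Z X f" "is_hom X Z r" "\<forall>i\<in>V. \<forall>x\<in>kvec (rdim Z i). r i (f i x) = x"
        by (rule direct_summandE[OF Z(2)])
      from summand_complement[OF f less.prems wZ] obtain K j q where ses: "ses K X Z j r"
        and q: "is_hom X K q" "\<forall>i\<in>V. \<forall>x\<in>kvec (rdim K i). q i (j i x) = x"
          "\<forall>i\<in>V. \<forall>x\<in>kvec (rdim X i). j i (q i x) + f i (r i x) = x"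
        by (elim exE conjE)
      have K: "wf_rep K" and j: "is_hom K X j" using ses by (auto simp: ses_def)
      have KX: "direct_summand K X" by (rule direct_summandI[OF j q(1)]) (use q(2) in blast)
      have "tdim Z \<noteq> 0" using Z(1) by (simp add: tdim_zero indecomposable_def)
      then have lt: "tdim K < tdim X" using ses_tdim[OF ses] by simp
      note IH = less.hyps[OF lt K]
      have sub: "direct_summand Z' X" if "direct_summand Z' K" for Z' :: "('v, 'e, 'k) qrep"
        using direct_summand_trans[OF that KX] .
      show ?thesis
      proof (intro conjI impI)
        assume *: "\<forall>Z. indecomposable Z \<and> direct_summand Z X \<longrightarrow> ext_zero Y Z"
        have eK: "ext_zero Y K" using IH * sub by blast
        have eZ: "ext_zero Y Z" using * Z by blast
        show "ext_zero Y X" unfolding ext_zero_def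
        proof (intro allI impI)
          fix c assume c: "cocycle Y X c"
          have 1: "cobound Y K (\<lambda>a x. q (tgt a) (c a x))"
            using eK cocycle_post[OF c q(1)] unfolding ext_zero_def by blast
          have 2: "cobound Y Z (\<lambda>a x. r (tgt a) (c a x))"
            using eZ cocycle_post[OF c f(2)] unfolding ext_zero_def by blast
          show "cobound Y X c"
            by (rule cobound_cong[OF cobound_add[OF cobound_post[OF 1 j Y K]
                    cobound_post[OF 2 f(1) Y wZ] Y less.prems]])
              (use q(3) tgt_V lin_in[OF cocycle_lin[OF c]] in simp)
        qed
      next
        assume *: "\<forall>Z. indecomposable Z \<and> direct_summand Z X \<longrightarrow> ext_zero Z Y"
        have eK: "ext_zero K Y" using IH * sub by blast
        have eZ: "ext_zero Z Y" using * Z by blast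
        show "ext_zero X Y" unfolding ext_zero_def
        proof (intro allI impI)
          fix c assume c: "cocycle X Y c"
          have 1: "cobound K Y (\<lambda>a x. c a (j (src a) x))"
            using eK cocycle_pre[OF c j] unfolding ext_zero_def by blast
          have 2: "cobound Z Y (\<lambda>a x. c a (f (src a) x))"
            using eZ cocycle_pre[OF c f(1)] unfolding ext_zero_def by blast
          show "cobound X Y c"
          proof (rule cobound_cong[OF cobound_add[OF cobound_pre[OF 1 q(1)] cobound_pre[OF 2 f(2)] less.prems Y]])
            fix a and x :: "nat \<Rightarrow> 'k" assume a: "a \<in> E" and x: "x \<in> kvec (rdim X (src a))"
            note s = src_V[OF a]
            show "c a x = c a (j (src a) (q (src a) x)) + c a (f (src a) (r (src a) x))"
              using lin_add[OF cocycle_lin[OF c a] hom_inI[OF j s hom_inI[OF q(1) s x]]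
                  hom_inI[OF f(1) s hom_inI[OF f(2) s x]]] q(3) s x by simp
          qed
        qed
      qed
    qed
  qed
  then show "(\<And>Z. indecomposable Z \<Longrightarrow> direct_summand Z X \<Longrightarrow> ext_zero Y Z) \<Longrightarrow> ext_zero Y X"
    and "(\<And>Z. indecomposable Z \<Longrightarrow> direct_summand Z X \<Longrightarrow> ext_zero Z Y) \<Longrightarrow> ext_zero X Y"
    by blast+
qed

subsection \<open>Characteristic functions in the Hall algebra\<close>

definition rep_of :: "('v, 'e, 'k::field) qrep set \<Rightarrow> ('v, 'e, 'k) qrep" where
  "rep_of c = (SOME X. X \<in> c)"

definition iso_closed :: "('v, 'e, 'k::field) qrep set \<Rightarrow> bool" where
  "iso_closed \<A> \<longleftrightarrow> (\<forall>X\<in>\<A>. wf_rep X \<and> (\<forall>Y. wf_rep Y \<and> rep_iso X Y \<longrightarrow> Y \<in> \<A>))"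

definition chi :: "('v, 'e, 'k::field) qrep set \<Rightarrow> ('v, 'e, 'k) qrep set \<Rightarrow> rat" where
  "chi \<A> = (\<lambda>c. if c \<in> iso_class ` \<A> then 1 else 0)"

definition reps :: "('v \<Rightarrow> nat) \<Rightarrow> ('v, 'e, 'k::field) qrep set" where
  "reps d = {X. wf_rep X \<and> rdim X = d}"

text \<open>Set to 0 off \<open>V\<close>, so that it can be compared with \<open>rdim\<close> as a
  function on all vertices.\<close>

definition sdim :: "('v \<Rightarrow> (nat \<Rightarrow> 'k::{finite,field}) set) \<Rightarrow> 'v \<Rightarrow> nat" where
  "sdim U i = (if i \<in> V then vdim (U i) else 0)"

lemma rep_of_class:
  assumes "c \<in> iso_classes"
  shows "wf_rep (rep_of c)" "iso_class (rep_of c) = c"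
proof -
  obtain X where X: "wf_rep X" "c = iso_class X" using assms unfolding iso_classes_def by blast
  have "rep_of c \<in> c" unfolding rep_of_def X(2) using iso_class_self[OF X(1)] by (rule someI)
  then have "wf_rep (rep_of c)" "rep_iso X (rep_of c)" unfolding X(2) iso_class_def by auto
  then show "wf_rep (rep_of c)" "iso_class (rep_of c) = c"
    using iso_class_eq_iff[OF X(1)] X(2) by auto
qed

lemma rep_of_iso: "wf_rep X \<Longrightarrow> rep_iso X (rep_of (iso_class X))"
  using rep_of_class[OF iso_class_in] iso_class_eq_iff by metis

lemma iso_closed_class: "wf_rep X \<Longrightarrow> iso_closed (iso_class X)"
  unfolding iso_closed_def iso_class_def using rep_iso_trans by blast

lemma chi_iff:
  assumes "iso_closed \<A>"
  shows "chi \<A> c = (if c \<in> iso_classes \<and> rep_of c \<in> \<A> then 1 else 0)"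
proof -
  have "c \<in> iso_class ` \<A> \<longleftrightarrow> c \<in> iso_classes \<and> rep_of c \<in> \<A>"
  proof
    assume "c \<in> iso_class ` \<A>"
    then obtain X where X: "X \<in> \<A>" "c = iso_class X" by blast
    then have "wf_rep X" using assms unfolding iso_closed_def by blast
    then show "c \<in> iso_classes \<and> rep_of c \<in> \<A>"
      using X assms rep_of_iso rep_of_class(1) iso_class_in unfolding iso_closed_def by blast
  next
    assume c: "c \<in> iso_classes \<and> rep_of c \<in> \<A>"
    then have "iso_class (rep_of c) = c" using rep_of_class(2) by blast
    then show "c \<in> iso_class ` \<A>" using c by (metis imageI)
  qed
  then show ?thesis by (simp add: chi_def)
qed

lemma chi_iso_class: "wf_rep X \<Longrightarrow> chi (iso_class X) = hall_basis (iso_class X)"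
proof -
  assume X: "wf_rep X"
  have "iso_class ` iso_class X = {iso_class X}"
  proof (intro equalityI subsetI)
    fix c assume "c \<in> iso_class ` iso_class X"
    then obtain Y where Y: "Y \<in> iso_class X" "c = iso_class Y" by blast
    then have "wf_rep Y" "rep_iso X Y" by (auto simp: iso_class_def)
    then have "iso_class X = iso_class Y" using iso_class_eq_iff[OF X] by blast
    then show "c \<in> {iso_class X}" using Y(2) by simp
  qed (use iso_class_self[OF X] in blast)
  then show ?thesis by (auto simp: chi_def hall_basis_def)
qed

lemma rep_iso_dim:
  fixes X Y :: "('v, 'e, 'k::{finite,field}) qrep"
  assumes "rep_iso X Y" "wf_rep X" "wf_rep Y" shows "rdim X = rdim Y"
proof
  fix i
  obtain f where f: "hom_inj X f" "hom_surj X Y f" using assms(1) unfolding rep_iso_def by blast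
  show "rdim X i = rdim Y i"
  proof (cases "i \<in> V")
    case True
    then show ?thesis using hom_image_dim[OF f(1) True] f(2) unfolding hom_surj_def by simp
  next
    case False
    then show ?thesis using wf_rdim[OF assms(2)] wf_rdim[OF assms(3)] by simp
  qed
qed

lemma iso_closed_reps: "iso_closed (reps d :: ('v, 'e, 'k::{finite,field}) qrep set)"
  unfolding iso_closed_def reps_def using rep_iso_dim by fastforce

lemma iso_class_self_map:
  assumes "wf_rep X" "wf_rep Y" "rdim X = rdim Y"
    "\<And>a x. a \<in> E \<Longrightarrow> x \<in> kvec (rdim X (src a)) \<Longrightarrow> rmap X a x = rmap Y a x"
  shows "iso_class X = iso_class Y"
proof -
  have "is_hom X Y (\<lambda>i x. x)" by (rule is_homI) (use assms lin_id in auto)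
  then have "rep_iso X Y" unfolding rep_iso_def hom_inj_def hom_surj_def using assms(3)
    by (intro exI[of _ "\<lambda>i x. x"]) auto
  then show ?thesis using iso_class_eq_iff assms by blast
qed

lemma finite_classes: "finite (iso_class ` (reps d :: ('v, 'e, 'k::{finite,field}) qrep set))"
proof (rule finite_subset)
  let ?M = "PiE E (\<lambda>a. lins (d (src a)) (d (tgt a)) :: ((nat \<Rightarrow> 'k) \<Rightarrow> nat \<Rightarrow> 'k) set)"
  show "finite ((\<lambda>m. iso_class \<lparr>rdim = d, rmap = m\<rparr>) ` ?M)"
    by (intro finite_imageI finite_PiE finite_E) simp
  show "iso_class ` (reps d :: ('v, 'e, 'k) qrep set) \<subseteq> (\<lambda>m. iso_class \<lparr>rdim = d, rmap = m\<rparr>) ` ?M"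
  proof
    fix c :: "('v, 'e, 'k) qrep set" assume "c \<in> iso_class ` reps d"
    then obtain X where X: "wf_rep X" "rdim X = d" "c = iso_class X" by (auto simp: reps_def)
    let ?m = "\<lambda>a\<in>E. restrict (rmap X a) (kvec (d (src a)))"
    have m: "lin_on (d (src a)) (d (tgt a)) (restrict (rmap X a) (kvec (d (src a))))" if "a \<in> E" for a
      by (rule lin_cong[OF wf_lin[OF X(1) that, unfolded X(2)]]) simp
    then have "?m \<in> ?M" by (auto simp: lins_def)
    moreover have "wf_rep \<lparr>rdim = d, rmap = ?m\<rparr>"
      using m X by (auto simp: wf_rep_def)
    then have "c = iso_class \<lparr>rdim = d, rmap = ?m\<rparr>"
      unfolding X(3) by (intro iso_class_self_map X) (simp_all add: X(2))
    ultimately show "c \<in> (\<lambda>m. iso_class \<lparr>rdim = d, rmap = m\<rparr>) ` ?M" by blast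
  qed
qed

lemma finite_subreps:
  fixes X :: "('v, 'e, 'k::{finite,field}) qrep"
  assumes "wf_rep X" shows "finite {U. subrep X U}"
proof (rule finite_subset)
  let ?B = "Pow (\<Union>i\<in>V. kvec (rdim X i) :: (nat \<Rightarrow> 'k) set)"
  show "finite {U. \<forall>i. (i \<in> V \<longrightarrow> U i \<in> ?B) \<and> (i \<notin> V \<longrightarrow> U i = {0 :: nat \<Rightarrow> 'k})}"
    by (rule finite_set_of_finite_funs) (simp_all add: finite_V)
  show "{U. subrep X U} \<subseteq> {U. \<forall>i. (i \<in> V \<longrightarrow> U i \<in> ?B) \<and> (i \<notin> V \<longrightarrow> U i = {0 :: nat \<Rightarrow> 'k})}"
  proof (intro subsetI CollectI allI conjI impI)
    fix U i assume "U \<in> {U. subrep X U}"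
    then have U: "subrep X U" by simp
    show "U i \<in> ?B" if "i \<in> V" using ksubspaceD(1)[OF subrep_sub[OF U, of i]] that by blast
    show "U i = {0}" if "i \<notin> V" by (rule subrep_outside[OF assms U that])
  qed
qed

lemma hall_number_eq: "hall_number X M N = card {U. subrep X U \<and> sub_iso X U N \<and> quo_iso X U M}"
  by (simp add: hall_number_def sub_iso_def quo_iso_def)

text \<open>The subrepresentations counted by the separate Hall numbers are collected: each belongs
  to exactly one pair of classes, that of its quotient and its own. The double sum thus becomes the
  size of a single set.\<close>

lemma hall_mult_chi:
  fixes \<A> \<B> :: "('v, 'e, 'k::{finite,field}) qrep set"
  assumes iso: "iso_closed \<A>" "iso_closed \<B>" and dim: "\<A> \<subseteq> reps d" "\<B> \<subseteq> reps e"
    and c: "c \<in> iso_classes"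
  shows "hall_mult (chi \<A>) (chi \<B>) c = of_nat (card {U. subrep (rep_of c) U \<and>
    (\<exists>B\<in>\<B>. sub_iso (rep_of c) U B) \<and> (\<exists>A\<in>\<A>. quo_iso (rep_of c) U A)})"
proof -
  let ?X = "rep_of c"
  let ?IA = "iso_class ` \<A>" and ?IB = "iso_class ` \<B>"
  let ?S = "\<lambda>p. {U. subrep ?X U \<and> sub_iso ?X U (rep_of (snd p)) \<and> quo_iso ?X U (rep_of (fst p))}"
  have X: "wf_rep ?X" by (rule rep_of_class(1)[OF c])
  have fin: "finite ?IA" "finite ?IB"
    using finite_subset[OF image_mono[OF dim(1)] finite_classes]
      finite_subset[OF image_mono[OF dim(2)] finite_classes] .
  have supp: "{A. chi \<A> A \<noteq> 0} = ?IA" "{B. chi \<B> B \<noteq> 0} = ?IB" by (auto simp: chi_def)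
  have wfA: "wf_rep A" if "A \<in> \<A>" for A using iso(1) that unfolding iso_closed_def by blast
  have wfB: "wf_rep B" if "B \<in> \<B>" for B using iso(2) that unfolding iso_closed_def by blast
  have rA: "rep_of a \<in> \<A>" "wf_rep (rep_of a)" "iso_class (rep_of a) = a" if a: "a \<in> ?IA" for a
  proof -
    obtain A where A: "A \<in> \<A>" "a = iso_class A" using a by blast
    note w = wfA[OF A(1)]
    show "wf_rep (rep_of a)" "iso_class (rep_of a) = a" using rep_of_class iso_class_in[OF w] A(2) by auto
    then show "rep_of a \<in> \<A>" using rep_of_iso[OF w] iso(1) A unfolding iso_closed_def by blast
  qed
  have rB: "rep_of b \<in> \<B>" "wf_rep (rep_of b)" "iso_class (rep_of b) = b" if b: "b \<in> ?IB" for b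
  proof -
    obtain B where B: "B \<in> \<B>" "b = iso_class B" using b by blast
    note w = wfB[OF B(1)]
    show "wf_rep (rep_of b)" "iso_class (rep_of b) = b" using rep_of_class iso_class_in[OF w] B(2) by auto
    then show "rep_of b \<in> \<B>" using rep_of_iso[OF w] iso(2) B unfolding iso_closed_def by blast
  qed
  have "hall_mult (chi \<A>) (chi \<B>) c =
      (\<Sum>a\<in>?IA. \<Sum>b\<in>?IB. chi \<A> a * chi \<B> b * of_nat (hall_number ?X (rep_of a) (rep_of b)))"
    unfolding hall_mult_def supp rep_of_def using c by simp
  also have "\<dots> = (\<Sum>a\<in>?IA. \<Sum>b\<in>?IB. of_nat (hall_number ?X (rep_of a) (rep_of b)))"
    by (intro sum.cong refl) (simp add: chi_def)
  also have "\<dots> = (\<Sum>p\<in>?IA \<times> ?IB. of_nat (card (?S p)))"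
    unfolding hall_number_eq by (simp add: sum.cartesian_product split_beta)
  also have "\<dots> = of_nat (\<Sum>p\<in>?IA \<times> ?IB. card (?S p))" by simp
  also have "(\<Sum>p\<in>?IA \<times> ?IB. card (?S p)) = card (\<Union>p\<in>?IA \<times> ?IB. ?S p)"
  proof (rule card_UN_disjoint[symmetric])
    show "finite (?IA \<times> ?IB)" using fin by simp
    show "\<forall>p\<in>?IA \<times> ?IB. finite (?S p)"
      using finite_subset[OF _ finite_subreps[OF X]] by (metis (no_types, lifting) Collect_mono)
    show "\<forall>p\<in>?IA \<times> ?IB. \<forall>q\<in>?IA \<times> ?IB. p \<noteq> q \<longrightarrow> ?S p \<inter> ?S q = {}"
    proof (intro ballI impI, rule ccontr)
      fix p q assume p: "p \<in> ?IA \<times> ?IB" and q: "q \<in> ?IA \<times> ?IB" and ne: "p \<noteq> q"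
        and "?S p \<inter> ?S q \<noteq> {}"
      then obtain U where U: "sub_iso ?X U (rep_of (snd p))" "quo_iso ?X U (rep_of (fst p))"
        "sub_iso ?X U (rep_of (snd q))" "quo_iso ?X U (rep_of (fst q))" by blast
      have pq: "fst p \<in> ?IA" "snd p \<in> ?IB" "fst q \<in> ?IA" "snd q \<in> ?IB" using p q by auto
      have "rep_iso (rep_of (snd p)) (rep_of (snd q))"
        by (rule sub_iso_unique[OF U(1,3) rB(2)[OF pq(2)] rB(2)[OF pq(4)]])
      then have "snd p = snd q"
        using iso_class_eq_iff[OF rB(2)[OF pq(2)] rB(2)[OF pq(4)]] rB(3)[OF pq(2)] rB(3)[OF pq(4)] by simp
      moreover have "rep_iso (rep_of (fst p)) (rep_of (fst q))"
        by (rule quo_iso_unique[OF U(2,4) X rA(2)[OF pq(1)] rA(2)[OF pq(3)]])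
      then have "fst p = fst q"
        using iso_class_eq_iff[OF rA(2)[OF pq(1)] rA(2)[OF pq(3)]] rA(3)[OF pq(1)] rA(3)[OF pq(3)] by simp
      ultimately show False using ne by (simp add: prod_eq_iff)
    qed
  qed
  also have "(\<Union>p\<in>?IA \<times> ?IB. ?S p) =
      {U. subrep ?X U \<and> (\<exists>B\<in>\<B>. sub_iso ?X U B) \<and> (\<exists>A\<in>\<A>. quo_iso ?X U A)}" (is "?L = ?R")
  proof (intro equalityI subsetI)
    fix U assume "U \<in> ?L"
    then obtain a b where ab: "a \<in> ?IA" "b \<in> ?IB" "U \<in> ?S (a, b)" by blast
    then show "U \<in> ?R" using rA(1)[OF ab(1)] rB(1)[OF ab(2)] by auto
  next
    fix U assume "U \<in> ?R"
    then obtain A B where U: "subrep ?X U" "A \<in> \<A>" "B \<in> \<B>" "sub_iso ?X U B" "quo_iso ?X U A" by blast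
    have "sub_iso ?X U (rep_of (iso_class B))"
      by (rule sub_iso_cong[OF U(4) rep_iso_sym[OF rep_of_iso[OF wfB[OF U(3)]] wfB[OF U(3)]
            rB(2)[OF imageI[OF U(3)]]]])
    moreover have "quo_iso ?X U (rep_of (iso_class A))"
      by (rule quo_iso_cong[OF U(5) rep_of_iso[OF wfA[OF U(2)]]])
    ultimately have "U \<in> ?S (iso_class A, iso_class B)" using U(1) by simp
    then show "U \<in> ?L" using U(2,3) by blast
  qed
  finally show ?thesis .
qed

lemma hall_mult_outside: "c \<notin> iso_classes \<Longrightarrow> hall_mult x y c = 0"
  by (simp add: hall_mult_def)

lemma sub_iso_dim:
  fixes X :: "('v, 'e, 'k::{finite,field}) qrep"
  assumes "sub_iso X U B" "wf_rep B" shows "rdim B = sdim U"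
proof
  fix i
  obtain f where f: "hom_inj B f" "\<forall>i\<in>V. f i ` kvec (rdim B i) = U i"
    using assms(1) unfolding sub_iso_def by blast
  show "rdim B i = sdim U i"
  proof (cases "i \<in> V")
    case True
    then show ?thesis using hom_image_dim[OF f(1) True] f(2) by (simp add: sdim_def)
  next
    case False
    then show ?thesis using wf_rdim[OF assms(2)] by (simp add: sdim_def)
  qed
qed

lemma quo_iso_dim:
  fixes X :: "('v, 'e, 'k::{finite,field}) qrep"
  assumes "quo_iso X U A" "wf_rep A" "wf_rep X" shows "rdim X i = sdim U i + rdim A i"
proof (cases "i \<in> V")
  case True
  obtain g where g: "is_hom X A g" "hom_surj X A g" "\<forall>i\<in>V. {x \<in> kvec (rdim X i). g i x = 0} = U i"
    using assms(1) unfolding quo_iso_def by blast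
  show ?thesis
    using vdim_rank_nullity[OF hom_lin[OF g(1) True] ksubspace_kvec] g(2,3) True
    unfolding hom_surj_def by (simp add: sdim_def)
next
  case False
  then show ?thesis using wf_rdim[OF assms(2)] wf_rdim[OF assms(3)] by (simp add: sdim_def)
qed

lemma sdim_mono: "subrep X U \<Longrightarrow> subrep X W \<Longrightarrow> U \<le> W \<Longrightarrow> sdim U i \<le> sdim W i"
  by (simp add: sdim_def le_fun_def vdim_mono[OF subrep_sub subrep_sub])

lemma sdim_full: "wf_rep X \<Longrightarrow> sdim (\<lambda>i. kvec (rdim X i)) = rdim X"
  by (auto simp: sdim_def wf_rdim)

lemma sdim_eq:
  fixes X :: "('v, 'e, 'k::{finite,field}) qrep"
  assumes X: "wf_rep X" and U: "subrep X U" "subrep X W" "U \<le> W" and d: "\<And>i. i \<in> V \<Longrightarrow> sdim W i \<le> sdim U i"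
  shows "U = W"
proof
  fix i
  show "U i = W i"
  proof (cases "i \<in> V")
    case True
    then show ?thesis using vdim_eq[OF subrep_sub[OF U(1)] subrep_sub[OF U(2)]] U(3) d[OF True]
      by (simp add: le_fun_def sdim_def)
  next
    case False
    then show ?thesis using subrep_outside[OF X] U by blast
  qed
qed

lemma subrep_le_full: "subrep X U \<Longrightarrow> U \<le> (\<lambda>i. kvec (rdim X i))"
  unfolding le_fun_def using ksubspaceD(1)[OF subrep_sub] by blast

subsection \<open>Subalgebras\<close>

lemma hall_subalg_zero: "(\<lambda>c. 0) \<in> hall_subalg G"
  using hall_subalg.smult[OF hall_subalg.one, of 0] by simp

lemma hall_subalg_sum:
  "finite I \<Longrightarrow> (\<And>i. i \<in> I \<Longrightarrow> x i \<in> hall_subalg G) \<Longrightarrow> (\<lambda>c. \<Sum>i\<in>I. x i c) \<in> hall_subalg G"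
proof (induction rule: finite_induct)
  case empty
  then show ?case using hall_subalg_zero by simp
next
  case (insert i F)
  then have "(\<lambda>c. x i c + (\<Sum>i\<in>F. x i c)) \<in> hall_subalg G" by (intro hall_subalg.add) auto
  then show ?case using insert by simp
qed

lemma hall_subalg_diff:
  assumes "x \<in> hall_subalg G" "y \<in> hall_subalg G" shows "(\<lambda>c. x c - y c) \<in> hall_subalg G"
  using hall_subalg.add[OF assms(1) hall_subalg.smult[OF assms(2), of "-1"]] by simp

lemma hall_subalg_scale_cancel:
  assumes "x \<in> hall_subalg G" "q \<noteq> 0" "x = (\<lambda>c. q * y c)" shows "y \<in> hall_subalg G"
  using hall_subalg.smult[OF assms(1), of "inverse q"] assms(2,3) by (simp add: field_simps)

lemma hall_subalg_least:
  assumes "\<And>c. c \<in> G \<Longrightarrow> hall_basis c \<in> hall_subalg H"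
  shows "hall_subalg G \<subseteq> hall_subalg H"
proof
  fix x assume "x \<in> hall_subalg G"
  then show "x \<in> hall_subalg H" by induction (auto intro: assms hall_subalg.intros)
qed

section \<open>Extensions with vanishing Ext and the Hall product\<close>

text \<open>Both sequences split. The isomorphism sends the \<open>B\<close> and \<open>A\<close>
  components of a vector of \<open>X\<close> to \<open>X'\<close> by the embedding \<open>f'\<close>
  and the section \<open>s'\<close>.\<close>

lemma ses_iso:
  fixes X :: "('v, 'e, 'k::field) qrep"
  assumes s1: "ses B X A f g" and s2: "ses B X' A f' g'" and e: "ext_zero A B"
  shows "rep_iso X X'"
proof -
  have wf: "wf_rep B" "wf_rep X" "wf_rep A" "wf_rep X'"
    and f: "is_hom B X f" "hom_inj B f" and g: "is_hom X A g" "hom_surj X A g"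
    and ex: "\<And>i. i \<in> V \<Longrightarrow> {x \<in> kvec (rdim X i). g i x = 0} = f i ` kvec (rdim B i)"
    and f': "is_hom B X' f'" "hom_inj B f'" and g': "is_hom X' A g'" "hom_surj X' A g'"
    and ex': "\<And>i. i \<in> V \<Longrightarrow> {x \<in> kvec (rdim X' i). g' i x = 0} = f' i ` kvec (rdim B i)"
    using s1 s2 unfolding ses_def by auto
  obtain s where s: "is_hom A X s" "\<forall>i\<in>V. \<forall>y\<in>kvec (rdim A i). g i (s i y) = y"
    using ses_split[OF s1 e] by (elim exE conjE)
  obtain s' where s': "is_hom A X' s'" "\<forall>i\<in>V. \<forall>y\<in>kvec (rdim A i). g' i (s' i y) = y"
    using ses_split[OF s2 e] by (elim exE conjE)
  \<comment> \<open>Used with \<open>s\<close> as embedding and \<open>g\<close> as retraction. The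
    complement \<open>K\<close> is the kernel of \<open>g\<close>, which is also the image of
    \<open>f\<close>; \<open>t\<close> identifies it with \<open>B\<close>, giving the projection
    \<open>r\<close> onto \<open>B\<close>.\<close>
  from summand_complement[OF s(1) g(1) s(2) wf(2,3)] obtain K j q where ses: "ses K X A j g"
    and q: "is_hom X K q" "\<forall>i\<in>V. \<forall>x\<in>kvec (rdim K i). q i (j i x) = x"
      "\<forall>i\<in>V. \<forall>x\<in>kvec (rdim X i). j i (q i x) + s i (g i x) = x"
    by (elim exE conjE)
  have K: "wf_rep K" and j: "is_hom K X j" "hom_inj K j"
    and exK: "\<And>i. i \<in> V \<Longrightarrow> {x \<in> kvec (rdim X i). g i x = 0} = j i ` kvec (rdim K i)"
    using ses unfolding ses_def by auto
  have "\<exists>t. is_hom K B t \<and> (\<forall>i\<in>V. \<forall>x\<in>kvec (rdim K i). f i (t i x) = j i x)"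
    by (rule hom_lift_inj[OF f j(1) K wf(1)]) (use ex exK in blast)
  then obtain t where t: "is_hom K B t" "\<forall>i\<in>V. \<forall>x\<in>kvec (rdim K i). f i (t i x) = j i x"
    by (elim exE conjE)
  define r where "r i x = t i (q i x)" for i x
  have r: "is_hom X B r" unfolding r_def by (rule hom_compose[OF q(1) t(1)])
  have fr: "f i (r i x) + s i (g i x) = x" if "i \<in> V" "x \<in> kvec (rdim X i)" for i x
    using t(2) q(3) hom_inI[OF q(1)] that by (simp add: r_def)
  let ?h = "\<lambda>i x. f' i (r i x) + s' i (g i x)"
  have h: "is_hom X X' ?h"
  proof (rule is_homI)
    fix i assume i: "i \<in> V"
    show "lin_on (rdim X i) (rdim X' i) (?h i)"
      by (rule lin_plus[OF hom_lin[OF hom_compose[OF r f'(1)] i] hom_lin[OF hom_compose[OF g(1) s'(1)] i]])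
  next
    fix a and x :: "nat \<Rightarrow> 'k" assume a: "a \<in> E" and x: "x \<in> kvec (rdim X (src a))"
    note st = src_V[OF a]
    have k: "r (src a) x \<in> kvec (rdim B (src a))" "g (src a) x \<in> kvec (rdim A (src a))"
      using hom_inI[OF r st x] hom_inI[OF g(1) st x] .
    show "?h (tgt a) (rmap X a x) = rmap X' a (?h (src a) x)"
      using hom_comm[OF r a x] hom_comm[OF g(1) a x] hom_comm[OF f'(1) a k(1)] hom_comm[OF s'(1) a k(2)]
        lin_add[OF wf_lin[OF wf(4) a] hom_inI[OF f'(1) st k(1)] hom_inI[OF s'(1) st k(2)]] by simp
  qed
  have g'h: "g' i (?h i x) = g i x" if i: "i \<in> V" and x: "x \<in> kvec (rdim X i)" for i x
  proof -
    have k: "r i x \<in> kvec (rdim B i)" "g i x \<in> kvec (rdim A i)" using hom_inI[OF r i x] hom_inI[OF g(1) i x] .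
    have "g' i (f' i (r i x)) = 0" using ex'[OF i] k(1) by blast
    then show ?thesis
      using lin_add[OF hom_lin[OF g'(1) i] hom_inI[OF f'(1) i k(1)] hom_inI[OF s'(1) i k(2)]] s'(2) i k(2) by simp
  qed
  have "hom_inj X ?h" unfolding hom_inj_def
  proof (intro ballI lin_inj[OF hom_lin[OF h]])
    fix i and x :: "nat \<Rightarrow> 'k" assume i: "i \<in> V" and x: "x \<in> kvec (rdim X i)" and z: "?h i x = 0"
    have gx: "g i x = 0" using g'h[OF i x] lin_zero[OF hom_lin[OF g'(1) i]] unfolding z by simp
    then have "f' i (r i x) = f' i 0"
      using z lin_zero[OF hom_lin[OF s'(1) i]] lin_zero[OF hom_lin[OF f'(1) i]] by simp
    then have "r i x = 0" by (rule hom_injD[OF f'(2) i _ hom_inI[OF r i x] zero_in_kvec])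
    then show "x = 0"
      using fr[OF i x] gx lin_zero[OF hom_lin[OF s(1) i]] lin_zero[OF hom_lin[OF f(1) i]] by simp
  qed
  moreover have "hom_surj X X' ?h" unfolding hom_surj_def
  proof (intro ballI equalityI subsetI)
    fix i and y :: "nat \<Rightarrow> 'k" assume i: "i \<in> V" and y: "y \<in> kvec (rdim X' i)"
    have gy: "g' i y \<in> kvec (rdim A i)" by (rule hom_inI[OF g'(1) i y])
    have sy: "s' i (g' i y) \<in> kvec (rdim X' i)" by (rule hom_inI[OF s'(1) i gy])
    have "g' i (y - s' i (g' i y)) = 0"
      using lin_diff[OF hom_lin[OF g'(1) i] y sy] s'(2) i gy by simp
    then obtain b where b: "b \<in> kvec (rdim B i)" "y - s' i (g' i y) = f' i b"
      using ex'[OF i] kvec_diff[OF y sy] by blast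
    let ?x = "f i b + s i (g' i y)"
    have fb: "f i b \<in> kvec (rdim X i)" "s i (g' i y) \<in> kvec (rdim X i)"
      using hom_inI[OF f(1) i b(1)] hom_inI[OF s(1) i gy] .
    then have x: "?x \<in> kvec (rdim X i)" by simp
    have "g i (f i b) = 0" using ex[OF i] b(1) by blast
    then have gx: "g i ?x = g' i y" using lin_add[OF hom_lin[OF g(1) i] fb] s(2) i gy by simp
    then have "f i (r i ?x) = f i b" using fr[OF i x] by simp
    then have "r i ?x = b" by (rule hom_injD[OF f(2) i _ hom_inI[OF r i x] b(1)])
    then have "y = ?h i ?x" using gx b(2) by (simp add: algebra_simps)
    then show "y \<in> ?h i ` kvec (rdim X i)" by (rule image_eqI[OF _ x])
  qed (use hom_inI[OF h] in blast)
  ultimately show ?thesis using h unfolding rep_iso_def by blast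
qed

lemma ses_sub_quo:
  assumes "ses B X A f g"
  shows "\<exists>U. subrep X U \<and> sub_iso X U B \<and> quo_iso X U A"
proof -
  have wf: "wf_rep B" "wf_rep X" and f: "is_hom B X f" "hom_inj B f" and g: "is_hom X A g" "hom_surj X A g"
    and ex: "\<And>i. i \<in> V \<Longrightarrow> {x \<in> kvec (rdim X i). g i x = 0} = f i ` kvec (rdim B i)"
    using assms unfolding ses_def by auto
  let ?U = "\<lambda>i. if i \<in> V then f i ` kvec (rdim B i) else {0}"
  have "subrep X ?U" by (rule subrep_image[OF f(1) wf(1) subrep_full[OF wf(1)]])
  moreover have "sub_iso X ?U B" unfolding sub_iso_def using f by (intro exI[of _ f]) simp
  moreover have "quo_iso X ?U A" unfolding quo_iso_def using g ex by (intro exI[of _ g]) simp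
  ultimately show ?thesis by blast
qed

lemma sub_quo_ses:
  assumes "sub_iso X U B" "quo_iso X U A" "wf_rep X" "wf_rep A" "wf_rep B"
  shows "\<exists>f g. ses B X A f g"
proof -
  obtain f where f: "is_hom B X f" "hom_inj B f" "\<forall>i\<in>V. f i ` kvec (rdim B i) = U i"
    using assms(1) unfolding sub_iso_def by (elim exE conjE)
  obtain g where g: "is_hom X A g" "hom_surj X A g" "\<forall>i\<in>V. {x \<in> kvec (rdim X i). g i x = 0} = U i"
    using assms(2) unfolding quo_iso_def by (elim exE conjE)
  show ?thesis unfolding ses_def using assms f g by (intro exI[of _ f] exI[of _ g]) simp
qed

text \<open>By \<open>ses_iso\<close> the class of \<open>X\<close> is the only one in the support
  of the product, so the product is a multiple of it; the given sequence makes the coefficient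
  nonzero.\<close>

lemma hall_subalg_ses:
  fixes X :: "('v, 'e, 'k::{finite,field}) qrep"
  assumes ses: "ses B X A f g" and e: "ext_zero A B"
    and A: "hall_basis (iso_class A) \<in> hall_subalg G" and B: "hall_basis (iso_class B) \<in> hall_subalg G"
  shows "hall_basis (iso_class X) \<in> hall_subalg G"
proof -
  have wf: "wf_rep B" "wf_rep X" "wf_rep A" using ses unfolding ses_def by auto
  let ?S = "\<lambda>c. {U. subrep (rep_of c) U \<and> (\<exists>B'\<in>iso_class B. sub_iso (rep_of c) U B') \<and>
      (\<exists>A'\<in>iso_class A. quo_iso (rep_of c) U A')}"
  have dims: "iso_class A \<subseteq> reps (rdim A)" "iso_class B \<subseteq> reps (rdim B)"
    using rep_iso_dim wf unfolding iso_class_def reps_def by fastforce+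
  have prod: "hall_mult (hall_basis (iso_class A)) (hall_basis (iso_class B)) c = of_nat (card (?S c))"
    if "c \<in> iso_classes" for c
    unfolding chi_iso_class[OF wf(1), symmetric] chi_iso_class[OF wf(3), symmetric]
    by (rule hall_mult_chi[OF iso_closed_class[OF wf(3)] iso_closed_class[OF wf(1)] dims that])
  have mem: "c = iso_class X" if c: "c \<in> iso_classes" and ne: "?S c \<noteq> {}" for c
  proof -
    obtain U A' B' where U: "A' \<in> iso_class A" "B' \<in> iso_class B" "sub_iso (rep_of c) U B'"
      "quo_iso (rep_of c) U A'" using ne by blast
    have iso: "wf_rep A'" "rep_iso A A'" "wf_rep B'" "rep_iso B B'"
      using U(1,2) unfolding iso_class_def by auto
    note w = rep_of_class[OF c]
    from sub_quo_ses[OF sub_iso_cong[OF U(3) iso(4)] quo_iso_cong[OF U(4) rep_iso_sym[OF iso(2) wf(3) iso(1)]]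
        w(1) wf(3,1)]
    obtain f' g' where "ses B (rep_of c) A f' g'" by blast
    from ses_iso[OF ses this e] show ?thesis using iso_class_eq_iff[OF wf(2) w(1)] w(2) by simp
  qed
  let ?c = "iso_class X"
  have c: "?c \<in> iso_classes" by (rule iso_class_in[OF wf(2)])
  \<comment> \<open>Hall numbers are evaluated at chosen representatives, so the sequence is first
    transported from \<open>X\<close> to \<open>rep_of ?c\<close>.\<close>
  have h: "card (?S ?c) \<noteq> 0"
  proof -
    have wX: "wf_rep (rep_of ?c)" by (rule rep_of_class(1)[OF c])
    obtain p where p: "is_hom X (rep_of ?c) p" "hom_inj X p" "hom_surj X (rep_of ?c) p"
      using rep_of_iso[OF wf(2)] unfolding rep_iso_def by blast
    obtain p' where p': "is_hom (rep_of ?c) X p'" "hom_surj (rep_of ?c) X p'"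
      "\<forall>i\<in>V. \<forall>x\<in>kvec (rdim X i). p' i (p i x) = x" "\<forall>i\<in>V. \<forall>y\<in>kvec (rdim (rep_of ?c) i). p i (p' i y) = y"
      using hom_inverse[OF p wf(2) wX] by blast
    have f: "is_hom B X f" "hom_inj B f" and g: "is_hom X A g" "hom_surj X A g"
      and ex: "\<And>i. i \<in> V \<Longrightarrow> {x \<in> kvec (rdim X i). g i x = 0} = f i ` kvec (rdim B i)"
      using ses unfolding ses_def by auto
    have "ses B (rep_of ?c) A (\<lambda>i x. p i (f i x)) (\<lambda>i x. g i (p' i x))"
      unfolding ses_def
    proof (intro conjI wf wX ballI hom_compose[OF f(1) p(1)] hom_inj_compose[OF f(2,1) p(2)]
        hom_compose[OF p'(1) g(1)] hom_surj_compose[OF p'(2) g(2)] equalityI subsetI)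
      fix i x assume i: "i \<in> V" and "x \<in> {x \<in> kvec (rdim (rep_of ?c) i). g i (p' i x) = 0}"
      then have x: "x \<in> kvec (rdim (rep_of ?c) i)" "g i (p' i x) = 0" by auto
      then have "p' i x \<in> f i ` kvec (rdim B i)" using ex[OF i] hom_inI[OF p'(1) i x(1)] by blast
      then obtain b where "b \<in> kvec (rdim B i)" "p' i x = f i b" by blast
      then show "x \<in> (\<lambda>x. p i (f i x)) ` kvec (rdim B i)" using p'(4) i x(1) by (metis image_eqI)
    next
      fix i y assume i: "i \<in> V" and "y \<in> (\<lambda>x. p i (f i x)) ` kvec (rdim B i)"
      then obtain b where b: "b \<in> kvec (rdim B i)" "y = p i (f i b)" by blast
      have fb: "f i b \<in> kvec (rdim X i)" by (rule hom_inI[OF f(1) i b(1)])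
      have "g i (f i b) = 0" using ex[OF i] b(1) by blast
      then show "y \<in> {x \<in> kvec (rdim (rep_of ?c) i). g i (p' i x) = 0}"
        using b(2) p'(3) i fb hom_inI[OF p(1) i fb] by simp
    qed
    then have "?S ?c \<noteq> {}"
      using ses_sub_quo iso_class_self[OF wf(1)] iso_class_self[OF wf(3)] by blast
    moreover have "finite (?S ?c)" by (rule finite_subset[OF _ finite_subreps[OF wX]]) blast
    ultimately show ?thesis by simp
  qed
  have "hall_mult (hall_basis (iso_class A)) (hall_basis (iso_class B)) =
      (\<lambda>c. of_nat (card (?S ?c)) * hall_basis ?c c)"
  proof
    fix c
    show "hall_mult (hall_basis (iso_class A)) (hall_basis (iso_class B)) c =
      of_nat (card (?S ?c)) * hall_basis ?c c"
    proof (cases "c \<in> iso_classes")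
      case True
      show ?thesis
      proof (cases "c = ?c")
        case True
        then show ?thesis using prod[OF c] by (simp add: hall_basis_def)
      next
        case False
        then have "?S c = {}" using mem[OF True] by blast
        then have "card (?S c) = 0" by (metis card.empty)
        then have "hall_mult (hall_basis (iso_class A)) (hall_basis (iso_class B)) c = 0"
          using prod[OF True] by (simp only: of_nat_0)
        moreover have "hall_basis ?c c = 0" using False by (simp add: hall_basis_def)
        ultimately show ?thesis by simp
      qed
    next
      case False
      then show ?thesis using c by (auto simp: hall_mult_outside hall_basis_def)
    qed
  qed
  from hall_subalg_scale_cancel[OF hall_subalg.mult[OF A B] _ this] h show ?thesis by simp
qed

subsection \<open>The sum of all representations of a given dimension vector\<close>

lemma reps_zero:
  assumes "\<And>i. i \<in> V \<Longrightarrow> d i = 0" "\<And>i. i \<notin> V \<Longrightarrow> d i = 0"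
  shows "(reps d :: ('v, 'e, 'k::field) qrep set) = iso_class zero_rep"
proof -
  have d: "d = (\<lambda>i. 0)" using assms by blast
  have z: "wf_rep (zero_rep :: ('v, 'e, 'k) qrep)"
    by (simp add: wf_rep_def zero_rep_def lin_on_def)
  show ?thesis
  proof (intro equalityI subsetI)
    fix X :: "('v, 'e, 'k) qrep" assume "X \<in> reps d"
    then have X: "wf_rep X" "rdim X = (\<lambda>i. 0)" by (auto simp: reps_def d)
    have "iso_class zero_rep = iso_class X"
      by (rule iso_class_self_map[OF z X(1)])
        (simp_all add: X(2) zero_rep_def lin_zero[OF wf_lin[OF X(1)]])
    then show "X \<in> iso_class zero_rep" using iso_class_self[OF X(1)] by simp
  next
    fix X :: "('v, 'e, 'k) qrep" assume "X \<in> iso_class zero_rep"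
    then have X: "wf_rep X" "rep_iso zero_rep X" by (auto simp: iso_class_def)
    then obtain f where f: "hom_surj zero_rep X f" unfolding rep_iso_def by blast
    have "rdim X i = 0" for i
    proof (cases "i \<in> V")
      case True
      then have k: "kvec (rdim X i) = {f i 0}" using f by (auto simp: hom_surj_def zero_rep_def)
      then have "f i 0 = 0" using zero_in_kvec[of "rdim X i"] by (metis singletonD)
      then show ?thesis using k kvec_trivial[where 'k='k] by simp
    qed (use wf_rdim[OF X(1)] in blast)
    then show "X \<in> reps d" using X(1) by (simp add: reps_def d fun_eq_iff)
  qed
qed

lemma no_loop: "a \<in> E \<Longrightarrow> src a \<noteq> tgt a"
proof
  assume a: "a \<in> E" and "src a = tgt a"
  then have "(src a, src a) \<in> {(src a, tgt a) | a. a \<in> E}" by force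
  then show False using acyclic_E unfolding acyclic_def by blast
qed

definition unit_dim :: "'v \<Rightarrow> 'v \<Rightarrow> nat" where
  "unit_dim i = (\<lambda>j. if j = i then 1 else 0)"

text \<open>Without loops, every arrow starts or ends in a zero space for this dimension vector. All
  arrow maps vanish, and there is only one class.\<close>

lemma simple_class:
  assumes i: "i \<in> V"
  shows "\<exists>S :: ('v, 'e, 'k::{finite,field}) qrep. simple_rep S \<and> reps (unit_dim i) = iso_class S"
proof -
  let ?S = "\<lparr>rdim = unit_dim i, rmap = (\<lambda>_ _. 0)\<rparr> :: ('v, 'e, 'k) qrep"
  have wf: "wf_rep ?S" using i by (auto simp: wf_rep_def unit_dim_def lin_const0)
  have "simple_rep ?S" unfolding simple_rep_def
  proof (intro conjI allI impI wf)
    show "\<not> is_zero_rep ?S" using i by (auto simp: is_zero_rep_def unit_dim_def)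
    fix U assume U: "subrep ?S U"
    have o: "U j = {0}" if "j \<noteq> i" for j
      using subrep_sub[OF U, of j] that by (simp add: unit_dim_def ksubspace_0)
    have s: "ksubspace 1 (U i)" using subrep_sub[OF U, of i] by (simp add: unit_dim_def)
    have "vdim (U i) \<le> 1" using vdim_mono[OF s ksubspace_kvec ksubspaceD(1)[OF s, THEN subsetI]] by simp
    then consider "vdim (U i) = 0" | "vdim (U i) = 1" by linarith
    then show "(\<forall>j\<in>V. U j = {0}) \<or> (\<forall>j\<in>V. U j = kvec (rdim ?S j))"
    proof cases
      case 1
      have "{0} = U i"
        by (rule vdim_eq[OF ksubspace_zero s]) (use 1 ksubspaceD(2)[OF s] in auto)
      then show ?thesis using o by metis
    next
      case 2
      have "U i = kvec 1"
        by (rule vdim_eq[OF s ksubspace_kvec ksubspaceD(1)[OF s, THEN subsetI]]) (use 2 in auto)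
      then show ?thesis using o by (auto simp: unit_dim_def)
    qed
  qed
  moreover have "reps (unit_dim i) = iso_class ?S"
  proof (intro equalityI subsetI)
    fix X :: "('v, 'e, 'k) qrep" assume "X \<in> reps (unit_dim i)"
    then have X: "wf_rep X" "rdim X = unit_dim i" by (auto simp: reps_def)
    have "iso_class ?S = iso_class X"
    proof (rule iso_class_self_map[OF wf X(1)])
      fix a and x :: "nat \<Rightarrow> 'k" assume a: "a \<in> E" and "x \<in> kvec (rdim ?S (src a))"
      then have x: "x \<in> kvec (rdim X (src a))" by (simp add: X(2))
      have "rmap X a x = 0"
      proof (cases "src a = i")
        case True
        then have "rdim X (tgt a) = 0" using no_loop[OF a] by (auto simp: X(2) unit_dim_def)
        then show ?thesis using wf_map[OF X(1) a x] by simp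
      next
        case False
        then have "x = 0" using x by (simp add: X(2) unit_dim_def)
        then show ?thesis using lin_zero[OF wf_lin[OF X(1) a]] by simp
      qed
      then show "rmap ?S a x = rmap X a x" by simp
    qed (simp add: X(2))
    then show "X \<in> iso_class ?S" using iso_class_self[OF X(1)] by simp
  next
    fix X :: "('v, 'e, 'k) qrep" assume "X \<in> iso_class ?S"
    then have X: "wf_rep X" "rep_iso ?S X" by (auto simp: iso_class_def)
    then show "X \<in> reps (unit_dim i)" using rep_iso_dim[OF X(2) wf X(1)] by (simp add: reps_def)
  qed
  ultimately show ?thesis by blast
qed

text \<open>The finite acyclic arrow relation is well founded; a minimal vertex of the support
  receives arrows only from outside the support.\<close>

lemma exists_source:
  assumes "j \<in> V" "d j > (0::nat)"
  shows "\<exists>i\<in>V. d i > 0 \<and> (\<forall>a\<in>E. tgt a = i \<longrightarrow> d (src a) = 0)"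
proof -
  let ?R = "{(src a, tgt a) | a. a \<in> E}"
  have "?R = (\<lambda>a. (src a, tgt a)) ` E" by auto
  then have "finite ?R" using finite_E by simp
  then have "wf ?R" using acyclic_E by (rule finite_acyclic_wf)
  then obtain i where i: "i \<in> {i \<in> V. d i > 0}" "\<And>y. (y, i) \<in> ?R \<Longrightarrow> y \<notin> {i \<in> V. d i > 0}"
    using wfE_min[of ?R j "{i \<in> V. d i > 0}"] assms by auto
  have "d (src a) = 0" if "a \<in> E" "tgt a = i" for a
  proof -
    have "(src a, i) \<in> ?R" using that by blast
    from i(2)[OF this] show ?thesis using src_V[OF that(1)] by simp
  qed
  then show ?thesis using i(1) by auto
qed

lemma chi_reps_composition:
  "chi (reps d :: ('v, 'e, 'k::{finite,field}) qrep set) \<in> composition_algebra"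
proof (induction "\<Sum>i\<in>V. d i" arbitrary: d rule: less_induct)
  case less
  let ?R = "\<lambda>d. reps d :: ('v, 'e, 'k) qrep set"
  consider (outside) "\<exists>i. i \<notin> V \<and> d i \<noteq> 0" | (zero) "\<And>i. i \<notin> V \<Longrightarrow> d i = 0" "\<And>i. i \<in> V \<Longrightarrow> d i = 0"
    | (pos) "\<And>i. i \<notin> V \<Longrightarrow> d i = 0" "\<exists>j\<in>V. d j > 0" by force
  then show ?case
  proof cases
    \<comment> \<open>\<open>d\<close> ranges over all functions; one that is nonzero off
      \<open>V\<close> belongs to no well-formed representation, so its sum is 0.\<close>
    case outside
    then obtain i where "i \<notin> V" "d i \<noteq> 0" by blast
    then have "X \<notin> ?R d" for X using wf_rdim[of X i] by (auto simp: reps_def)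
    then have "?R d = {}" by blast
    then show ?thesis using hall_subalg_zero by (simp add: chi_def composition_algebra_def)
  next
    case zero
    have w: "wf_rep (zero_rep :: ('v, 'e, 'k) qrep)"
      by (simp add: wf_rep_def zero_rep_def lin_on_def)
    have r: "?R d = iso_class zero_rep" by (rule reps_zero) (use zero in auto)
    have "chi (?R d) = hall_basis (iso_class zero_rep)"
      unfolding r by (rule chi_iso_class[OF w])
    then show ?thesis by (simp only: composition_algebra_def hall_subalg.one)
  next
    case pos
    then obtain i where i: "i \<in> V" "d i > 0" "\<forall>a\<in>E. tgt a = i \<longrightarrow> d (src a) = 0"
      using exists_source by blast
    define d' where "d' = d(i := d i - 1)"
    have dd: "d j = d' j + unit_dim i j" for j using i(2) by (simp add: d'_def unit_dim_def)
    obtain S :: "('v, 'e, 'k) qrep" where S: "simple_rep S" "?R (unit_dim i) = iso_class S"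
      using simple_class[OF i(1)] by blast
    have "wf_rep S" using S(1) by (simp add: simple_rep_def)
    then have c1: "chi (?R (unit_dim i)) = hall_basis (iso_class S)"
      unfolding S(2) by (rule chi_iso_class)
    have "iso_class S \<in> {iso_class S | S. simple_rep S}" using S(1) by blast
    from hall_subalg.gen[OF this] have 1: "chi (?R (unit_dim i)) \<in> composition_algebra"
      unfolding c1 composition_algebra_def .
    have "(\<Sum>i\<in>V. d' i) < (\<Sum>i\<in>V. d i)"
      by (rule sum_strict_mono_ex1[OF finite_V]) (use i in \<open>auto simp: d'_def\<close>)
    then have 2: "chi (?R d') \<in> composition_algebra" by (rule less)
    \<comment> \<open>As \<open>i\<close> is a source of the support, subrepresentations of dimension \<open>d'\<close> are hyperplanes at \<open>i\<close>.\<close>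
    define \<H> where "\<H> = {H :: (nat \<Rightarrow> 'k) set. ksubspace (d i) H \<and> vdim H = d i - 1}"
    have "finite \<H>" by (rule finite_subset[of _ "Pow (kvec (d i))"]) (auto simp: \<H>_def ksubspace_def)
    moreover have "kvec (d i - 1) \<in> \<H>"
      unfolding \<H>_def using kvec_mono[of "d i - 1" "d i"] by (auto intro!: ksubspaceI)
    ultimately have h: "card \<H> \<noteq> 0" by auto
    have "hall_mult (chi (?R (unit_dim i))) (chi (?R d')) = (\<lambda>c. of_nat (card \<H>) * chi (?R d) c)"
    proof
      fix c :: "('v, 'e, 'k) qrep set"
      show "hall_mult (chi (?R (unit_dim i))) (chi (?R d')) c = of_nat (card \<H>) * chi (?R d) c"
      proof (cases "c \<in> iso_classes")
        case False
        then show ?thesis by (simp add: hall_mult_outside chi_iff[OF iso_closed_reps])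
      next
        case True
        let ?X = "rep_of c"
        have X: "wf_rep ?X" by (rule rep_of_class(1)[OF True])
        let ?T = "{U. subrep ?X U \<and> (\<exists>B\<in>?R d'. sub_iso ?X U B) \<and> (\<exists>A\<in>?R (unit_dim i). quo_iso ?X U A)}"
        have prod: "hall_mult (chi (?R (unit_dim i))) (chi (?R d')) c = of_nat (card ?T)"
          by (rule hall_mult_chi[OF iso_closed_reps iso_closed_reps subset_refl subset_refl True])
        have TD: "sdim U = d' \<and> rdim ?X = d" if "U \<in> ?T" for U
        proof -
          obtain A B where AB: "wf_rep B" "rdim B = d'" "sub_iso ?X U B" "wf_rep A"
            "rdim A = unit_dim i" "quo_iso ?X U A" using \<open>U \<in> ?T\<close> by (auto simp: reps_def)
          have "sdim U = d'" using sub_iso_dim[OF AB(3,1)] AB(2) by simp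
          then show ?thesis using quo_iso_dim[OF AB(6,4) X] AB(5) dd by (auto simp: fun_eq_iff)
        qed
        show ?thesis
        proof (cases "rdim ?X = d")
          case False
          then have "?T = {}" using TD by blast
          then have "card ?T = 0" by (metis card.empty)
          moreover have "?X \<notin> ?R d" using False by (simp add: reps_def)
          ultimately show ?thesis using prod by (simp add: chi_iff[OF iso_closed_reps])
        next
          case rX: True
          have T: "?T = {U. subrep ?X U \<and> sdim U = d'}"
          proof (intro equalityI subsetI)
            fix U assume "U \<in> {U. subrep ?X U \<and> sdim U = d'}"
            then have U: "subrep ?X U" "sdim U = d'" by auto
            obtain B where B: "wf_rep B" "sub_iso ?X U B" using sub_exists[OF X U(1)] by blast
            obtain A where A: "wf_rep A" "quo_iso ?X U A" using quo_exists[OF X U(1)] by blast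
            have "rdim B = d'" using sub_iso_dim[OF B(2,1)] U(2) by simp
            moreover have "rdim A = unit_dim i"
              using quo_iso_dim[OF A(2,1) X] U(2) dd rX by (auto simp: fun_eq_iff)
            ultimately show "U \<in> ?T" using U(1) A B by (auto simp: reps_def)
          qed (use TD in blast)
          have sd: "vdim (U j) = d' j" if "U \<in> ?T" "j \<in> V" for U j
            using TD[OF that(1)] that(2) by (metis sdim_def)
          have ks: "ksubspace (d j) (U j)" if "U \<in> ?T" for U j
            using subrep_sub[of ?X U j] that rX by simp
          have rest: "U j = kvec (d j)" if U: "U \<in> ?T" and j: "j \<noteq> i" for U j
          proof (cases "j \<in> V")
            case True
            then have "vdim (U j) = d j" using sd[OF U True] j by (simp add: d'_def)
            then show ?thesis
              by (intro vdim_eq[OF ks[OF U] ksubspace_kvec ksubspaceD(1)[OF ks[OF U], THEN subsetI]]) auto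
          next
            case False
            then show ?thesis using ks[OF U, of j] pos(1) by (simp add: ksubspace_0)
          qed
          have "bij_betw (\<lambda>U. U i) ?T \<H>"
          proof (rule bij_betwI[where g = "\<lambda>H j. if j = i then H else kvec (d j)"])
            show "(\<lambda>U. U i) \<in> ?T \<rightarrow> \<H>"
            proof
              fix U assume U: "U \<in> ?T"
              show "U i \<in> \<H>" using ks[OF U, of i] sd[OF U i(1)] by (simp add: \<H>_def d'_def)
            qed
            show "(\<lambda>H j. if j = i then H else kvec (d j)) \<in> \<H> \<rightarrow> ?T"
            proof
              fix H assume H: "H \<in> \<H>"
              let ?U = "\<lambda>j. if j = i then H else kvec (d j)"
              have "subrep ?X ?U" unfolding subrep_def
              proof (intro conjI allI ballI image_subsetI)
                show "ksubspace (rdim ?X j) (?U j)" for j using H rX by (simp add: \<H>_def)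
                fix a x assume a: "a \<in> E" and x: "x \<in> ?U (src a)"
                have "?U (src a) \<subseteq> kvec (d (src a))" using H by (auto simp: \<H>_def ksubspace_def)
                then have xk: "x \<in> kvec (rdim ?X (src a))" using x rX by auto
                \<comment> \<open>Arrows into \<open>i\<close> start at zero spaces, so any
                  hyperplane at \<open>i\<close> is admissible; at all other vertices the whole
                  space is taken.\<close>
                show "rmap ?X a x \<in> ?U (tgt a)"
                proof (cases "tgt a = i")
                  case True
                  then have "x = 0" using xk i(3) a rX by simp
                  then have "rmap ?X a x = 0" using lin_zero[OF wf_lin[OF X a]] by simp
                  then show ?thesis using True H by (simp add: \<H>_def ksubspace_def)
                next
                  case False
                  then show ?thesis using wf_map[OF X a xk] rX by simp
                qed
              qed
              moreover have "sdim ?U = d'"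
                using H i(1) pos(1) by (auto simp: sdim_def \<H>_def d'_def fun_eq_iff)
              ultimately show "?U \<in> ?T" unfolding T by blast
            qed
            fix U assume "U \<in> ?T"
            then show "(\<lambda>j. if j = i then U i else kvec (d j)) = U" using rest by (auto simp: fun_eq_iff)
          qed simp
          then have "card ?T = card \<H>" by (rule bij_betw_same_card)
          moreover have "?X \<in> ?R d" using rX X by (simp add: reps_def)
          ultimately show ?thesis using prod True by (simp add: chi_iff[OF iso_closed_reps])
        qed
      qed
    qed
    from hall_subalg_scale_cancel[OF hall_subalg.mult[OF 1[unfolded composition_algebra_def]
          2[unfolded composition_algebra_def]] _ this]
    show ?thesis using h by (simp add: composition_algebra_def)
  qed
qed

subsection \<open>Slopes and the Harder--Narasimhan recursion\<close>

text \<open>For nonzero \<open>d\<close>, \<open>qf \<theta> c d \<le> 0\<close> compares the slope of \<open>d\<close> with \<open>c\<close>; unlike the slope it is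
  additive in \<open>d\<close>.\<close>

definition qf :: "('v \<Rightarrow> real) \<Rightarrow> real \<Rightarrow> ('v \<Rightarrow> nat) \<Rightarrow> real" where
  "qf \<theta> c d = (\<Sum>i\<in>V. (\<theta> i - c) * real (d i))"

text \<open>Division by zero gives the zero vector slope 0, hence comparisons of slopes assume
  \<open>nzd\<close>.\<close>

definition slope :: "('v \<Rightarrow> real) \<Rightarrow> ('v \<Rightarrow> nat) \<Rightarrow> real" where
  "slope \<theta> d = (\<Sum>i\<in>V. \<theta> i * real (d i)) / (\<Sum>i\<in>V. real (d i))"

definition nzd :: "('v \<Rightarrow> nat) \<Rightarrow> bool" where
  "nzd d \<longleftrightarrow> (\<exists>i\<in>V. d i \<noteq> 0)"

lemma qf_eq: "qf \<theta> c d = (\<Sum>i\<in>V. \<theta> i * real (d i)) - c * (\<Sum>i\<in>V. real (d i))"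
  by (simp add: qf_def sum_distrib_left sum_subtractf left_diff_distrib)

lemma nzd_pos: "nzd d \<Longrightarrow> (\<Sum>i\<in>V. real (d i)) > 0"
  unfolding nzd_def by (rule bexE) (auto intro!: sum_pos2[OF finite_V])

lemma qf_slope:
  assumes "nzd d"
  shows "qf \<theta> c d \<le> 0 \<longleftrightarrow> slope \<theta> d \<le> c" "qf \<theta> c d < 0 \<longleftrightarrow> slope \<theta> d < c"
  using nzd_pos[OF assms] by (simp_all add: qf_eq slope_def field_simps)

lemma qf_slope_self: "qf \<theta> (slope \<theta> d) d = 0"
proof (cases "nzd d")
  case True
  then show ?thesis using nzd_pos[OF True] by (simp add: qf_eq slope_def)
qed (simp add: qf_def nzd_def)

lemma qf_add: "(\<And>i. i \<in> V \<Longrightarrow> d i = e i + f i) \<Longrightarrow> qf \<theta> c d = qf \<theta> c e + qf \<theta> c f"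
  by (simp add: qf_def sum.distrib[symmetric] algebra_simps cong: sum.cong)

lemma qf_zero: "\<not> nzd d \<Longrightarrow> qf \<theta> c d = 0"
  by (simp add: qf_def nzd_def)

lemma qf_shift: "qf \<theta> c d = qf \<theta> c' d + (c' - c) * (\<Sum>i\<in>V. real (d i))"
  by (simp add: qf_eq algebra_simps)

lemma subrep_Int: "subrep X U \<Longrightarrow> subrep X W \<Longrightarrow> subrep X (\<lambda>i. U i \<inter> W i)"
  unfolding subrep_def image_subset_iff by (auto intro: ksubspace_Int)

lemma subrep_ssum:
  assumes X: "wf_rep X" and U: "subrep X U" and W: "subrep X W"
  shows "subrep X (\<lambda>i. ssum (U i) (W i))"
  unfolding subrep_def
proof (intro conjI allI ballI image_subsetI)
  show "ksubspace (rdim X i) (ssum (U i) (W i))" for i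
    by (rule ksubspace_ssum[OF subrep_sub[OF U] subrep_sub[OF W]])
  fix a x assume a: "a \<in> E" and "x \<in> ssum (U (src a)) (W (src a))"
  then obtain u w where uw: "x = u + w" "u \<in> U (src a)" "w \<in> W (src a)" unfolding ssum_def by blast
  have "rmap X a x = rmap X a u + rmap X a w"
    unfolding uw(1) by (rule lin_add[OF wf_lin[OF X a] ksubspaceD(1)[OF subrep_sub[OF U] uw(2)]
          ksubspaceD(1)[OF subrep_sub[OF W] uw(3)]])
  then show "rmap X a x \<in> ssum (U (tgt a)) (W (tgt a))"
    using subrep_map[OF U a uw(2)] subrep_map[OF W a uw(3)] unfolding ssum_def by blast
qed

lemma sdim_ssum:
  assumes "subrep X U" "subrep X W"
  shows "sdim (\<lambda>i. ssum (U i) (W i)) i + sdim (\<lambda>i. U i \<inter> W i) i = sdim U i + sdim W i"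
  using vdim_ssum[OF subrep_sub[OF assms(1)] subrep_sub[OF assms(2)]] by (simp add: sdim_def)

text \<open>The first step of the Harder--Narasimhan filtration: \<open>U\<close> is semistable and all
  subrepresentations of \<open>X/U\<close> have smaller slope.\<close>

definition destab :: "('v \<Rightarrow> real) \<Rightarrow> ('v, 'e, 'k::{finite,field}) qrep \<Rightarrow> ('v \<Rightarrow> (nat \<Rightarrow> 'k) set) \<Rightarrow> bool" where
  "destab \<theta> X U \<longleftrightarrow> subrep X U \<and> nzd (sdim U)
     \<and> (\<forall>W. subrep X W \<and> W \<le> U \<longrightarrow> qf \<theta> (slope \<theta> (sdim U)) (sdim W) \<le> 0)
     \<and> (\<forall>W. subrep X W \<and> U \<le> W \<and> W \<noteq> U \<longrightarrow> qf \<theta> (slope \<theta> (sdim U)) (sdim W) < 0)"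

text \<open>Among the nonzero subrepresentations of maximal slope, one of maximal total dimension is
  taken. Maximal slope bounds every subrepresentation, and maximal dimension makes the bound strict
  above \<open>U\<close>.\<close>

lemma destab_exists:
  fixes X :: "('v, 'e, 'k::{finite,field}) qrep"
  assumes X: "wf_rep X" and nz: "nzd (rdim X)"
  shows "\<exists>U. destab \<theta> X U \<and> (\<forall>W. subrep X W \<longrightarrow> qf \<theta> (slope \<theta> (sdim U)) (sdim W) \<le> 0)"
proof -
  let ?S = "{U. subrep X U \<and> nzd (sdim U)}"
  let ?m = "\<lambda>U. slope \<theta> (sdim U)"
  let ?l = "\<lambda>U. \<Sum>i\<in>V. sdim U i"
  have S: "finite ?S" by (rule finite_subset[OF _ finite_subreps[OF X]]) blast
  have "(\<lambda>i. kvec (rdim X i)) \<in> ?S" using subrep_full[OF X] nz by (simp add: sdim_full[OF X])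
  then have S0: "?S \<noteq> {}" by blast
  define c where "c = Max (?m ` ?S)"
  have mc: "?m U \<le> c" if "U \<in> ?S" for U unfolding c_def using S that by simp
  have "c \<in> ?m ` ?S" unfolding c_def using S S0 by (intro Max_in) auto
  then obtain U1 where U1: "U1 \<in> ?S" "?m U1 = c" by force
  let ?T = "{U \<in> ?S. ?m U = c}"
  have T: "finite ?T" by (rule finite_subset[OF _ S]) blast
  have T0: "?T \<noteq> {}" using U1 by blast
  have "Max (?l ` ?T) \<in> ?l ` ?T" using T T0 by (intro Max_in) auto
  then obtain U where U: "U \<in> ?T" "Max (?l ` ?T) = ?l U" by force
  have lU: "?l W \<le> ?l U" if "W \<in> ?T" for W unfolding U(2)[symmetric] using T that by simp
  have sU: "subrep X U" "nzd (sdim U)" "?m U = c" using U(1) by auto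
  have all: "qf \<theta> c (sdim W) \<le> 0" if "subrep X W" for W
  proof (cases "nzd (sdim W)")
    case True
    then show ?thesis using mc[of W] that qf_slope(1)[OF True] by simp
  qed (simp add: qf_zero)
  have strict: "qf \<theta> c (sdim W) < 0" if W: "subrep X W" "U \<le> W" "W \<noteq> U" for W
  proof -
    have le: "sdim U i \<le> sdim W i" for i by (rule sdim_mono[OF sU(1) W(1,2)])
    have "\<exists>i\<in>V. sdim U i < sdim W i"
      using sdim_eq[OF X sU(1) W(1,2)] W(3) by (metis leI)
    then have lt: "?l U < ?l W" by (intro sum_strict_mono_ex1[OF finite_V]) (use le in auto)
    have nzW: "nzd (sdim W)" using sU(2) le unfolding nzd_def by (metis le_zero_eq)
    have "?m W \<noteq> c" using lU[of W] lt W(1) nzW by auto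
    then have "?m W < c" using mc[of W] W(1) nzW by auto
    then show ?thesis using qf_slope(2)[OF nzW] by simp
  qed
  have "destab \<theta> X U" unfolding destab_def sU(3) using sU all strict by blast
  then show ?thesis using all sU(3) by blast
qed

text \<open>With c' the smaller slope, that of \<open>W\<close>, additivity over sum
  \<open>J\<close> and intersection \<open>I\<close> gives \<open>qf\<close> of \<open>J\<close> as
  \<open>qf\<close> of \<open>U\<close> minus \<open>qf\<close> of \<open>I\<close>. This is
  nonnegative because \<open>I\<close> lies in \<open>U\<close>, which has slope c at least c' and
  bounds the slopes of its subrepresentations by c. Strictness above \<open>W\<close> forces
  \<open>J = W\<close>, so \<open>U \<le> W\<close>; a proper inclusion would give both c' < c and c
  at most c'.\<close>

lemma destab_le:
  fixes X :: "('v, 'e, 'k::{finite,field}) qrep"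
  assumes X: "wf_rep X" and U: "destab \<theta> X U" and W: "destab \<theta> X W"
    and le: "slope \<theta> (sdim W) \<le> slope \<theta> (sdim U)"
  shows "U = W"
proof -
  let ?c = "slope \<theta> (sdim U)" and ?c' = "slope \<theta> (sdim W)"
  let ?J = "\<lambda>i. ssum (U i) (W i)" and ?I = "\<lambda>i. U i \<inter> W i"
  have sU: "subrep X U" and sW: "subrep X W" and nz: "nzd (sdim U)" "nzd (sdim W)"
    using U W unfolding destab_def by auto
  have J: "subrep X ?J" by (rule subrep_ssum[OF X sU sW])
  have I: "subrep X ?I" by (rule subrep_Int[OF sU sW])
  have UJ: "U \<le> ?J" "W \<le> ?J" using ssum_supset[OF subrep_sub[OF sU] subrep_sub[OF sW]] by (auto simp: le_fun_def)
  have IU: "?I \<le> U" by (simp add: le_fun_def)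
  have "qf \<theta> ?c' (sdim ?J) + qf \<theta> ?c' (sdim ?I) = qf \<theta> ?c' (sdim U) + qf \<theta> ?c' (sdim W)"
    using qf_add[of "\<lambda>i. sdim ?J i + sdim ?I i" "sdim ?J" "sdim ?I"]
      qf_add[of "\<lambda>i. sdim U i + sdim W i" "sdim U" "sdim W"] sdim_ssum[OF sU sW] by simp
  then have eq: "qf \<theta> ?c' (sdim ?J) = qf \<theta> ?c' (sdim U) - qf \<theta> ?c' (sdim ?I)"
    by (simp add: qf_slope_self)
  have "qf \<theta> ?c' (sdim U) = (?c - ?c') * (\<Sum>i\<in>V. real (sdim U i))"
    using qf_shift[of \<theta> ?c' "sdim U" ?c] by (simp add: qf_slope_self)
  moreover have "qf \<theta> ?c (sdim ?I) \<le> 0" using U I IU unfolding destab_def by blast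
  then have "qf \<theta> ?c' (sdim ?I) \<le> (?c - ?c') * (\<Sum>i\<in>V. real (sdim ?I i))"
    using qf_shift[of \<theta> ?c' "sdim ?I" ?c] by simp
  moreover have "(?c - ?c') * (\<Sum>i\<in>V. real (sdim ?I i)) \<le> (?c - ?c') * (\<Sum>i\<in>V. real (sdim U i))"
    using le sdim_mono[OF I sU IU] by (intro mult_left_mono sum_mono) auto
  ultimately have "qf \<theta> ?c' (sdim ?J) \<ge> 0" using eq by linarith
  moreover have "qf \<theta> ?c' (sdim ?J) < 0" if "?J \<noteq> W"
    using W J UJ(2) that unfolding destab_def by blast
  ultimately have "?J = W" by fastforce
  then have UW: "U \<le> W" using UJ(1) by simp
  show ?thesis
  proof (rule ccontr)
    assume "U \<noteq> W"
    then have "qf \<theta> ?c (sdim W) < 0" using U sW UW unfolding destab_def by blast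
    then have "?c' < ?c" using qf_slope(2)[OF nz(2)] by simp
    moreover have "qf \<theta> ?c' (sdim U) \<le> 0" using W sU UW unfolding destab_def by blast
    then have "?c \<le> ?c'" using qf_slope(1)[OF nz(1)] by simp
    ultimately show False by simp
  qed
qed

lemma destab_unique:
  fixes X :: "('v, 'e, 'k::{finite,field}) qrep"
  assumes "wf_rep X" "destab \<theta> X U" "destab \<theta> X W" shows "U = W"
  using destab_le[OF assms] destab_le[OF assms(1,3,2)]
  by (cases "slope \<theta> (sdim W) \<le> slope \<theta> (sdim U)") auto

section \<open>Semistable classes, classes of bounded slope, and the recursion\<close>

definition semistable :: "('v \<Rightarrow> real) \<Rightarrow> ('v \<Rightarrow> nat) \<Rightarrow> ('v, 'e, 'k::{finite,field}) qrep set" where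
  "semistable \<theta> e = {X. wf_rep X \<and> rdim X = e \<and>
     (\<forall>W. subrep X W \<longrightarrow> qf \<theta> (slope \<theta> e) (sdim W) \<le> 0)}"

text \<open>The quotients \<open>X/U\<close> left by the first filtration step. For
  \<open>e = 0\<close> the condition is void, so the zero representation qualifies for every bound
  \<open>c\<close>.\<close>

definition slope_below :: "('v \<Rightarrow> real) \<Rightarrow> real \<Rightarrow> ('v \<Rightarrow> nat) \<Rightarrow> ('v, 'e, 'k::{finite,field}) qrep set" where
  "slope_below \<theta> c e = {X. wf_rep X \<and> rdim X = e \<and>
     (\<forall>W. subrep X W \<and> nzd (sdim W) \<longrightarrow> qf \<theta> c (sdim W) < 0)}"

definition img :: "('v \<Rightarrow> (nat \<Rightarrow> 'k::field) \<Rightarrow> nat \<Rightarrow> 'k) \<Rightarrow> ('v \<Rightarrow> (nat \<Rightarrow> 'k) set) \<Rightarrow> 'v \<Rightarrow> (nat \<Rightarrow> 'k) set" where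
  "img f W = (\<lambda>i. if i \<in> V then f i ` W i else {0})"

lemma subrep_img: "is_hom X Y f \<Longrightarrow> wf_rep X \<Longrightarrow> subrep X W \<Longrightarrow> subrep Y (img f W)"
  unfolding img_def by (rule subrep_image)

lemma sdim_img:
  fixes X :: "('v, 'e, 'k::{finite,field}) qrep"
  assumes "hom_inj X f" "subrep X W" shows "sdim (img f W) = sdim W"
proof
  fix i
  show "sdim (img f W) i = sdim W i"
  proof (cases "i \<in> V")
    case True
    have "inj_on (f i) (W i)"
      using assms(1) True ksubspaceD(1)[OF subrep_sub[OF assms(2)]] unfolding hom_inj_def
      by (meson inj_on_subset subsetI)
    then show ?thesis using True by (simp add: sdim_def img_def vdim_image)
  qed (simp add: sdim_def)
qed

lemma iso_closed_stability:
  "iso_closed (semistable \<theta> e :: ('v, 'e, 'k::{finite,field}) qrep set)"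
  "iso_closed (slope_below \<theta> c e :: ('v, 'e, 'k::{finite,field}) qrep set)"
proof -
  have *: "rdim Y = rdim X \<and> (\<forall>W. subrep Y W \<longrightarrow> (\<exists>W'. subrep X W' \<and> sdim W' = sdim W))"
    if XY: "wf_rep X" "wf_rep Y" "rep_iso X Y" for X Y :: "('v, 'e, 'k) qrep"
  proof -
    obtain f where f: "is_hom Y X f" "hom_inj Y f"
      using rep_iso_sym[OF XY(3,1,2)] unfolding rep_iso_def by blast
    show ?thesis using subrep_img[OF f(1) XY(2)] sdim_img[OF f(2)] rep_iso_dim[OF XY(3,1,2)] by metis
  qed
  show "iso_closed (semistable \<theta> e :: ('v, 'e, 'k) qrep set)"
    unfolding iso_closed_def
  proof (intro ballI conjI allI impI)
    fix X Y :: "('v, 'e, 'k) qrep" assume X: "X \<in> semistable \<theta> e"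
    then show wX: "wf_rep X" by (simp add: semistable_def)
    assume "wf_rep Y \<and> rep_iso X Y"
    then show "Y \<in> semistable \<theta> e" using *[OF wX, of Y] X unfolding semistable_def by (auto; metis)
  qed
  show "iso_closed (slope_below \<theta> c e :: ('v, 'e, 'k) qrep set)"
    unfolding iso_closed_def
  proof (intro ballI conjI allI impI)
    fix X Y :: "('v, 'e, 'k) qrep" assume X: "X \<in> slope_below \<theta> c e"
    then show wX: "wf_rep X" by (simp add: slope_below_def)
    assume "wf_rep Y \<and> rep_iso X Y"
    then show "Y \<in> slope_below \<theta> c e" using *[OF wX, of Y] X unfolding slope_below_def by (auto; metis)
  qed
qed

text \<open>Subrepresentations inside \<open>U\<close> correspond to those of \<open>B\<close>, and
  those containing \<open>U\<close> to those of \<open>A\<close>. Semistability of \<open>U\<close>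
  becomes a condition on \<open>B\<close> alone, and strictness above \<open>U\<close> a condition
  on \<open>A\<close> alone.\<close>

lemma destab_iff:
  fixes X :: "('v, 'e, 'k::{finite,field}) qrep"
  assumes X: "wf_rep X" and U: "subrep X U" and B: "wf_rep B" "sub_iso X U B"
    and A: "wf_rep A" "quo_iso X U A"
  shows "destab \<theta> X U \<longleftrightarrow> nzd (sdim U) \<and> B \<in> semistable \<theta> (sdim U)
      \<and> A \<in> slope_below \<theta> (slope \<theta> (sdim U)) (rdim A)"
proof -
  let ?c = "slope \<theta> (sdim U)"
  obtain f where f: "is_hom B X f" "hom_inj B f" "\<forall>i\<in>V. f i ` kvec (rdim B i) = U i"
    using B(2) unfolding sub_iso_def by (elim exE conjE)
  obtain g where g: "is_hom X A g" "hom_surj X A g" and gk: "\<forall>i\<in>V. {x \<in> kvec (rdim X i). g i x = 0} = U i"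
    using A(2) unfolding quo_iso_def by (elim exE conjE)
  have out: "W i = {0}" if "subrep X W" "i \<notin> V" for W i by (rule subrep_outside[OF X that])
  have 1: "(\<forall>W. subrep X W \<and> W \<le> U \<longrightarrow> qf \<theta> ?c (sdim W) \<le> 0) \<longleftrightarrow>
      (\<forall>W. subrep B W \<longrightarrow> qf \<theta> ?c (sdim W) \<le> 0)" (is "?P \<longleftrightarrow> ?Q")
  proof
    assume P: ?P
    show ?Q
    proof (intro allI impI)
      fix W assume W: "subrep B W"
      have "img f W i \<subseteq> U i" for i
      proof (cases "i \<in> V")
        case True
        have "W i \<subseteq> kvec (rdim B i)" using ksubspaceD(1)[OF subrep_sub[OF W]] by blast
        then have "f i ` W i \<subseteq> U i" using f(3)[rule_format, OF True] by blast
        then show ?thesis using True by (simp add: img_def)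
      next
        case False
        then show ?thesis using out[OF U False] by (simp add: img_def)
      qed
      then have "img f W \<le> U" by (simp add: le_fun_def)
      then have "qf \<theta> ?c (sdim (img f W)) \<le> 0" using P subrep_img[OF f(1) B(1) W] by blast
      then show "qf \<theta> ?c (sdim W) \<le> 0" using sdim_img[OF f(2) W] by simp
    qed
  next
    assume Q: ?Q
    show ?P
    proof (intro allI impI, elim conjE)
      fix W assume W: "subrep X W" and le: "W \<le> U"
      let ?W = "\<lambda>i. if i \<in> V then {x \<in> kvec (rdim B i). f i x \<in> W i} else {0}"
      have sW: "subrep B ?W" by (rule subrep_vimage[OF f(1) B(1) W])
      have "img f ?W = W"
      proof
        fix i
        show "img f ?W i = W i"
        proof (cases "i \<in> V")
          case True
          have "W i \<subseteq> f i ` kvec (rdim B i)" using le f(3)[rule_format, OF True] by (simp add: le_fun_def)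
          then have "f i ` {x \<in> kvec (rdim B i). f i x \<in> W i} = W i" by blast
          then show ?thesis using True by (simp add: img_def)
        next
          case False
          then show ?thesis using out[OF W False] by (simp add: img_def)
        qed
      qed
      then have "sdim W = sdim ?W" using sdim_img[OF f(2) sW] by simp
      then show "qf \<theta> ?c (sdim W) \<le> 0" using Q sW by simp
    qed
  qed
  have gdim: "sdim W i = sdim (img g W) i + sdim U i" if W: "subrep X W" "U \<le> W" for W i
  proof (cases "i \<in> V")
    case True
    have "W i \<subseteq> kvec (rdim X i)" using ksubspaceD(1)[OF subrep_sub[OF W(1)]] by blast
    moreover have "U i \<subseteq> W i" using W(2) by (simp add: le_fun_def)
    ultimately have "{x \<in> W i. g i x = 0} = U i" using gk[rule_format, OF True] by blast
    then show ?thesis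
      using vdim_rank_nullity[OF hom_lin[OF g(1) True] subrep_sub[OF W(1)]] True
      by (simp add: sdim_def img_def)
  qed (simp add: sdim_def)
  \<comment> \<open>At its own slope \<open>U\<close> contributes 0, so \<open>W\<close> and
    \<open>W/U\<close> have the same value. This is the advantage of the additive \<open>qf\<close>
    over the slope.\<close>
  have qg: "qf \<theta> ?c (sdim W) = qf \<theta> ?c (sdim (img g W))" if "subrep X W" "U \<le> W" for W
    using qf_add[of "sdim W" "sdim (img g W)" "sdim U" \<theta> ?c] gdim[OF that] by (simp add: qf_slope_self)
  have 2: "(\<forall>W. subrep X W \<and> U \<le> W \<and> W \<noteq> U \<longrightarrow> qf \<theta> ?c (sdim W) < 0) \<longleftrightarrow>
      (\<forall>W. subrep A W \<and> nzd (sdim W) \<longrightarrow> qf \<theta> ?c (sdim W) < 0)" (is "?P \<longleftrightarrow> ?Q")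
  proof
    assume P: ?P
    show ?Q
    proof (intro allI impI, elim conjE)
      fix W assume W: "subrep A W" and nz: "nzd (sdim W)"
      let ?W = "\<lambda>i. if i \<in> V then {x \<in> kvec (rdim X i). g i x \<in> W i} else {0}"
      have sW: "subrep X ?W" by (rule subrep_vimage[OF g(1) X W])
      have UW: "U \<le> ?W"
        unfolding le_fun_def
      proof
        fix i
        show "U i \<le> ?W i"
        proof (cases "i \<in> V")
          case True
          have "{x \<in> kvec (rdim X i). g i x = 0} \<subseteq> {x \<in> kvec (rdim X i). g i x \<in> W i}"
            using ksubspaceD(2)[OF subrep_sub[OF W, of i]] by auto
          then show ?thesis using gk[rule_format, OF True] True by simp
        next
          case False
          then show ?thesis using out[OF U False] by simp
        qed
      qed
      have im: "img g ?W = W"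
      proof
        fix i
        show "img g ?W i = W i"
        proof (cases "i \<in> V")
          case True
          have "W i \<subseteq> kvec (rdim A i)" using ksubspaceD(1)[OF subrep_sub[OF W]] by blast
          then have "W i \<subseteq> g i ` kvec (rdim X i)" using g(2) True unfolding hom_surj_def by blast
          then have "g i ` {x \<in> kvec (rdim X i). g i x \<in> W i} = W i" by blast
          then show ?thesis using True by (simp add: img_def)
        next
          case False
          then show ?thesis using subrep_outside[OF A(1) W False] by (simp add: img_def)
        qed
      qed
      have "?W \<noteq> U"
      proof
        assume e: "?W = U"
        have "sdim ?W i = sdim W i + sdim U i" for i using gdim[OF sW UW, of i] unfolding im .
        then have "sdim W i = 0" for i unfolding e by simp
        then show False using nz by (simp add: nzd_def)
      qed
      then have "qf \<theta> ?c (sdim ?W) < 0" using P sW UW by blast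
      then show "qf \<theta> ?c (sdim W) < 0" using qg[OF sW UW] im by simp
    qed
  next
    assume Q: ?Q
    show ?P
    proof (intro allI impI, elim conjE)
      fix W assume W: "subrep X W" and le: "U \<le> W" and ne: "W \<noteq> U"
      have "nzd (sdim (img g W))"
      proof (rule ccontr)
        assume "\<not> nzd (sdim (img g W))"
        then have "sdim W i \<le> sdim U i" if "i \<in> V" for i
          using gdim[OF W le, of i] that by (simp add: nzd_def)
        then have "U = W" by (rule sdim_eq[OF X U W le])
        then show False using ne by simp
      qed
      then show "qf \<theta> ?c (sdim W) < 0" using Q subrep_img[OF g(1) X W] qg[OF W le] by simp
    qed
  qed
  show ?thesis unfolding destab_def 1 2 semistable_def slope_below_def
    using U A B sub_iso_dim[OF B(2,1)] by auto
qed

text \<open>By \<open>destab_iff\<close> the conditions on the types of \<open>U\<close> and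
  \<open>X/U\<close> that define the product merge into one condition on \<open>U\<close> inside
  \<open>X\<close>.\<close>

lemma hall_mult_stability:
  assumes d: "\<And>i. i \<notin> V \<Longrightarrow> d i = 0" and e: "e \<le> d" "nzd e" and c: "c \<in> iso_classes"
  shows "hall_mult (chi (slope_below \<theta> (slope \<theta> e) (\<lambda>i. d i - e i))) (chi (semistable \<theta> e)) c =
    of_nat (card {U. destab \<theta> (rep_of c :: ('v, 'e, 'k::{finite,field}) qrep) U \<and> sdim U = e \<and> rdim (rep_of c) = d})"
proof -
  let ?X = "rep_of c"
  let ?A = "slope_below \<theta> (slope \<theta> e) (\<lambda>i. d i - e i) :: ('v, 'e, 'k) qrep set"
  let ?B = "semistable \<theta> e :: ('v, 'e, 'k) qrep set"
  have X: "wf_rep ?X" by (rule rep_of_class(1)[OF c])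
  have dims: "?A \<subseteq> reps (\<lambda>i. d i - e i)" "?B \<subseteq> reps e"
    by (auto simp: slope_below_def semistable_def reps_def)
  have "{U. subrep ?X U \<and> (\<exists>B\<in>?B. sub_iso ?X U B) \<and> (\<exists>A\<in>?A. quo_iso ?X U A)} =
      {U. destab \<theta> ?X U \<and> sdim U = e \<and> rdim ?X = d}" (is "?L = ?R")
  proof (intro equalityI subsetI)
    fix U assume "U \<in> ?L"
    then obtain A B where U: "subrep ?X U" "B \<in> ?B" "sub_iso ?X U B" "A \<in> ?A" "quo_iso ?X U A" by blast
    have w: "wf_rep B" "rdim B = e" "wf_rep A" "rdim A = (\<lambda>i. d i - e i)"
      using U(2,4) by (auto simp: slope_below_def semistable_def)
    have s: "sdim U = e" using sub_iso_dim[OF U(3) w(1)] w(2) by simp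
    have "rdim ?X i = d i" for i using quo_iso_dim[OF U(5) w(3) X, of i] s w(4) e(1) by (simp add: le_fun_def)
    then have "rdim ?X = d" by blast
    moreover have "destab \<theta> ?X U"
      using destab_iff[OF X U(1) w(1) U(3) w(3) U(5)] s w(4) U(2,4) e(2) by simp
    ultimately show "U \<in> ?R" using s by simp
  next
    fix U assume "U \<in> ?R"
    then have U: "destab \<theta> ?X U" "sdim U = e" "rdim ?X = d" by auto
    have sU: "subrep ?X U" using U(1) by (simp add: destab_def)
    obtain B where B: "wf_rep B" "sub_iso ?X U B" using sub_exists[OF X sU] by blast
    obtain A where A: "wf_rep A" "quo_iso ?X U A" using quo_exists[OF X sU] by blast
    have "rdim A = (\<lambda>i. d i - e i)" using quo_iso_dim[OF A(2,1) X] U(2,3) by (auto simp: fun_eq_iff)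
    then have "B \<in> ?B" "A \<in> ?A" using destab_iff[OF X sU B A] U(1,2) by auto
    then show "U \<in> ?L" using sU B(2) A(2) by blast
  qed
  then show ?thesis
    using hall_mult_chi[OF iso_closed_stability(2) iso_closed_stability(1) dims c] by simp
qed

definition subdims :: "('v \<Rightarrow> nat) \<Rightarrow> ('v \<Rightarrow> nat) set" where
  "subdims d = {e. e \<le> d \<and> nzd e}"

lemma finite_subdims:
  assumes "\<And>i. i \<notin> V \<Longrightarrow> d i = (0::nat)"
  shows "finite (subdims d)"
proof (rule finite_subset)
  let ?M = "{..\<Sum>i\<in>V. d i}"
  show "finite {e. \<forall>i. (i \<in> V \<longrightarrow> e i \<in> ?M) \<and> (i \<notin> V \<longrightarrow> e i = 0)}"
    by (rule finite_set_of_finite_funs) (simp_all add: finite_V)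
  show "subdims d \<subseteq> {e. \<forall>i. (i \<in> V \<longrightarrow> e i \<in> ?M) \<and> (i \<notin> V \<longrightarrow> e i = 0)}"
  proof (intro subsetI CollectI allI conjI impI)
    fix e i assume "e \<in> subdims d"
    then have le: "e i \<le> d i" by (simp add: subdims_def le_fun_def)
    show "e i \<in> ?M" if "i \<in> V" using le member_le_sum[OF that, of d] finite_V by auto
    show "e i = 0" if "i \<notin> V" using le assms[OF that] by simp
  qed
qed

text \<open>Since the destabilizing subrepresentation is unique, summing over its dimension vector
  counts each class at most once. The predicate \<open>R\<close> is used twice: constantly true for
  the sum of all classes, and as a bound on the slope for \<open>slope_below\<close>.\<close>

lemma stability_sum:
  assumes d: "\<And>i. i \<notin> V \<Longrightarrow> d i = 0"
  shows "(\<Sum>e\<in>{e \<in> subdims d. R (slope \<theta> e)}.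
      hall_mult (chi (slope_below \<theta> (slope \<theta> e) (\<lambda>i. d i - e i))) (chi (semistable \<theta> e)) c) =
    (if c \<in> iso_classes \<and> rdim (rep_of c :: ('v, 'e, 'k::{finite,field}) qrep) = d \<and>
      (\<exists>U. destab \<theta> (rep_of c) U \<and> R (slope \<theta> (sdim U))) then 1 else 0)"
proof (cases "c \<in> iso_classes")
  case False
  then show ?thesis by (simp add: hall_mult_outside)
next
  case True
  let ?X = "rep_of c" and ?D = "{e \<in> subdims d. R (slope \<theta> e)}"
  let ?S = "\<lambda>e. {U. destab \<theta> ?X U \<and> sdim U = e \<and> rdim ?X = d}"
  have X: "wf_rep ?X" by (rule rep_of_class(1)[OF True])
  have "(\<Sum>e\<in>?D. hall_mult (chi (slope_below \<theta> (slope \<theta> e) (\<lambda>i. d i - e i))) (chi (semistable \<theta> e)) c)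
      = (\<Sum>e\<in>?D. of_nat (card (?S e)))"
    by (rule sum.cong[OF refl], rule hall_mult_stability[OF d _ _ True]) (auto simp: subdims_def)
  also have "\<dots> = (if rdim ?X = d \<and> (\<exists>U. destab \<theta> ?X U \<and> R (slope \<theta> (sdim U))) then 1 else 0)"
  proof (cases "rdim ?X = d \<and> (\<exists>U. destab \<theta> ?X U \<and> R (slope \<theta> (sdim U)))")
    case False
    have "card (?S e) = 0" if e: "e \<in> ?D" for e
    proof -
      have "?S e = {}" using False e by auto
      then show ?thesis by (simp only: card.empty)
    qed
    then have "(\<Sum>e\<in>?D. of_nat (card (?S e)) :: rat) = 0" by (intro sum.neutral) simp
    then show ?thesis using False by simp
  next
    case T: True
    then obtain U where U: "destab \<theta> ?X U" "R (slope \<theta> (sdim U))" by blast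
    have sU: "subrep ?X U" "nzd (sdim U)" using U(1) by (simp_all add: destab_def)
    have "sdim U i \<le> d i" for i
      using sdim_mono[OF sU(1) subrep_full[OF X] subrep_le_full[OF sU(1)], of i, unfolded sdim_full[OF X]] T
      by simp
    then have UD: "sdim U \<in> ?D" using sU(2) U(2) by (simp add: subdims_def le_fun_def)
    have u: "W = U" if "destab \<theta> ?X W" for W by (rule destab_unique[OF X that U(1)])
    have "card (?S e) = (if e = sdim U then 1 else 0)" for e
    proof (cases "e = sdim U")
      case True
      have "?S e = {U}"
      proof (intro equalityI subsetI)
        fix W assume "W \<in> ?S e"
        then show "W \<in> {U}" using u by simp
      next
        fix W assume "W \<in> {U}"
        then show "W \<in> ?S e" using U(1) T True by simp
      qed
      then show ?thesis using True by (simp only: if_True) simp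
    next
      case False
      have "W \<notin> ?S e" for W using u[of W] False by auto
      then have "?S e = {}" by blast
      then show ?thesis using False by (simp only: card.empty if_False)
    qed
    then have "(\<Sum>e\<in>?D. of_nat (card (?S e)) :: rat) = (\<Sum>e\<in>?D. if e = sdim U then 1 else 0)"
      by (intro sum.cong) auto
    also have "\<dots> = 1" using UD finite_subdims[of d, OF d] by (simp add: sum.delta')
    finally show ?thesis using T by simp
  qed
  finally show ?thesis using True by simp
qed

text \<open>The term \<open>e = d\<close> of the recursion: a subrepresentation of full dimension is
  the whole of \<open>X\<close>, which is destabilizing exactly when \<open>X\<close> is
  semistable.\<close>

lemma semistable_full:
  assumes d: "\<And>i. i \<notin> V \<Longrightarrow> d i = 0" and nz: "nzd d"
  shows "hall_mult (chi (slope_below \<theta> (slope \<theta> d) (\<lambda>i. d i - d i))) (chi (semistable \<theta> d)) =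
    chi (semistable \<theta> d :: ('v, 'e, 'k::{finite,field}) qrep set)"
proof
  fix c :: "('v, 'e, 'k) qrep set"
  show "hall_mult (chi (slope_below \<theta> (slope \<theta> d) (\<lambda>i. d i - d i))) (chi (semistable \<theta> d)) c =
    chi (semistable \<theta> d) c"
  proof (cases "c \<in> iso_classes")
    case False
    then show ?thesis by (simp add: hall_mult_outside chi_iff[OF iso_closed_stability(1)])
  next
    case True
    let ?X = "rep_of c"
    let ?F = "\<lambda>i. kvec (rdim ?X i)"
    have X: "wf_rep ?X" by (rule rep_of_class(1)[OF True])
    have full: "U = ?F" if "subrep ?X U" "sdim U = d" "rdim ?X = d" for U
      by (rule sdim_eq[OF X that(1) subrep_full[OF X] subrep_le_full[OF that(1)]])
        (subst sdim_full[OF X], simp only: that(2,3) order_refl)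
    have iff: "destab \<theta> ?X ?F \<longleftrightarrow> ?X \<in> semistable \<theta> d" if r: "rdim ?X = d"
    proof -
      have "W = ?F" if "subrep ?X W" "?F \<le> W" for W
        using subrep_le_full[OF that(1)] that(2) by (rule antisym)
      then show ?thesis
        unfolding destab_def semistable_def sdim_full[OF X]
        using X r nz subrep_full[OF X] subrep_le_full by blast
    qed
    have "{U. destab \<theta> ?X U \<and> sdim U = d \<and> rdim ?X = d} = (if ?X \<in> semistable \<theta> d then {?F} else {})"
    proof (cases "rdim ?X = d")
      case r: True
      have "destab \<theta> ?X U \<and> sdim U = d \<longleftrightarrow> U = ?F \<and> ?X \<in> semistable \<theta> d" for U
      proof
        assume U: "destab \<theta> ?X U \<and> sdim U = d"
        then have "subrep ?X U" by (simp add: destab_def)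
        then have "U = ?F" using full U r by blast
        then show "U = ?F \<and> ?X \<in> semistable \<theta> d" using U iff[OF r] by blast
      next
        assume U: "U = ?F \<and> ?X \<in> semistable \<theta> d"
        then have "sdim U = rdim ?X" using sdim_full[OF X] by blast
        then show "destab \<theta> ?X U \<and> sdim U = d" using U iff[OF r] r by simp
      qed
      then show ?thesis using r by auto
    next
      case False
      then have "?X \<notin> semistable \<theta> d" by (simp add: semistable_def)
      then show ?thesis using False by simp
    qed
    then show ?thesis
      using hall_mult_stability[OF d order_refl nz True, of \<theta>] True
      by (simp add: chi_iff[OF iso_closed_stability(1)])
  qed
qed

text \<open>Both families are needed at once, since a term of the recursion multiplies a
  \<open>slope_below\<close> sum of dimension \<open>d - e\<close> with a semistable sum of
  dimension \<open>e\<close>.\<close>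

lemma stability_composition:
  fixes \<theta> :: "'v \<Rightarrow> real"
  assumes "\<And>i. i \<notin> V \<Longrightarrow> d i = 0"
  shows "chi (semistable \<theta> d :: ('v, 'e, 'k::{finite,field}) qrep set) \<in> composition_algebra \<and>
    (\<forall>c. chi (slope_below \<theta> c d :: ('v, 'e, 'k) qrep set) \<in> composition_algebra)"
  using assms
proof (induction "\<Sum>i\<in>V. d i" arbitrary: d rule: less_induct)
  case less
  let ?C = "composition_algebra :: (('v, 'e, 'k) qrep set \<Rightarrow> rat) set"
  let ?SS = "\<lambda>d. semistable \<theta> d :: ('v, 'e, 'k) qrep set"
  let ?GG = "\<lambda>c d. slope_below \<theta> c d :: ('v, 'e, 'k) qrep set"
  note d = less.prems
  show ?case
  proof (cases "nzd d")
    \<comment> \<open>For zero \<open>d\<close> every subrepresentation is zero, so both stability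
      conditions are void.\<close>
    case False
    have nz: "\<not> nzd (sdim W)" if "wf_rep X" "rdim X = d" "subrep X W" for X :: "('v, 'e, 'k) qrep" and W
      using sdim_mono[OF that(3) subrep_full[OF that(1)] subrep_le_full[OF that(3)]]
        sdim_full[OF that(1)] that(2) False unfolding nzd_def by (metis le_zero_eq)
    have "?SS d = reps d" using nz qf_zero by (auto simp: semistable_def reps_def)
    moreover have "?GG c d = reps d" for c using nz by (auto simp: slope_below_def reps_def)
    ultimately show ?thesis using chi_reps_composition by simp
  next
    case nz: True
    let ?T = "\<lambda>e. hall_mult (chi (?GG (slope \<theta> e) (\<lambda>i. d i - e i))) (chi (?SS e))"
    \<comment> \<open>As \<open>e\<close> is nonzero and different from \<open>d\<close>, both
      \<open>e\<close> and \<open>d - e\<close> have smaller total dimension than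
      \<open>d\<close>.\<close>
    have small: "?T e \<in> ?C" if e: "e \<in> subdims d" "e \<noteq> d" for e
    proof -
      have le: "e i \<le> d i" for i using e(1) by (simp add: subdims_def le_fun_def)
      have eo: "e i = 0" if "i \<notin> V" for i using le[of i] d[OF that] by simp
      have "\<exists>i\<in>V. e i < d i"
      proof (rule ccontr)
        assume "\<not> (\<exists>i\<in>V. e i < d i)"
        then have "e i = d i" for i using le[of i] eo[of i] d[of i] by (cases "i \<in> V") force+
        then show False using e(2) by blast
      qed
      then have "(\<Sum>i\<in>V. e i) < (\<Sum>i\<in>V. d i)"
        by (intro sum_strict_mono_ex1[OF finite_V]) (use le in auto)
      then have 1: "chi (?SS e) \<in> ?C" using less.hyps eo by blast
      have "\<exists>i\<in>V. d i - e i < d i"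
      proof -
        obtain i where "i \<in> V" "e i \<noteq> 0" using e(1) by (auto simp: subdims_def nzd_def)
        then show ?thesis using le[of i] by (intro bexI[of _ i]) auto
      qed
      then have "(\<Sum>i\<in>V. d i - e i) < (\<Sum>i\<in>V. d i)"
        by (intro sum_strict_mono_ex1[OF finite_V]) auto
      then have 2: "chi (?GG (slope \<theta> e) (\<lambda>i. d i - e i)) \<in> ?C" using less.hyps d by simp
      show ?thesis using hall_subalg.mult[OF 2[unfolded composition_algebra_def] 1[unfolded composition_algebra_def]]
        by (simp only: composition_algebra_def)
    qed
    have Td: "?T d = chi (?SS d)" by (rule semistable_full[OF d nz])
    have ex: "\<exists>U. destab \<theta> X U \<and> (\<forall>W. subrep X W \<longrightarrow> qf \<theta> (slope \<theta> (sdim U)) (sdim W) \<le> 0)"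
      if "wf_rep X" "rdim X = d" for X :: "('v, 'e, 'k) qrep"
      using destab_exists[OF that(1)] nz that(2) by simp
    have fin: "finite (subdims d)" by (rule finite_subdims[OF d])
    have dd: "d \<in> subdims d" using nz by (simp add: subdims_def)
    have SS: "chi (?SS d) \<in> ?C"
    proof -
      \<comment> \<open>Every representation has a destabilizing subrepresentation, so the terms for
        all \<open>e\<close> add up to the full sum over \<open>d\<close>; the semistable sum is the
        term \<open>e = d\<close>, isolated by subtraction.\<close>
      have "chi (?SS d) = (\<lambda>c. chi (reps d) c - (\<Sum>e\<in>subdims d - {d}. ?T e c))"
      proof
        fix c :: "('v, 'e, 'k) qrep set"
        have s: "(\<Sum>e\<in>{e \<in> subdims d. True}. ?T e c) = (if c \<in> iso_classes \<and> rdim (rep_of c) = d \<and>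
            (\<exists>U. destab \<theta> (rep_of c) U \<and> True) then 1 else 0)"
          by (rule stability_sum[where d = d and R = "\<lambda>_. True", OF d])
        have "c \<in> iso_classes \<and> rep_of c \<in> reps d \<longleftrightarrow> c \<in> iso_classes \<and> rdim (rep_of c) = d \<and>
            (\<exists>U. destab \<theta> (rep_of c) U \<and> True)"
          using ex[OF rep_of_class(1)] rep_of_class(1) unfolding reps_def by blast
        then have "chi (reps d) c = (\<Sum>e\<in>{e \<in> subdims d. True}. ?T e c)"
          unfolding s chi_iff[OF iso_closed_reps] by (simp only:)
        then have "chi (reps d) c = (\<Sum>e\<in>subdims d. ?T e c)" by simp
        then show "chi (?SS d) c = chi (reps d) c - (\<Sum>e\<in>subdims d - {d}. ?T e c)"
          using sum.remove[OF fin dd, of "\<lambda>e. ?T e c"] unfolding Td by simp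
      qed
      moreover have "(\<lambda>c. \<Sum>e\<in>subdims d - {d}. ?T e c) \<in> ?C"
        unfolding composition_algebra_def
        by (rule hall_subalg_sum) (use fin small in \<open>auto simp: composition_algebra_def\<close>)
      ultimately show ?thesis
        using hall_subalg_diff chi_reps_composition[of d] by (simp add: composition_algebra_def)
    qed
    have "chi (?GG m d) \<in> ?C" for m
    proof -
      \<comment> \<open>The destabilizing subrepresentation attains the maximal slope, so all slopes
        lie below \<open>m\<close> exactly when its slope does. The term \<open>e = d\<close> may
        now occur, having just been placed in the algebra.\<close>
      have iff: "X \<in> ?GG m d \<longleftrightarrow> rdim X = d \<and> (\<exists>U. destab \<theta> X U \<and> slope \<theta> (sdim U) < m)"
        if X: "wf_rep X" for X
      proof
        assume G: "X \<in> ?GG m d"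
        then have r: "rdim X = d" by (simp add: slope_below_def)
        obtain U where U: "destab \<theta> X U" using ex[OF X r] by blast
        then have "subrep X U" "nzd (sdim U)" by (simp_all add: destab_def)
        then have "qf \<theta> m (sdim U) < 0" using G by (simp add: slope_below_def)
        then show "rdim X = d \<and> (\<exists>U. destab \<theta> X U \<and> slope \<theta> (sdim U) < m)"
          using qf_slope(2)[OF \<open>nzd (sdim U)\<close>] r U by blast
      next
        assume *: "rdim X = d \<and> (\<exists>U. destab \<theta> X U \<and> slope \<theta> (sdim U) < m)"
        then obtain U where U: "destab \<theta> X U" "slope \<theta> (sdim U) < m" by blast
        obtain U' where U': "destab \<theta> X U'"
          "\<forall>W. subrep X W \<longrightarrow> qf \<theta> (slope \<theta> (sdim U')) (sdim W) \<le> 0" using ex[OF X] * by blast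
        have "U' = U" by (rule destab_unique[OF X U'(1) U(1)])
        have "qf \<theta> m (sdim W) < 0" if W: "subrep X W" "nzd (sdim W)" for W
        proof -
          have "slope \<theta> (sdim W) \<le> slope \<theta> (sdim U)"
            using U'(2) W(1) qf_slope(1)[OF W(2)] \<open>U' = U\<close> by blast
          then show ?thesis using qf_slope(2)[OF W(2)] U(2) by simp
        qed
        then show "X \<in> ?GG m d" using X * by (simp add: slope_below_def)
      qed
      have "chi (?GG m d) = (\<lambda>c. \<Sum>e\<in>{e \<in> subdims d. slope \<theta> e < m}. ?T e c)"
      proof
        fix c :: "('v, 'e, 'k) qrep set"
        show "chi (?GG m d) c = (\<Sum>e\<in>{e \<in> subdims d. slope \<theta> e < m}. ?T e c)"
        proof -
          have s: "(\<Sum>e\<in>{e \<in> subdims d. slope \<theta> e < m}. ?T e c) = (if c \<in> iso_classes \<and>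
              rdim (rep_of c) = d \<and> (\<exists>U. destab \<theta> (rep_of c) U \<and> slope \<theta> (sdim U) < m) then 1 else 0)"
            by (rule stability_sum[where d = d and R = "\<lambda>x. x < m", OF d])
          have i: "c \<in> iso_classes \<and> rep_of c \<in> ?GG m d \<longleftrightarrow> c \<in> iso_classes \<and> rdim (rep_of c) = d \<and>
              (\<exists>U. destab \<theta> (rep_of c) U \<and> slope \<theta> (sdim U) < m)"
            using iff[OF rep_of_class(1)] by blast
          have "chi (?GG m d) c = (if c \<in> iso_classes \<and> rep_of c \<in> ?GG m d then 1 else 0)"
            by (rule chi_iff[OF iso_closed_stability(2)])
          from trans[OF trans[OF this if_cong[OF i refl refl]] s[symmetric]] show ?thesis .
        qed
      qed
      moreover have "?T e \<in> ?C" if "e \<in> subdims d" for e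
      proof (cases "e = d")
        case True
        show ?thesis unfolding True Td by (rule SS)
      qed (rule small[OF that])
      then have "(\<lambda>c. \<Sum>e\<in>{e \<in> subdims d. slope \<theta> e < m}. ?T e c) \<in> ?C"
        unfolding composition_algebra_def
        by (intro hall_subalg_sum) (use fin in \<open>auto simp: composition_algebra_def\<close>)
      ultimately show ?thesis by simp
    qed
    then show ?thesis using SS by blast
  qed
qed

subsection \<open>Exceptional representations are stable\<close>

text \<open>The weight \<open>d \<mapsto> \<langle>n, d\<rangle> - \<langle>d, n\<rangle>\<close>.\<close>

definition canonical_weight :: "('v \<Rightarrow> nat) \<Rightarrow> 'v \<Rightarrow> real" where
  "canonical_weight n i = (\<Sum>a\<in>E. (if src a = i then real (n (tgt a)) else 0)
     - (if tgt a = i then real (n (src a)) else 0))"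

text \<open>The vertex sums of the two Euler forms agree and cancel; exchanging summation collects
  the arrow terms at their end points.\<close>

lemma canonical_weight_sum:
  "(\<Sum>i\<in>V. canonical_weight n i * real (d i)) = real_of_int (euler n d - euler d n)"
proof -
  have "(\<Sum>i\<in>V. canonical_weight n i * real (d i)) =
    (\<Sum>i\<in>V. \<Sum>a\<in>E. (if src a = i then real (n (tgt a)) * real (d i) else 0)
      - (if tgt a = i then real (n (src a)) * real (d i) else 0))"
    unfolding canonical_weight_def sum_distrib_right
    by (intro sum.cong refl) (simp add: left_diff_distrib)
  also have "\<dots> = (\<Sum>a\<in>E. \<Sum>i\<in>V. (if src a = i then real (n (tgt a)) * real (d i) else 0)
      - (if tgt a = i then real (n (src a)) * real (d i) else 0))"
    by (rule sum.swap)
  also have "\<dots> = (\<Sum>a\<in>E. real (n (tgt a)) * real (d (src a)) - real (n (src a)) * real (d (tgt a)))"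
    by (intro sum.cong refl) (simp add: sum_subtractf finite_V src_V tgt_V)
  finally show ?thesis by (simp add: euler_def sum_subtractf mult.commute)
qed

lemma exceptional_stable:
  fixes N :: "('v, 'e, 'k::{finite,field}) qrep"
  assumes N: "exceptional N" and U: "subrep N U" "nzd (sdim U)" and ne: "U \<noteq> (\<lambda>i. kvec (rdim N i))"
  shows "euler (rdim N) (sdim U) - euler (sdim U) (rdim N) < 0"
proof -
  have wf: "wf_rep N" by (rule exceptional_wf[OF N])
  obtain B where B: "wf_rep B" "sub_iso N U B" using sub_exists[OF wf U(1)] by blast
  note dB = sub_iso_dim[OF B(2,1)]
  obtain f where f: "is_hom B N f" "hom_inj B f" "\<forall>i\<in>V. f i ` kvec (rdim B i) = U i"
    using B(2) unfolding sub_iso_def by (elim exE conjE)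
  have fz: "x = 0" if "i \<in> V" "x \<in> kvec (rdim B i)" "f i x = 0" for i x
  proof -
    have "f i x = f i 0" using that(3) lin_zero[OF hom_lin[OF f(1) that(1)]] by simp
    then show ?thesis by (rule hom_injD[OF f(2) that(1) _ that(2) zero_in_kvec])
  qed
  \<comment> \<open>A nonzero map from \<open>N\<close> to \<open>B\<close> followed by the
    inclusion is a nonzero endomorphism of the brick \<open>N\<close>, hence onto, which forces
    \<open>U\<close> to be everything.\<close>
  have "hom_zero N B" unfolding hom_zero_def
  proof (intro allI impI ballI, rule ccontr)
    fix g i and x :: "nat \<Rightarrow> 'k"
    assume g: "is_hom N B g" and i: "i \<in> V" and x: "x \<in> kvec (rdim N i)" and nz: "g i x \<noteq> 0"
    have "f i (g i x) \<noteq> 0" using fz[OF i hom_inI[OF g i x]] nz by blast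
    moreover have "(\<forall>i\<in>V. \<forall>x\<in>kvec (rdim N i). f i (g i x) = 0) \<or>
        hom_inj N (\<lambda>i x. f i (g i x)) \<and> hom_surj N N (\<lambda>i x. f i (g i x))"
      using N hom_compose[OF g f(1)] unfolding exceptional_def brick_def by blast
    ultimately have s: "hom_surj N N (\<lambda>i x. f i (g i x))" using i x by blast
    have "U j = kvec (rdim N j)" for j
    proof (cases "j \<in> V")
      case True
      have "kvec (rdim N j) \<subseteq> f j ` kvec (rdim B j)"
      proof
        fix y :: "nat \<Rightarrow> 'k" assume "y \<in> kvec (rdim N j)"
        from hom_surjD[OF s True this] obtain z where z: "z \<in> kvec (rdim N j)" "y = f j (g j z)" by blast
        then show "y \<in> f j ` kvec (rdim B j)" using hom_inI[OF g True z(1)] by blast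
      qed
      then show ?thesis using f(3)[rule_format, OF True] ksubspaceD(1)[OF subrep_sub[OF U(1), of j]] by blast
    next
      case False
      then show ?thesis using subrep_outside[OF wf U(1) False] wf_rdim[OF wf False] by simp
    qed
    then show False using ne by blast
  qed
  then have 1: "euler (rdim N) (sdim U) \<le> 0" using euler_hom_zero[OF wf B(1)] dB by simp
  have "\<not> hom_zero B N"
  proof
    assume h: "hom_zero B N"
    have "rdim B i = 0" if i: "i \<in> V" for i
    proof (rule kvec_trivial[where 'k = 'k], intro equalityI subsetI)
      fix x :: "nat \<Rightarrow> 'k" assume x: "x \<in> kvec (rdim B i)"
      show "x \<in> {0}" using fz[OF i x hom_zeroD[OF h f(1) i x]] by simp
    qed simp
    then show False using U(2) dB by (simp add: nzd_def)
  qed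
  moreover have "ext_zero B N"
    using N ext_zero_sub[OF _ f(1,2)] unfolding exceptional_def by blast
  ultimately have "euler (sdim U) (rdim N) > 0" using euler_ext_zero[OF B(1) wf] dB by simp
  then show ?thesis using 1 by simp
qed

lemma semistable_exceptional:
  fixes N :: "('v, 'e, 'k::{finite,field}) qrep"
  assumes N: "exceptional N"
  shows "semistable (canonical_weight (rdim N)) (rdim N) = iso_class N"
proof -
  let ?n = "rdim N"
  let ?t = "canonical_weight ?n"
  have wf: "wf_rep N" by (rule exceptional_wf[OF N])
  \<comment> \<open>The weight comes from an antisymmetric form, so it vanishes on
    \<open>?n\<close>, and 0 is the slope to compare with.\<close>
  have s0: "slope ?t ?n = 0" by (simp add: slope_def canonical_weight_sum)
  have q: "qf ?t 0 d = real_of_int (euler ?n d - euler d ?n)" for d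
    by (simp add: qf_eq canonical_weight_sum)
  have stable: "qf ?t 0 (sdim U) < 0"
    if "subrep N U" "nzd (sdim U)" "U \<noteq> (\<lambda>i. kvec (?n i))" for U
    using exceptional_stable[OF N that] q[of "sdim U"] by simp
  have NS: "N \<in> semistable ?t ?n"
    unfolding semistable_def s0
  proof (intro CollectI conjI allI impI refl wf)
    fix W assume W: "subrep N W"
    show "qf ?t 0 (sdim W) \<le> 0"
    proof (cases "nzd (sdim W) \<and> W \<noteq> (\<lambda>i. kvec (?n i))")
      case True
      then show ?thesis using stable[OF W] by simp
    next
      case False
      then consider "\<not> nzd (sdim W)" | "W = (\<lambda>i. kvec (?n i))" by blast
      then show ?thesis
      proof cases
        case 2
        then have "sdim W = ?n" using sdim_full[OF wf] by blast
        then show ?thesis using q[of ?n] by simp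
      qed (simp add: qf_zero)
    qed
  qed
  show ?thesis
  proof (intro equalityI subsetI)
    fix M assume "M \<in> iso_class N"
    then show "M \<in> semistable ?t ?n"
      using NS iso_closed_stability(1)[of ?t ?n] unfolding iso_closed_def iso_class_def by blast
  next
    fix M :: "('v, 'e, 'k) qrep" assume "M \<in> semistable ?t ?n"
    then have M: "wf_rep M" "rdim M = ?n" and ss: "\<And>W. subrep M W \<Longrightarrow> qf ?t 0 (sdim W) \<le> 0"
      by (auto simp: semistable_def s0)
    obtain j where j: "j \<in> V" "?n j \<noteq> 0"
      using N unfolding exceptional_def brick_def is_zero_rep_def by blast
    have "\<not> hom_zero N N"
    proof
      assume "hom_zero N N"
      have "x = 0" if "x \<in> kvec (?n j)" for x :: "nat \<Rightarrow> 'k"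
        by (rule hom_zeroD[OF \<open>hom_zero N N\<close> hom_identity j(1) that])
      then have "kvec (?n j) = {0 :: nat \<Rightarrow> 'k}" by auto
      from kvec_trivial[OF this] show False using j(2) by simp
    qed
    \<comment> \<open>The Euler form sees only dimension vectors, so its positivity applies to the
      pair \<open>M\<close>, \<open>N\<close> and produces a nonzero map from \<open>M\<close> to
      \<open>N\<close>.\<close>
    then have "euler ?n ?n > 0"
      using N euler_ext_zero[OF wf wf] unfolding exceptional_def by blast
    then have "\<not> hom_zero M N" using euler_hom_zero[OF M(1) wf] M(2) by fastforce
    then obtain v i x where v: "is_hom M N v" and i: "i \<in> V" "x \<in> kvec (rdim M i)" "v i x \<noteq> 0"
      unfolding hom_zero_def by blast
    let ?F = "\<lambda>i. kvec (rdim M i)"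
    let ?K = "\<lambda>i. if i \<in> V then {x \<in> kvec (rdim M i). v i x = 0} else {0}"
    have I: "subrep N (img v ?F)" by (rule subrep_img[OF v M(1) subrep_full[OF M(1)]])
    have K: "subrep M ?K" by (rule subrep_kernel[OF v M(1) wf])
    have rn: "?n i = sdim (img v ?F) i + sdim ?K i" if "i \<in> V" for i
      using vdim_rank_nullity[OF hom_lin[OF v that] ksubspace_kvec] that M(2)
      by (simp add: sdim_def img_def)
    have nzI: "nzd (sdim (img v ?F))"
    proof (rule ccontr)
      assume "\<not> nzd (sdim (img v ?F))"
      then have "vdim {0 :: nat \<Rightarrow> 'k} = vdim (v i ` kvec (rdim M i))"
        using i(1) by (simp add: nzd_def sdim_def img_def)
      moreover have s: "ksubspace (?n i) (v i ` kvec (rdim M i))"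
        by (rule ksubspace_image[OF hom_lin[OF v i(1)]]) simp
      ultimately have "{0} = v i ` kvec (rdim M i)"
        using ksubspaceD(2)[OF s] by (intro vdim_eq[OF ksubspace_zero s]) auto
      then show False using i(2,3) by blast
    qed
    \<comment> \<open>The weight of \<open>?n\<close> is 0 and splits between image and kernel of
      \<open>v\<close>. A proper image is negative by stability of \<open>N\<close>, so the kernel
      would be positive, against semistability of \<open>M\<close>.\<close>
    have full: "img v ?F = (\<lambda>i. kvec (?n i))"
    proof (rule ccontr)
      assume "img v ?F \<noteq> (\<lambda>i. kvec (?n i))"
      then have "qf ?t 0 (sdim (img v ?F)) < 0" using stable[OF I nzI] by blast
      moreover have "qf ?t 0 ?n = qf ?t 0 (sdim (img v ?F)) + qf ?t 0 (sdim ?K)"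
        by (rule qf_add[OF rn])
      ultimately show False using ss[OF K] q[of ?n] by simp
    qed
    have "hom_surj M N v" unfolding hom_surj_def
    proof
      fix i assume "i \<in> V"
      then show "v i ` kvec (rdim M i) = kvec (?n i)" using fun_cong[OF full, of i] by (simp add: img_def)
    qed
    moreover from this have "hom_inj M v"
      unfolding hom_surj_def hom_inj_def M(2) by (auto intro!: eq_card_imp_inj_on)
    ultimately have "rep_iso M N" using v unfolding rep_iso_def by blast
    then show "M \<in> iso_class N" using rep_iso_sym[OF _ M(1) wf] M(1) by (simp add: iso_class_def)
  qed
qed

lemma exceptional_composition:
  fixes N :: "('v, 'e, 'k::{finite,field}) qrep"
  assumes N: "exceptional N"
  shows "hall_basis (iso_class N) \<in> composition_algebra"
proof -
  have wf: "wf_rep N" by (rule exceptional_wf[OF N])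
  have "chi (semistable (canonical_weight (rdim N)) (rdim N) :: ('v, 'e, 'k) qrep set) \<in> composition_algebra"
    using stability_composition[of "rdim N"] wf_rdim[OF wf] by blast
  then show ?thesis unfolding semistable_exceptional[OF N] chi_iso_class[OF wf] .
qed

subsection \<open>Preprojective and preinjective modules\<close>

lemma zero_composition:
  fixes X :: "('v, 'e, 'k::{finite,field}) qrep"
  assumes X: "wf_rep X" "is_zero_rep X"
  shows "hall_basis (iso_class X) \<in> composition_algebra"
proof -
  have "reps (rdim X) = (iso_class zero_rep :: ('v, 'e, 'k) qrep set)"
    by (rule reps_zero) (use X wf_rdim[OF X(1)] in \<open>auto simp: is_zero_rep_def\<close>)
  moreover have "X \<in> reps (rdim X)" using X(1) by (simp add: reps_def)
  ultimately have "rep_iso zero_rep X" by (simp add: iso_class_def)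
  moreover have "wf_rep (zero_rep :: ('v, 'e, 'k) qrep)"
    by (simp add: wf_rep_def zero_rep_def lin_on_def)
  ultimately have e: "iso_class X = iso_class zero_rep" using iso_class_eq_iff X(1) by blast
  show ?thesis unfolding composition_algebra_def e by (rule hall_subalg.one)
qed

lemma minimal_summand:
  fixes X :: "('v, 'e, 'k::{finite,field}) qrep"
  assumes X: "wf_rep X" "\<not> is_zero_rep X"
    and lev: "\<forall>Y. indecomposable Y \<and> direct_summand Y X \<longrightarrow> (\<exists>n::nat. lev n Y)"
  shows "\<exists>Y n. indecomposable Y \<and> direct_summand Y X \<and> lev n Y \<and>
    (\<forall>Z m. indecomposable Z \<and> direct_summand Z X \<and> lev m Z \<longrightarrow> n \<le> m)"
proof -
  let ?P = "\<lambda>n. \<exists>Y. indecomposable Y \<and> direct_summand Y X \<and> lev n Y"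
  have "\<exists>n. ?P n" using indecomposable_summand_exists[OF X] lev by blast
  then have "?P (Least ?P)" by (rule LeastI_ex)
  then obtain Y where "indecomposable Y" "direct_summand Y X" "lev (Least ?P) Y" by blast
  moreover have "Least ?P \<le> m" if "indecomposable Z" "direct_summand Z X" "lev m Z" for Z m
    by (rule Least_le) (use that in blast)
  ultimately show ?thesis by blast
qed

text \<open>A split sequence can be read backwards, so the split-off summand may serve as quotient
  or as subobject, depending on the direction in which Ext vanishes.\<close>

lemma ses_split_swap:
  fixes X :: "('v, 'e, 'k::field) qrep"
  assumes ses: "ses K X Y j r" and f: "is_hom Y X f" "\<forall>i\<in>V. \<forall>x\<in>kvec (rdim Y i). r i (f i x) = x"
    and q: "is_hom X K q" "\<forall>i\<in>V. \<forall>x\<in>kvec (rdim K i). q i (j i x) = x"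
      "\<forall>i\<in>V. \<forall>x\<in>kvec (rdim X i). j i (q i x) + f i (r i x) = x"
  shows "ses Y X K f q"
proof -
  have wf: "wf_rep K" "wf_rep X" "wf_rep Y" and j: "is_hom K X j" "hom_inj K j" and r: "is_hom X Y r"
    using ses by (auto simp: ses_def)
  have "hom_inj Y f" unfolding hom_inj_def inj_on_def using f(2) by metis
  moreover have "hom_surj X K q" unfolding hom_surj_def
  proof (intro ballI equalityI subsetI)
    fix i and y :: "nat \<Rightarrow> 'k" assume i: "i \<in> V" and y: "y \<in> kvec (rdim K i)"
    show "y \<in> q i ` kvec (rdim X i)"
      by (rule image_eqI[OF _ hom_inI[OF j(1) i y]]) (use q(2) i y in simp)
  qed (use hom_inI[OF q(1)] in blast)
  moreover have "{x \<in> kvec (rdim X i). q i x = 0} = f i ` kvec (rdim Y i)" if i: "i \<in> V" for i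
  proof (intro equalityI subsetI)
    fix x assume "x \<in> {x \<in> kvec (rdim X i). q i x = 0}"
    then have x: "x \<in> kvec (rdim X i)" "q i x = 0" by auto
    have "x = f i (r i x)" using q(3)[rule_format, OF i x(1)] x(2) lin_zero[OF hom_lin[OF j(1) i]] by simp
    then show "x \<in> f i ` kvec (rdim Y i)" by (rule image_eqI[OF _ hom_inI[OF r i x(1)]])
  next
    fix x assume "x \<in> f i ` kvec (rdim Y i)"
    then obtain y where y: "y \<in> kvec (rdim Y i)" "x = f i y" by blast
    have x: "x \<in> kvec (rdim X i)" using hom_inI[OF f(1) i y(1)] y(2) by simp
    have "r i x = y" using f(2) i y by simp
    then have "j i (q i x) + x = x" using q(3)[rule_format, OF i x] y(2) by simp
    then have "j i (q i x) = j i 0" using lin_zero[OF hom_lin[OF j(1) i]] by simp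
    then have "q i x = 0" by (rule hom_injD[OF j(2) i _ hom_inI[OF q(1) i x] zero_in_kvec])
    then show "x \<in> {x \<in> kvec (rdim X i). q i x = 0}" using x by simp
  qed
  ultimately show ?thesis unfolding ses_def using wf f(1) q(1) by blast
qed

text \<open>\<open>lev\<close> stands for \<open>proj_level\<close> or \<open>inj_level\<close>. The
  first alternative of the Ext hypothesis is the preprojective one, where the summand of least level
  becomes the quotient; the second is the preinjective one, where it becomes the subobject.\<close>

lemma level_composition:
  fixes X :: "('v, 'e, 'k::{finite,field}) qrep"
  assumes exc: "\<And>n Y. lev n Y \<Longrightarrow> exceptional Y"
    and ext: "(\<forall>n m Y Z. lev n Y \<and> lev m Z \<and> n \<le> m \<longrightarrow> ext_zero Y Z) \<or>
      (\<forall>n m Y Z. lev n Y \<and> lev m Z \<and> n \<le> m \<longrightarrow> ext_zero Z Y)"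
    and "wf_rep X" "\<And>Y. indecomposable Y \<Longrightarrow> direct_summand Y X \<Longrightarrow> \<exists>n::nat. lev n Y"
  shows "hall_basis (iso_class X) \<in> composition_algebra"
  using assms(3,4)
proof (induction "tdim X" arbitrary: X rule: less_induct)
  case less
  note X = less.prems(1) and lv = less.prems(2)
  show ?case
  proof (cases "is_zero_rep X")
    case True
    then show ?thesis by (rule zero_composition[OF X])
  next
    case False
    have "\<forall>Y. indecomposable Y \<and> direct_summand Y X \<longrightarrow> (\<exists>n. lev n Y)" using lv by blast
    from minimal_summand[OF X False this] obtain Y n where Y: "indecomposable Y"
      "direct_summand Y X" "lev n Y"
      and min: "\<forall>Z m. indecomposable Z \<and> direct_summand Z X \<and> lev m Z \<longrightarrow> n \<le> m"
      by (elim exE conjE)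
    note eY = exc[OF Y(3)]
    note wY = exceptional_wf[OF eY]
    obtain f r where f: "is_hom Y X f" "is_hom X Y r" "\<forall>i\<in>V. \<forall>x\<in>kvec (rdim Y i). r i (f i x) = x"
      by (rule direct_summandE[OF Y(2)])
    from summand_complement[OF f X wY] obtain K j q where ses: "ses K X Y j r"
      and q: "is_hom X K q" "\<forall>i\<in>V. \<forall>x\<in>kvec (rdim K i). q i (j i x) = x"
        "\<forall>i\<in>V. \<forall>x\<in>kvec (rdim X i). j i (q i x) + f i (r i x) = x" by (elim exE conjE)
    have K: "wf_rep K" and j: "is_hom K X j" using ses by (auto simp: ses_def)
    have KX: "direct_summand K X" by (rule direct_summandI[OF j q(1)]) (use q(2) in blast)
    have sub: "direct_summand Z X" if "direct_summand Z K" for Z :: "('v, 'e, 'k) qrep"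
      by (rule direct_summand_trans[OF that KX])
    have "tdim Y \<noteq> 0" using Y(1) by (simp add: tdim_zero indecomposable_def)
    then have "tdim K < tdim X" using ses_tdim[OF ses] by simp
    then have cK: "hall_basis (iso_class K) \<in> composition_algebra"
      by (rule less.hyps[OF _ K]) (use lv sub in blast)
    note cY = exceptional_composition[OF eY]
    \<comment> \<open>Minimality of \<open>n\<close> puts every summand of the complement at level
      at least \<open>n\<close>, so Ext between \<open>Y\<close> and \<open>K\<close> vanishes in
      the required direction by additivity.\<close>
    have lK: "\<exists>m. lev m Z \<and> n \<le> m" if "indecomposable Z" "direct_summand Z K" for Z
      using lv[OF that(1) sub[OF that(2)]] min that(1) sub[OF that(2)] by blast
    from ext show ?thesis
    proof
      assume e: "\<forall>n m Y Z. lev n Y \<and> lev m Z \<and> n \<le> m \<longrightarrow> ext_zero Y Z"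
      have "ext_zero Y K"
        by (rule ext_zero_summands(1)[OF wY K]) (use e lK Y(3) in blast)
      from hall_subalg_ses[OF ses this cY[unfolded composition_algebra_def] cK[unfolded composition_algebra_def]]
      show ?thesis by (simp only: composition_algebra_def)
    next
      assume e: "\<forall>n m Y Z. lev n Y \<and> lev m Z \<and> n \<le> m \<longrightarrow> ext_zero Z Y"
      have "ext_zero K Y"
        by (rule ext_zero_summands(2)[OF wY K]) (use e lK Y(3) in blast)
      from hall_subalg_ses[OF ses_split_swap[OF ses f(1,3) q] this
          cK[unfolded composition_algebra_def] cY[unfolded composition_algebra_def]]
      show ?thesis by (simp only: composition_algebra_def)
    qed
  qed
qed

lemma preprojective_composition:
  fixes X :: "('v, 'e, 'k::{finite,field}) qrep"
  assumes "preprojective X"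
  shows "hall_basis (iso_class X) \<in> composition_algebra"
proof (rule level_composition)
  show "(\<forall>n m (Y :: ('v, 'e, 'k) qrep) Z. proj_level n Y \<and> proj_level m Z \<and> n \<le> m \<longrightarrow> ext_zero Y Z) \<or>
      (\<forall>n m (Y :: ('v, 'e, 'k) qrep) Z. proj_level n Y \<and> proj_level m Z \<and> n \<le> m \<longrightarrow> ext_zero Z Y)"
    using proj_level_ext by (meson not_less)
  show "\<exists>n. proj_level n Y" if "indecomposable Y" "direct_summand Y X" for Y
    by (rule preproj_indec_level) (use assms that in \<open>simp add: preprojective_def\<close>)
  show "wf_rep X" using assms by (simp add: preprojective_def)
qed (rule proj_level_exceptional)

lemma preinjective_composition:
  fixes X :: "('v, 'e, 'k::{finite,field}) qrep"
  assumes "preinjective X"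
  shows "hall_basis (iso_class X) \<in> composition_algebra"
proof (rule level_composition)
  show "(\<forall>n m (Y :: ('v, 'e, 'k) qrep) Z. inj_level n Y \<and> inj_level m Z \<and> n \<le> m \<longrightarrow> ext_zero Y Z) \<or>
      (\<forall>n m (Y :: ('v, 'e, 'k) qrep) Z. inj_level n Y \<and> inj_level m Z \<and> n \<le> m \<longrightarrow> ext_zero Z Y)"
    using inj_level_ext by (meson not_less)
  show "\<exists>n. inj_level n Y" if "indecomposable Y" "direct_summand Y X" for Y
    by (rule preinj_indec_level) (use assms that in \<open>simp add: preinjective_def\<close>)
  show "wf_rep X" using assms by (simp add: preinjective_def)
qed (rule inj_level_exceptional)

lemma preprojective_preinjective_composition:
  "preproj_algebra \<subseteq> (composition_algebra :: (('v, 'e, 'k::{finite,field}) qrep set \<Rightarrow> rat) set)"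
  "preinj_algebra \<subseteq> (composition_algebra :: (('v, 'e, 'k::{finite,field}) qrep set \<Rightarrow> rat) set)"
proof -
  show "preproj_algebra \<subseteq> (composition_algebra :: (('v, 'e, 'k) qrep set \<Rightarrow> rat) set)"
    unfolding preproj_algebra_def composition_algebra_def
    by (rule hall_subalg_least) (use preprojective_composition in \<open>auto simp: composition_algebra_def\<close>)
  show "preinj_algebra \<subseteq> (composition_algebra :: (('v, 'e, 'k) qrep set \<Rightarrow> rat) set)"
    unfolding preinj_algebra_def composition_algebra_def
    by (rule hall_subalg_least) (use preinjective_composition in \<open>auto simp: composition_algebra_def\<close>)
qed

end

theorem theorem2p3:
  fixes V :: "'v set" and E :: "'e set" and src tgt :: "'e \<Rightarrow> 'v"
  assumes "finite V" and "finite E"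
    and "src ` E \<subseteq> V" and "tgt ` E \<subseteq> V"
    and "acyclic {(src a, tgt a) | a. a \<in> E}"
  shows "(quiver.preproj_algebra V E src tgt :: (('v, 'e, 'k::{finite,field}) qrep set \<Rightarrow> rat) set)
           \<subseteq> quiver.composition_algebra V E src tgt
     \<and> (quiver.preinj_algebra V E src tgt :: (('v, 'e, 'k) qrep set \<Rightarrow> rat) set)
           \<subseteq> quiver.composition_algebra V E src tgt"
proof -
  interpret acyclic_quiver V E src tgt
    by unfold_locales (use assms in auto)
  show ?thesis using preprojective_preinjective_composition by blast
qed

end
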